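(* Let $n\ge2$, let $BS(n,n)=\langle a,b\mid ab^n=b^na\rangle$, and let $\sigma\in Z^2(BS(n,n),\mathbb{T})$. Then the following are equivalent: (i) $(BS(n,n),\sigma)$ satisfies Kleppner's condition. (ii) $(BS(n,n),\sigma)$ is $C^*$-simple. (iii) $(BS(n,n),\sigma)$ has the unique trace property. Hence, $BS(n,n)$ lies in $\mathcal{K}$.
   Context: For a discrete group $G$ with identity $e$, $Z^2(G,\mathbb{T})$ is the set of normalized 2-cocycles, i.e. maps $\sigma:G\times G\to\mathbb{T}$ with $\sigma(g,e)=\sigma(e,g)=1$ and $\sigma(g,h)\sigma(gh,k)=\sigma(h,k)\sigma(g,hk)$ for all $g,h,k$. With $(\lambda_\sigma(g)\xi)(h)=\sigma(g,g^{-1}h)\xi(g^{-1}h)$ on $\ell^2(G)$, $C_r^*(G,\sigma)$ is the C$^*$-algebra generated by $\lambda_\sigma(G)$. $(G,\sigma)$ is $C^*$-simple if $C_r^*(G,\sigma)$ is simple, and has the unique trace property if $C_r^*(G,\sigma)$ has a unique tracial state. An element $g\in G$ is $\sigma$-regular if $\sigma(g,h)=\sigma(h,g)$ whenever $h\in G$ commutes with $g$ (a property of conjugacy classes); $(G,\sigma)$ satisfies Kleppner's condition if every nontrivial $\sigma$-regular conjugacy class of $G$ is infinite. $\mathcal{K}$ is the class of groups $G$ such that for every $\sigma\in Z^2(G,\mathbb{T})$, $(G,\sigma)$ is $C^*$-simple if and only if it satisfies Kleppner's condition, and $(G,\sigma)$ has the unique trace property if and only if it satisfies Kleppner's condition.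 *)

theory Defs
  imports "HOL-Analysis.Analysis" "HOL-Algebra.Group"
begin

section \<open>Groups given by generators and relations\<close>

text \<open>A letter \<open>(s, True)\<close> stands for the generator \<open>s\<close> and \<open>(s, False)\<close> for its formal inverse.
  Every element of the type \<open>'s\<close> is a generator.\<close>

type_synonym 's word = "('s \<times> bool) list"

inductive pres_eq :: "('s word \<times> 's word) set \<Rightarrow> 's word \<Rightarrow> 's word \<Rightarrow> bool"
  for R :: "('s word \<times> 's word) set" where
  pres_refl: "pres_eq R u u"
| pres_sym: "pres_eq R u v \<Longrightarrow> pres_eq R v u"
| pres_trans: "pres_eq R u v \<Longrightarrow> pres_eq R v w \<Longrightarrow> pres_eq R u w"
| pres_ctxt: "pres_eq R u v \<Longrightarrow> pres_eq R (x @ u @ y) (x @ v @ y)"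
| pres_cancel: "pres_eq R [(s, e), (s, \<not> e)] []"
| pres_rel: "(u, v) \<in> R \<Longrightarrow> pres_eq R u v"

definition pres_class :: "('s word \<times> 's word) set \<Rightarrow> 's word \<Rightarrow> 's word set" where
  "pres_class R u = {v. pres_eq R u v}"

definition presented_group :: "('s word \<times> 's word) set \<Rightarrow> 's word set monoid" where
  "presented_group R =
     \<lparr>carrier = range (pres_class R),
      mult = (\<lambda>X Y. \<Union>u\<in>X. \<Union>v\<in>Y. pres_class R (u @ v)),
      one = pres_class R []\<rparr>"

datatype bs_gen = BS_a | BS_b

definition BS :: "nat \<Rightarrow> nat \<Rightarrow> bs_gen word set monoid" where
  "BS m n = presented_group
     {([(BS_a, True)] @ replicate m (BS_b, True), replicate n (BS_b, True) @ [(BS_a, True)])}"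


section \<open>Cocycles and Kleppner's condition\<close>

text \<open>Cocycles are functions on the whole type; only their values on the carrier matter.\<close>

definition two_cocycles :: "('a, 'b) monoid_scheme \<Rightarrow> ('a \<Rightarrow> 'a \<Rightarrow> complex) set" where
  "two_cocycles G = {\<sigma>.
     (\<forall>g\<in>carrier G. \<forall>h\<in>carrier G. cmod (\<sigma> g h) = 1) \<and>
     (\<forall>g\<in>carrier G. \<sigma> g \<one>\<^bsub>G\<^esub> = 1 \<and> \<sigma> \<one>\<^bsub>G\<^esub> g = 1) \<and>
     (\<forall>g\<in>carrier G. \<forall>h\<in>carrier G. \<forall>k\<in>carrier G.
        \<sigma> g h * \<sigma> (g \<otimes>\<^bsub>G\<^esub> h) k = \<sigma> h k * \<sigma> g (h \<otimes>\<^bsub>G\<^esub> k))}"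

definition sigma_regular :: "('a, 'b) monoid_scheme \<Rightarrow> ('a \<Rightarrow> 'a \<Rightarrow> complex) \<Rightarrow> 'a \<Rightarrow> bool" where
  "sigma_regular G \<sigma> g \<longleftrightarrow> g \<in> carrier G \<and>
     (\<forall>h\<in>carrier G. g \<otimes>\<^bsub>G\<^esub> h = h \<otimes>\<^bsub>G\<^esub> g \<longrightarrow> \<sigma> g h = \<sigma> h g)"

definition conj_class :: "('a, 'b) monoid_scheme \<Rightarrow> 'a \<Rightarrow> 'a set" where
  "conj_class G g = (\<lambda>h. h \<otimes>\<^bsub>G\<^esub> g \<otimes>\<^bsub>G\<^esub> inv\<^bsub>G\<^esub> h) ` carrier G"

definition kleppner_condition :: "('a, 'b) monoid_scheme \<Rightarrow> ('a \<Rightarrow> 'a \<Rightarrow> complex) \<Rightarrow> bool" where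
  "kleppner_condition G \<sigma> \<longleftrightarrow>
     (\<forall>g\<in>carrier G. g \<noteq> \<one>\<^bsub>G\<^esub> \<and> sigma_regular G \<sigma> g \<longrightarrow> infinite (conj_class G g))"


section \<open>Bounded operators on $\ell^2(S)$\<close>

text \<open>Vectors of $\ell^2(S)$ are functions on the whole type vanishing off \<open>S\<close>, and operators are
  functions sending everything outside $\ell^2(S)$ to zero.  So equality of vectors and of operators
  is equality of functions, the algebraic operations are pointwise, and the product is \<open>(\<circ>)\<close>.\<close>

type_synonym 'a vec2 = "'a \<Rightarrow> complex"
type_synonym 'a op2 = "'a vec2 \<Rightarrow> 'a vec2"

definition ell2 :: "'a set \<Rightarrow> 'a vec2 set" where
  "ell2 S = {\<xi>. (\<forall>x. x \<notin> S \<longrightarrow> \<xi> x = 0) \<and> (\<lambda>x. (cmod (\<xi> x))\<^sup>2) summable_on S}"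

definition ell2_inner :: "'a set \<Rightarrow> 'a vec2 \<Rightarrow> 'a vec2 \<Rightarrow> complex" where
  "ell2_inner S \<xi> \<eta> = (\<Sum>\<^sub>\<infinity>x\<in>S. \<xi> x * cnj (\<eta> x))"

definition ell2_norm :: "'a set \<Rightarrow> 'a vec2 \<Rightarrow> real" where
  "ell2_norm S \<xi> = sqrt (\<Sum>\<^sub>\<infinity>x\<in>S. (cmod (\<xi> x))\<^sup>2)"

definition op_zero :: "'a op2" where
  "op_zero = (\<lambda>\<xi> x. 0)"

definition op_id :: "'a set \<Rightarrow> 'a op2" where
  "op_id S = (\<lambda>\<xi>. if \<xi> \<in> ell2 S then \<xi> else (\<lambda>x. 0))"

definition op_add :: "'a op2 \<Rightarrow> 'a op2 \<Rightarrow> 'a op2" where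
  "op_add T U = (\<lambda>\<xi> x. T \<xi> x + U \<xi> x)"

definition op_diff :: "'a op2 \<Rightarrow> 'a op2 \<Rightarrow> 'a op2" where
  "op_diff T U = (\<lambda>\<xi> x. T \<xi> x - U \<xi> x)"

definition op_scale :: "complex \<Rightarrow> 'a op2 \<Rightarrow> 'a op2" where
  "op_scale c T = (\<lambda>\<xi> x. c * T \<xi> x)"

definition bounded_ops :: "'a set \<Rightarrow> 'a op2 set" where
  "bounded_ops S = {T.
     (\<forall>\<xi>\<in>ell2 S. T \<xi> \<in> ell2 S) \<and>
     (\<forall>\<xi>. \<xi> \<notin> ell2 S \<longrightarrow> T \<xi> = (\<lambda>x. 0)) \<and>
     (\<forall>\<xi>\<in>ell2 S. \<forall>\<eta>\<in>ell2 S. T (\<lambda>x. \<xi> x + \<eta> x) = (\<lambda>x. T \<xi> x + T \<eta> x)) \<and>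
     (\<forall>c. \<forall>\<xi>\<in>ell2 S. T (\<lambda>x. c * \<xi> x) = (\<lambda>x. c * T \<xi> x)) \<and>
     (\<exists>K. \<forall>\<xi>\<in>ell2 S. ell2_norm S (T \<xi>) \<le> K * ell2_norm S \<xi>)}"

definition op_norm :: "'a set \<Rightarrow> 'a op2 \<Rightarrow> real" where
  "op_norm S T = (SUP \<xi>\<in>{\<xi> \<in> ell2 S. ell2_norm S \<xi> \<le> 1}. ell2_norm S (T \<xi>))"

definition op_adj :: "'a set \<Rightarrow> 'a op2 \<Rightarrow> 'a op2" where
  "op_adj S T = (THE U. U \<in> bounded_ops S \<and>
     (\<forall>\<xi>\<in>ell2 S. \<forall>\<eta>\<in>ell2 S. ell2_inner S (T \<xi>) \<eta> = ell2_inner S \<xi> (U \<eta>)))"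


section \<open>C*-algebras of operators, simplicity and traces\<close>

definition op_subspace :: "'a op2 set \<Rightarrow> bool" where
  "op_subspace A \<longleftrightarrow> op_zero \<in> A \<and> (\<forall>T\<in>A. \<forall>U\<in>A. op_add T U \<in> A) \<and>
     (\<forall>c. \<forall>T\<in>A. op_scale c T \<in> A)"

definition op_norm_closed :: "'a set \<Rightarrow> 'a op2 set \<Rightarrow> bool" where
  "op_norm_closed S A \<longleftrightarrow>
     (\<forall>T\<in>bounded_ops S. (\<forall>e>0. \<exists>U\<in>A. op_norm S (op_diff T U) < e) \<longrightarrow> T \<in> A)"

definition cstar_subalgebra :: "'a set \<Rightarrow> 'a op2 set \<Rightarrow> bool" where
  "cstar_subalgebra S A \<longleftrightarrow> A \<subseteq> bounded_ops S \<and> op_subspace A \<and>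
     (\<forall>T\<in>A. \<forall>U\<in>A. T \<circ> U \<in> A) \<and> (\<forall>T\<in>A. op_adj S T \<in> A) \<and> op_norm_closed S A"

definition cstar_generated :: "'a set \<Rightarrow> 'a op2 set \<Rightarrow> 'a op2 set" where
  "cstar_generated S X = \<Inter>{A. cstar_subalgebra S A \<and> X \<subseteq> A}"

definition closed_two_sided_ideal :: "'a set \<Rightarrow> 'a op2 set \<Rightarrow> 'a op2 set \<Rightarrow> bool" where
  "closed_two_sided_ideal S A J \<longleftrightarrow> J \<subseteq> A \<and> op_subspace J \<and>
     (\<forall>T\<in>A. \<forall>U\<in>J. T \<circ> U \<in> J \<and> U \<circ> T \<in> J) \<and> op_norm_closed S J"

definition cstar_simple_algebra :: "'a set \<Rightarrow> 'a op2 set \<Rightarrow> bool" where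
  "cstar_simple_algebra S A \<longleftrightarrow>
     (\<forall>J. closed_two_sided_ideal S A J \<longrightarrow> J = {op_zero} \<or> J = A)"

text \<open>Tracial states on a C*-algebra \<open>A\<close> of operators on $\ell^2(S)$ containing the identity operator:
  unital positive linear functionals that are invariant under cyclic permutation.  Extensionality
  makes them functions on \<open>A\<close>, so that uniqueness has its usual meaning.\<close>

definition tracial_state :: "'a set \<Rightarrow> 'a op2 set \<Rightarrow> ('a op2 \<Rightarrow> complex) \<Rightarrow> bool" where
  "tracial_state S A \<phi> \<longleftrightarrow> \<phi> \<in> extensional A \<and>
     (\<forall>T\<in>A. \<forall>U\<in>A. \<phi> (op_add T U) = \<phi> T + \<phi> U) \<and>
     (\<forall>c. \<forall>T\<in>A. \<phi> (op_scale c T) = c * \<phi> T) \<and>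
     (\<forall>T\<in>A. \<phi> (op_adj S T \<circ> T) \<in> \<real> \<and> 0 \<le> Re (\<phi> (op_adj S T \<circ> T))) \<and>
     \<phi> (op_id S) = 1 \<and>
     (\<forall>T\<in>A. \<forall>U\<in>A. \<phi> (T \<circ> U) = \<phi> (U \<circ> T))"


section \<open>Reduced twisted group C*-algebras\<close>

definition twisted_regular ::
  "('a, 'b) monoid_scheme \<Rightarrow> ('a \<Rightarrow> 'a \<Rightarrow> complex) \<Rightarrow> 'a \<Rightarrow> 'a op2" where
  "twisted_regular G \<sigma> g = (\<lambda>\<xi> h. if \<xi> \<in> ell2 (carrier G) \<and> h \<in> carrier G
     then \<sigma> g (inv\<^bsub>G\<^esub> g \<otimes>\<^bsub>G\<^esub> h) * \<xi> (inv\<^bsub>G\<^esub> g \<otimes>\<^bsub>G\<^esub> h) else 0)"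

definition reduced_twisted_cstar ::
  "('a, 'b) monoid_scheme \<Rightarrow> ('a \<Rightarrow> 'a \<Rightarrow> complex) \<Rightarrow> 'a op2 set" where
  "reduced_twisted_cstar G \<sigma> =
     cstar_generated (carrier G) (twisted_regular G \<sigma> ` carrier G)"

definition twisted_cstar_simple ::
  "('a, 'b) monoid_scheme \<Rightarrow> ('a \<Rightarrow> 'a \<Rightarrow> complex) \<Rightarrow> bool" where
  "twisted_cstar_simple G \<sigma> \<longleftrightarrow>
     cstar_simple_algebra (carrier G) (reduced_twisted_cstar G \<sigma>)"

definition unique_trace_property ::
  "('a, 'b) monoid_scheme \<Rightarrow> ('a \<Rightarrow> 'a \<Rightarrow> complex) \<Rightarrow> bool" where
  "unique_trace_property G \<sigma> \<longleftrightarrow>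
     (\<exists>!\<phi>. tracial_state (carrier G) (reduced_twisted_cstar G \<sigma>) \<phi>)"

definition class_K :: "('a, 'b) monoid_scheme \<Rightarrow> bool" where
  "class_K G \<longleftrightarrow> group G \<and> (\<forall>\<sigma>\<in>two_cocycles G.
     (twisted_cstar_simple G \<sigma> \<longleftrightarrow> kleppner_condition G \<sigma>) \<and>
     (unique_trace_property G \<sigma> \<longleftrightarrow> kleppner_condition G \<sigma>))"

end

theory Submission
  imports Defs
begin

text \<open>
  Put \<open>z = b\<^sup>n\<close>.  It is central in \<open>G = BS(n,n)\<close> and has infinite order, and the quotient of \<open>G\<close> by
  \<open>Z = \<langle>z\<rangle>\<close> is the free product of the infinite cyclic group \<open>\<langle>a\<rangle>\<close> with a cyclic group of order \<open>n\<close>.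
  Such a free product has Powers' property: any finite set of nontrivial elements moves some set
  \<open>C\<close> off itself while arbitrarily many translates of the complement of \<open>C\<close> are pairwise disjoint.
  Lifted to \<open>G\<close> this is \<open>relative_powers\<close>, and everything below rests on it and on the two facts
  about \<open>Z\<close>.  For instance it makes every conjugacy class outside \<open>Z\<close> infinite, so Kleppner's
  condition says that no element of \<open>Z\<close> other than \<open>1\<close> is \<open>\<sigma>\<close>-regular (\<open>kleppner_iff\<close>).

  Assume Kleppner's condition.  A finite linear combination of the unitaries \<open>\<lambda>\<^sub>\<sigma>(g)\<close> is a scalar plus
  a part supported on \<open>Z - {1}\<close> plus a part supported off \<open>Z\<close>.  Means over conjugations by suitable
  unitaries make the last part small by Powers' estimate (\<open>powers_estimate\<close>).  They make the middle part
  small because a central element \<open>w\<close> that is not regular admits \<open>h\<close> such that conjugation by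
  \<open>\<lambda>\<^sub>\<sigma>(h)\<close> multiplies \<open>\<lambda>\<^sub>\<sigma>(w)\<close> by some \<open>\<omega> \<noteq> 1\<close>, and the means of the powers of \<open>\<omega>\<close> tend to zero
  (\<open>central_averaging_small\<close>).  So every element of the algebra has a scalar in the closed convex hull
  of its conjugates (\<open>dixmier_averaging\<close>).  Tracial states are bounded and constant on conjugates, so
  this scalar is the value of each of them; hence there is only one.  An ideal that contains \<open>T \<noteq> 0\<close>
  contains the means of \<open>T\<^sup>*T\<close>, hence the nonzero scalar \<open>\<tau>(T\<^sup>*T)\<close>, and is the whole algebra.

  If Kleppner's condition fails, some \<open>w \<noteq> 1\<close> in \<open>Z\<close> is regular.  Then \<open>\<lambda>\<^sub>\<sigma>(w)\<close> is central, and up to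
  scalars it acts on the cyclic subgroup generated by \<open>w\<close> as a bilateral shift.  Asymptotically fixed vectors of this shift define
  a proper closed ideal that contains \<open>\<lambda>\<^sub>\<sigma>(w) - 1\<close> (\<open>not_simple\<close>), and compressing the canonical trace by
  the central element \<open>1 + \<lambda>\<^sub>\<sigma>(w)\<close> gives a second tracial state (\<open>not_unique_trace\<close>).

  Powers' property is proved by ping-pong for an action of \<open>G\<close> on a countable set in which \<open>z\<close> acts
  trivially.  The action comes from bare bijections between countable sets (\<open>induced_action\<close>); a
  normal form is needed only to see that every element outside \<open>Z\<close>, conjugated by almost any power
  of \<open>a\<close>, moves one ping-pong set off itself (\<open>eventually_pong\<close>).
\<close>

section \<open>Square-summable functions\<close>

lemma ell2_off: "\<xi> \<in> ell2 S \<Longrightarrow> x \<notin> S \<Longrightarrow> \<xi> x = 0"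
  by (simp add: ell2_def)

lemma ell2_summable: "\<xi> \<in> ell2 S \<Longrightarrow> (\<lambda>x. (cmod (\<xi> x))\<^sup>2) summable_on S"
  by (simp add: ell2_def)

lemma ell2_norm_nonneg [simp]: "0 \<le> ell2_norm S \<xi>"
  by (simp add: ell2_norm_def infsum_nonneg)

lemma ell2_norm_square: "(ell2_norm S \<xi>)\<^sup>2 = (\<Sum>\<^sub>\<infinity>x\<in>S. (cmod (\<xi> x))\<^sup>2)"
  by (simp add: ell2_norm_def infsum_nonneg)

lemma L2_set_le_ell2_norm:
  assumes "\<xi> \<in> ell2 S" "finite F" "F \<subseteq> S"
  shows "L2_set (\<lambda>x. cmod (\<xi> x)) F \<le> ell2_norm S \<xi>"
  unfolding L2_set_def ell2_norm_def
  using finite_sum_le_infsum[OF ell2_summable[OF assms(1)] assms(2,3)] by simp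

text \<open>Finite subsets suffice to control norms, so the estimates for the whole space follow from those for \<open>L2_set\<close>.\<close>

lemma ell2_boundI:
  assumes off: "\<And>x. x \<notin> S \<Longrightarrow> \<xi> x = 0"
    and bd: "\<And>F. finite F \<Longrightarrow> F \<subseteq> S \<Longrightarrow> L2_set (\<lambda>x. cmod (\<xi> x)) F \<le> K"
  shows "\<xi> \<in> ell2 S" "ell2_norm S \<xi> \<le> K"
proof -
  have K: "0 \<le> K" using bd[of "{}"] by simp
  have sq: "(\<Sum>x\<in>F. (cmod (\<xi> x))\<^sup>2) \<le> K\<^sup>2" if "finite F" "F \<subseteq> S" for F
    using bd[OF that] unfolding L2_set_def by (metis real_sqrt_le_iff real_sqrt_abs abs_of_nonneg K)
  have sm: "(\<lambda>x. (cmod (\<xi> x))\<^sup>2) summable_on S"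
    by (rule nonneg_bdd_above_summable_on) (auto intro!: bdd_aboveI2[where M="K\<^sup>2"] sq)
  show "\<xi> \<in> ell2 S" using sm off by (simp add: ell2_def)
  have "(\<Sum>\<^sub>\<infinity>x\<in>S. (cmod (\<xi> x))\<^sup>2) \<le> K\<^sup>2"
    by (rule infsum_le_finite_sums[OF sm sq])
  then show "ell2_norm S \<xi> \<le> K"
    unfolding ell2_norm_def using K by (simp add: real_le_lsqrt infsum_nonneg)
qed

lemma ell2_zero [simp]: "(\<lambda>x. 0) \<in> ell2 S"
  by (simp add: ell2_def)

lemma ell2_norm_zero [simp]: "ell2_norm S (\<lambda>x. 0) = 0"
  by (simp add: ell2_norm_def)

lemma ell2_add:
  assumes "\<xi> \<in> ell2 S" "\<eta> \<in> ell2 S"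
  shows "(\<lambda>x. \<xi> x + \<eta> x) \<in> ell2 S"
    and "ell2_norm S (\<lambda>x. \<xi> x + \<eta> x) \<le> ell2_norm S \<xi> + ell2_norm S \<eta>"
proof -
  have bd: "L2_set (\<lambda>x. cmod (\<xi> x + \<eta> x)) F \<le> ell2_norm S \<xi> + ell2_norm S \<eta>"
    if F: "finite F" "F \<subseteq> S" for F
  proof -
    have "L2_set (\<lambda>x. cmod (\<xi> x + \<eta> x)) F \<le> L2_set (\<lambda>x. cmod (\<xi> x) + cmod (\<eta> x)) F"
      by (intro L2_set_mono norm_triangle_ineq) auto
    also have "\<dots> \<le> L2_set (\<lambda>x. cmod (\<xi> x)) F + L2_set (\<lambda>x. cmod (\<eta> x)) F"
      by (rule L2_set_triangle_ineq)
    finally show ?thesis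
      using L2_set_le_ell2_norm[OF assms(1) F] L2_set_le_ell2_norm[OF assms(2) F] by linarith
  qed
  have off: "\<xi> x + \<eta> x = 0" if "x \<notin> S" for x
    using that assms by (simp add: ell2_off)
  show "(\<lambda>x. \<xi> x + \<eta> x) \<in> ell2 S"
    and "ell2_norm S (\<lambda>x. \<xi> x + \<eta> x) \<le> ell2_norm S \<xi> + ell2_norm S \<eta>"
    by (rule ell2_boundI[OF off bd]; assumption)+
qed

lemma ell2_scale:
  assumes "\<xi> \<in> ell2 S"
  shows "(\<lambda>x. c * \<xi> x) \<in> ell2 S"
    and "ell2_norm S (\<lambda>x. c * \<xi> x) = cmod c * ell2_norm S \<xi>"
proof -
  show "(\<lambda>x. c * \<xi> x) \<in> ell2 S"
    using assms by (auto simp: ell2_def norm_mult power_mult_distrib intro: summable_on_cmult_right)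
  show "ell2_norm S (\<lambda>x. c * \<xi> x) = cmod c * ell2_norm S \<xi>"
    by (simp add: ell2_norm_def norm_mult power_mult_distrib infsum_cmult_right' real_sqrt_mult)
qed

lemma ell2_diff:
  assumes "\<xi> \<in> ell2 S" "\<eta> \<in> ell2 S"
  shows "(\<lambda>x. \<xi> x - \<eta> x) \<in> ell2 S"
    and "ell2_norm S (\<lambda>x. \<xi> x - \<eta> x) \<le> ell2_norm S \<xi> + ell2_norm S \<eta>"
  using ell2_add[OF assms(1) ell2_scale(1)[OF assms(2), of "-1"]]
    ell2_scale(2)[OF assms(2), of "-1"] by auto

lemma ell2_sum:
  assumes "\<And>i. i \<in> I \<Longrightarrow> \<xi> i \<in> ell2 S"
  shows "(\<lambda>x. \<Sum>i\<in>I. \<xi> i x) \<in> ell2 S"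
    and "ell2_norm S (\<lambda>x. \<Sum>i\<in>I. \<xi> i x) \<le> (\<Sum>i\<in>I. ell2_norm S (\<xi> i))"
proof -
  have "(\<lambda>x. \<Sum>i\<in>I. \<xi> i x) \<in> ell2 S \<and>
     ell2_norm S (\<lambda>x. \<Sum>i\<in>I. \<xi> i x) \<le> (\<Sum>i\<in>I. ell2_norm S (\<xi> i))"
    using assms
  proof (induction I rule: infinite_finite_induct)
    case (insert i I)
    then show ?case
      using ell2_add[of "\<xi> i" S "\<lambda>x. \<Sum>i\<in>I. \<xi> i x"] by (fastforce simp: algebra_simps)
  qed auto
  then show "(\<lambda>x. \<Sum>i\<in>I. \<xi> i x) \<in> ell2 S"
    and "ell2_norm S (\<lambda>x. \<Sum>i\<in>I. \<xi> i x) \<le> (\<Sum>i\<in>I. ell2_norm S (\<xi> i))" by auto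
qed

lemma ell2_norm_coordinate:
  assumes "\<xi> \<in> ell2 S"
  shows "cmod (\<xi> x) \<le> ell2_norm S \<xi>"
proof (cases "x \<in> S")
  case True
  then show ?thesis using L2_set_le_ell2_norm[OF assms, of "{x}"] by (simp add: L2_set_def)
qed (simp add: ell2_off[OF assms])

lemma ell2_norm_eq_0:
  assumes "\<xi> \<in> ell2 S" "ell2_norm S \<xi> = 0"
  shows "\<xi> = (\<lambda>x. 0)"
  using ell2_norm_coordinate[OF assms(1)] assms(2) by fastforce


definition ell2_restrict :: "'a set \<Rightarrow> 'a vec2 \<Rightarrow> 'a vec2" where
  "ell2_restrict Y \<xi> = (\<lambda>x. if x \<in> Y then \<xi> x else 0)"

lemma ell2_restrict:
  assumes "\<xi> \<in> ell2 S"
  shows "ell2_restrict Y \<xi> \<in> ell2 S"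
    and "ell2_norm S (ell2_restrict Y \<xi>) \<le> ell2_norm S \<xi>"
proof -
  have bd: "L2_set (\<lambda>x. cmod (ell2_restrict Y \<xi> x)) F \<le> ell2_norm S \<xi>" if "finite F" "F \<subseteq> S" for F
    using order_trans[OF L2_set_mono L2_set_le_ell2_norm[OF assms that],
        of "\<lambda>x. cmod (ell2_restrict Y \<xi> x)"]
    by (simp add: ell2_restrict_def)
  have off: "ell2_restrict Y \<xi> x = 0" if "x \<notin> S" for x
    using that assms by (simp add: ell2_off ell2_restrict_def)
  show "ell2_restrict Y \<xi> \<in> ell2 S" "ell2_norm S (ell2_restrict Y \<xi>) \<le> ell2_norm S \<xi>"
    by (rule ell2_boundI[OF off bd]; assumption)+
qed

text \<open>Finitely supported vectors are dense; this is what determines an operator by its matrix entries.\<close>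

lemma ell2_restrict_approx:
  assumes "\<xi> \<in> ell2 S" "e > 0"
  obtains F where "finite F" "F \<subseteq> S" "ell2_norm S (\<lambda>x. \<xi> x - ell2_restrict F \<xi> x) < e"
proof -
  let ?f = "\<lambda>x. (cmod (\<xi> x))\<^sup>2"
  have sm: "?f summable_on S" by (rule ell2_summable[OF assms(1)])
  obtain F where F: "finite F" "F \<subseteq> S" "dist (sum ?f F) (infsum ?f S) \<le> e\<^sup>2/2"
    using infsum_finite_approximation[OF sm, of "e\<^sup>2/2"] assms(2) by auto
  have "(ell2_norm S (\<lambda>x. \<xi> x - ell2_restrict F \<xi> x))\<^sup>2 = (\<Sum>\<^sub>\<infinity>x\<in>S-F. ?f x)"
    unfolding ell2_norm_square by (rule infsum_cong_neutral) (auto simp: ell2_restrict_def)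
  also have "\<dots> = infsum ?f S - sum ?f F"
    using infsum_Diff[OF sm _ F(2)] F(1) by (simp add: summable_on_finite)
  also have "\<dots> < e\<^sup>2" using F(3) zero_less_power[OF assms(2), of 2] unfolding dist_real_def by linarith
  finally have "ell2_norm S (\<lambda>x. \<xi> x - ell2_restrict F \<xi> x) < e"
    using assms(2) by (simp add: power2_less_imp_less)
  then show thesis using F that by blast
qed

definition ell2_basis :: "'a \<Rightarrow> 'a vec2" where
  "ell2_basis y = (\<lambda>x. if x = y then 1 else 0)"

lemma ell2_basis:
  assumes "y \<in> S"
  shows "ell2_basis y \<in> ell2 S" "ell2_norm S (ell2_basis y) = 1"
proof -
  have eq: "(\<lambda>x. (cmod (ell2_basis y x))\<^sup>2) = (\<lambda>x. if x = y then 1 else 0)"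
    by (auto simp: ell2_basis_def)
  have h: "((\<lambda>x. if x = y then 1 else (0::real)) has_sum 1) S"
  proof -
    have "((\<lambda>x. if x = y then 1 else (0::real)) has_sum 1) {y}" 
      using has_sum_finite[of "{y}" "\<lambda>x. if x = y then 1 else (0::real)"] by simp
    then show ?thesis
      by (rule has_sum_cong_neutral[THEN iffD1, rotated 3]) (use assms in auto)
  qed
  show "ell2_basis y \<in> ell2 S"
    using has_sum_imp_summable[OF h] assms unfolding ell2_def mem_Collect_eq eq
    by (auto simp: ell2_basis_def)
  show "ell2_norm S (ell2_basis y) = 1"
    unfolding ell2_norm_def eq using infsumI[OF h] by simp
qed

lemma ell2_inner_abs_summable:
  assumes "\<xi> \<in> ell2 S" "\<eta> \<in> ell2 S"
  shows "(\<lambda>x. norm (\<xi> x * cnj (\<eta> x))) summable_on S"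
    and "(\<Sum>\<^sub>\<infinity>x\<in>S. norm (\<xi> x * cnj (\<eta> x))) \<le> ell2_norm S \<xi> * ell2_norm S \<eta>"
proof -
  have bd: "(\<Sum>x\<in>F. norm (\<xi> x * cnj (\<eta> x))) \<le> ell2_norm S \<xi> * ell2_norm S \<eta>"
    if F: "finite F" "F \<subseteq> S" for F
  proof -
    have "(\<Sum>x\<in>F. norm (\<xi> x * cnj (\<eta> x))) = (\<Sum>x\<in>F. \<bar>cmod (\<xi> x)\<bar> * \<bar>cmod (\<eta> x)\<bar>)"
      by (simp add: norm_mult)
    also have "\<dots> \<le> L2_set (\<lambda>x. cmod (\<xi> x)) F * L2_set (\<lambda>x. cmod (\<eta> x)) F"
      by (rule L2_set_mult_ineq)
    also have "\<dots> \<le> ell2_norm S \<xi> * ell2_norm S \<eta>"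
      using L2_set_le_ell2_norm[OF assms(1) F] L2_set_le_ell2_norm[OF assms(2) F]
      by (intro mult_mono) auto
    finally show ?thesis .
  qed
  show sm: "(\<lambda>x. norm (\<xi> x * cnj (\<eta> x))) summable_on S"
    by (rule nonneg_bdd_above_summable_on)
      (auto intro!: bdd_aboveI2[where M="ell2_norm S \<xi> * ell2_norm S \<eta>"] bd)
  show "(\<Sum>\<^sub>\<infinity>x\<in>S. norm (\<xi> x * cnj (\<eta> x))) \<le> ell2_norm S \<xi> * ell2_norm S \<eta>"
    by (rule infsum_le_finite_sums[OF sm bd])
qed

lemma ell2_inner_summable:
  assumes "\<xi> \<in> ell2 S" "\<eta> \<in> ell2 S"
  shows "(\<lambda>x. \<xi> x * cnj (\<eta> x)) summable_on S"
  using ell2_inner_abs_summable(1)[OF assms] by (rule abs_summable_summable)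

lemma ell2_cauchy_schwarz:
  assumes "\<xi> \<in> ell2 S" "\<eta> \<in> ell2 S"
  shows "cmod (ell2_inner S \<xi> \<eta>) \<le> ell2_norm S \<xi> * ell2_norm S \<eta>"
  unfolding ell2_inner_def
  using norm_infsum_bound[OF ell2_inner_abs_summable(1)[OF assms]] ell2_inner_abs_summable(2)[OF assms]
  by linarith

lemma ell2_inner_add:
  assumes "\<xi> \<in> ell2 S" "\<eta> \<in> ell2 S" "\<zeta> \<in> ell2 S"
  shows "ell2_inner S (\<lambda>x. \<xi> x + \<eta> x) \<zeta> = ell2_inner S \<xi> \<zeta> + ell2_inner S \<eta> \<zeta>"
    and "ell2_inner S \<zeta> (\<lambda>x. \<xi> x + \<eta> x) = ell2_inner S \<zeta> \<xi> + ell2_inner S \<zeta> \<eta>"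
  unfolding ell2_inner_def using assms
  by (simp_all add: algebra_simps flip: infsum_add[OF ell2_inner_summable ell2_inner_summable])

lemma ell2_inner_scale:
  shows "ell2_inner S (\<lambda>x. c * \<xi> x) \<eta> = c * ell2_inner S \<xi> \<eta>"
    and "ell2_inner S \<xi> (\<lambda>x. c * \<eta> x) = cnj c * ell2_inner S \<xi> \<eta>"
  unfolding ell2_inner_def
  by (simp_all add: mult.assoc mult.left_commute[of _ "cnj c"] infsum_cmult_right')

lemma ell2_inner_diff:
  assumes "\<xi> \<in> ell2 S" "\<eta> \<in> ell2 S" "\<zeta> \<in> ell2 S"
  shows "ell2_inner S (\<lambda>x. \<xi> x - \<eta> x) \<zeta> = ell2_inner S \<xi> \<zeta> - ell2_inner S \<eta> \<zeta>"
    and "ell2_inner S \<zeta> (\<lambda>x. \<xi> x - \<eta> x) = ell2_inner S \<zeta> \<xi> - ell2_inner S \<zeta> \<eta>"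
  using ell2_inner_add[OF assms(1) ell2_scale(1)[OF assms(2), of "-1"] assms(3)]
    ell2_inner_scale(1)[of S "-1" \<eta> \<zeta>] ell2_inner_scale(2)[of S \<zeta> "-1" \<eta>] by simp_all

lemma ell2_inner_zero [simp]:
  "ell2_inner S (\<lambda>x. 0) \<eta> = 0" "ell2_inner S \<eta> (\<lambda>x. 0) = 0"
  by (simp_all add: ell2_inner_def)

lemma ell2_inner_commute: "ell2_inner S \<eta> \<xi> = cnj (ell2_inner S \<xi> \<eta>)"
  unfolding ell2_inner_def by (simp add: mult.commute flip: infsum_cnj)

lemma ell2_inner_self:
  assumes "\<xi> \<in> ell2 S"
  shows "ell2_inner S \<xi> \<xi> = complex_of_real ((ell2_norm S \<xi>)\<^sup>2)"
  unfolding ell2_norm_square ell2_inner_def complex_norm_square[symmetric]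
  by (rule infsumI[OF has_sum_of_real[OF has_sum_infsum[OF ell2_summable[OF assms]]]])

lemma ell2_inner_basis:
  assumes "y \<in> S"
  shows "ell2_inner S (ell2_basis y) \<xi> = cnj (\<xi> y)" "ell2_inner S \<xi> (ell2_basis y) = \<xi> y"
proof -
  have "ell2_inner S \<xi> (ell2_basis y) = (\<Sum>\<^sub>\<infinity>x\<in>{y}. \<xi> x)" for \<xi>
    unfolding ell2_inner_def by (rule infsum_cong_neutral) (use assms in \<open>auto simp: ell2_basis_def\<close>)
  then show *: "ell2_inner S \<xi> (ell2_basis y) = \<xi> y" for \<xi> by simp
  show "ell2_inner S (ell2_basis y) \<xi> = cnj (\<xi> y)"
    by (subst ell2_inner_commute) (simp add: *)
qed


section \<open>Bounded operators\<close>

lemma bounded_opsD: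
  assumes "T \<in> bounded_ops S"
  shows "\<xi> \<in> ell2 S \<Longrightarrow> T \<xi> \<in> ell2 S"
    and "\<xi> \<notin> ell2 S \<Longrightarrow> T \<xi> = (\<lambda>x. 0)"
    and "\<xi> \<in> ell2 S \<Longrightarrow> \<eta> \<in> ell2 S \<Longrightarrow> T (\<lambda>x. \<xi> x + \<eta> x) = (\<lambda>x. T \<xi> x + T \<eta> x)"
    and "\<xi> \<in> ell2 S \<Longrightarrow> T (\<lambda>x. c * \<xi> x) = (\<lambda>x. c * T \<xi> x)"
  using assms by (auto simp: bounded_ops_def)

lemma bounded_ops_zero: "T \<in> bounded_ops S \<Longrightarrow> T (\<lambda>x. 0) = (\<lambda>x. 0)"
  using bounded_opsD(4)[of T S "\<lambda>x. 0" 0] by simp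

lemma bounded_ops_ell2 [simp]: "T \<in> bounded_ops S \<Longrightarrow> T \<xi> \<in> ell2 S"
  using bounded_opsD(1,2)[of T S \<xi>] by (cases "\<xi> \<in> ell2 S") auto

lemma bounded_ops_diff:
  assumes "T \<in> bounded_ops S" "\<xi> \<in> ell2 S" "\<eta> \<in> ell2 S"
  shows "T (\<lambda>x. \<xi> x - \<eta> x) = (\<lambda>x. T \<xi> x - T \<eta> x)"
  using bounded_opsD(3)[OF assms(1,2) ell2_scale(1)[OF assms(3), of "-1"]]
    bounded_opsD(4)[OF assms(1,3), of "-1"] by (simp add: fun_eq_iff)

lemma bounded_ops_sum:
  assumes "T \<in> bounded_ops S" "\<And>i. i \<in> I \<Longrightarrow> \<xi> i \<in> ell2 S"
  shows "T (\<lambda>x. \<Sum>i\<in>I. \<xi> i x) = (\<lambda>x. \<Sum>i\<in>I. T (\<xi> i) x)"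
  using assms(2)
proof (induction I rule: infinite_finite_induct)
  case (insert i I)
  then show ?case
    using bounded_opsD(3)[OF assms(1), of "\<xi> i" "\<lambda>x. \<Sum>i\<in>I. \<xi> i x"] by (simp add: ell2_sum(1))
qed (simp_all add: bounded_ops_zero[OF assms(1)])

lemma bounded_ops_bdd_above:
  assumes "T \<in> bounded_ops S"
  shows "bdd_above ((\<lambda>\<xi>. ell2_norm S (T \<xi>)) ` {\<xi> \<in> ell2 S. ell2_norm S \<xi> \<le> 1})"
proof -
  obtain K where K: "\<forall>\<xi>\<in>ell2 S. ell2_norm S (T \<xi>) \<le> K * ell2_norm S \<xi>"
    using assms unfolding bounded_ops_def by blast
  show ?thesis
  proof (rule bdd_aboveI2[where M="\<bar>K\<bar>"])
    fix \<xi> assume x: "\<xi> \<in> {\<xi> \<in> ell2 S. ell2_norm S \<xi> \<le> 1}"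
    then have "ell2_norm S (T \<xi>) \<le> K * ell2_norm S \<xi>" using K by blast
    also have "\<dots> \<le> \<bar>K\<bar> * 1" using x by (intro mult_mono) auto
    finally show "ell2_norm S (T \<xi>) \<le> \<bar>K\<bar>" by simp
  qed
qed

lemma op_norm_ge:
  assumes "T \<in> bounded_ops S" "\<xi> \<in> ell2 S"
  shows "ell2_norm S (T \<xi>) \<le> op_norm S T * ell2_norm S \<xi>"
proof (cases "ell2_norm S \<xi> = 0")
  case True
  then have "\<xi> = (\<lambda>x. 0)" by (rule ell2_norm_eq_0[OF assms(2)])
  then show ?thesis by (simp only: bounded_ops_zero[OF assms(1)] ell2_norm_zero)
next
  case False
  then have pos: "ell2_norm S \<xi> > 0" using ell2_norm_nonneg[of S \<xi>] by linarith
  define c where "c = complex_of_real (1 / ell2_norm S \<xi>)"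
  have c: "cmod c = 1 / ell2_norm S \<xi>" using pos by (simp add: c_def norm_divide)
  note bdd = bounded_ops_bdd_above[OF assms(1)]
  have "ell2_norm S (\<lambda>x. c * \<xi> x) \<le> 1"
    unfolding ell2_scale(2)[OF assms(2)] c using pos by simp
  then have "ell2_norm S (T (\<lambda>x. c * \<xi> x)) \<le> op_norm S T"
    unfolding op_norm_def by (intro cSUP_upper[OF _ bdd] CollectI conjI ell2_scale(1) assms(2))
  also have "T (\<lambda>x. c * \<xi> x) = (\<lambda>x. c * T \<xi> x)"
    by (rule bounded_opsD(4)[OF assms])
  also have "ell2_norm S \<dots> = ell2_norm S (T \<xi>) / ell2_norm S \<xi>"
    by (simp add: ell2_scale(2)[OF bounded_opsD(1)[OF assms]] c)
  finally show ?thesis using pos by (simp add: pos_divide_le_eq)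
qed

lemma op_norm_le:
  assumes "0 \<le> K" "\<And>\<xi>. \<xi> \<in> ell2 S \<Longrightarrow> ell2_norm S (T \<xi>) \<le> K * ell2_norm S \<xi>"
  shows "op_norm S T \<le> K"
  unfolding op_norm_def
proof (rule cSUP_least)
  show "{\<xi> \<in> ell2 S. ell2_norm S \<xi> \<le> 1} \<noteq> {}" using ell2_zero[of S] by fastforce
  fix \<xi> assume "\<xi> \<in> {\<xi> \<in> ell2 S. ell2_norm S \<xi> \<le> 1}"
  then show "ell2_norm S (T \<xi>) \<le> K"
    using assms(2)[of \<xi>] mult_left_mono[OF _ assms(1), of "ell2_norm S \<xi>" 1] by force
qed

lemma op_norm_nonneg [simp]:
  assumes "T \<in> bounded_ops S"
  shows "0 \<le> op_norm S T"
proof -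
  have "ell2_norm S (T (\<lambda>x. 0)) \<le> op_norm S T"
    unfolding op_norm_def by (rule cSUP_upper[OF _ bounded_ops_bdd_above[OF assms]]) simp
  then show ?thesis by (simp only: bounded_ops_zero[OF assms] ell2_norm_zero)
qed

lemma bounded_opsI:
  assumes "\<And>\<xi>. \<xi> \<in> ell2 S \<Longrightarrow> T \<xi> \<in> ell2 S"
    and "\<And>\<xi>. \<xi> \<notin> ell2 S \<Longrightarrow> T \<xi> = (\<lambda>x. 0)"
    and "\<And>\<xi> \<eta>. \<xi> \<in> ell2 S \<Longrightarrow> \<eta> \<in> ell2 S \<Longrightarrow> T (\<lambda>x. \<xi> x + \<eta> x) = (\<lambda>x. T \<xi> x + T \<eta> x)"
    and "\<And>c \<xi>. \<xi> \<in> ell2 S \<Longrightarrow> T (\<lambda>x. c * \<xi> x) = (\<lambda>x. c * T \<xi> x)"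
    and "\<And>\<xi>. \<xi> \<in> ell2 S \<Longrightarrow> ell2_norm S (T \<xi>) \<le> K * ell2_norm S \<xi>"
  shows "T \<in> bounded_ops S"
  unfolding bounded_ops_def using assms by blast

lemma op_eqI:
  assumes "T \<in> bounded_ops S" "U \<in> bounded_ops S" "\<And>\<xi>. \<xi> \<in> ell2 S \<Longrightarrow> T \<xi> = U \<xi>"
  shows "T = U"
proof
  fix \<xi> show "T \<xi> = U \<xi>"
    using assms bounded_opsD(2)[OF assms(1)] bounded_opsD(2)[OF assms(2)]
    by (cases "\<xi> \<in> ell2 S") auto
qed

lemma op_zero_bounded [simp]: "op_zero \<in> bounded_ops S"
  by (rule bounded_opsI[where K=0]) (auto simp: op_zero_def)

lemma op_id_bounded [simp]: "op_id S \<in> bounded_ops S"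
  by (rule bounded_opsI[where K=1]) (auto simp: op_id_def ell2_add ell2_scale)

lemma op_id_apply [simp]: "\<xi> \<in> ell2 S \<Longrightarrow> op_id S \<xi> = \<xi>"
  by (simp add: op_id_def)

lemma op_norm_zero [simp]: "op_norm S op_zero = 0"
  by (rule antisym[OF op_norm_le]) (auto simp: op_zero_def[THEN fun_cong])

lemma op_norm_id: "op_norm S (op_id S) \<le> 1"
  by (rule op_norm_le) auto

lemma op_add_bounded:
  assumes "T \<in> bounded_ops S" "U \<in> bounded_ops S"
  shows "op_add T U \<in> bounded_ops S" "op_norm S (op_add T U) \<le> op_norm S T + op_norm S U"
proof -
  have b: "ell2_norm S (op_add T U \<xi>) \<le> (op_norm S T + op_norm S U) * ell2_norm S \<xi>" if "\<xi> \<in> ell2 S" for \<xi>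
    using ell2_add(2)[of "T \<xi>" S "U \<xi>"] op_norm_ge[OF assms(1) that] op_norm_ge[OF assms(2) that] assms
    by (simp add: op_add_def algebra_simps)
  show "op_add T U \<in> bounded_ops S"
    by (rule bounded_opsI[OF _ _ _ _ b])
      (use assms in \<open>auto simp: op_add_def ell2_add bounded_opsD algebra_simps\<close>)
  show "op_norm S (op_add T U) \<le> op_norm S T + op_norm S U"
    by (rule op_norm_le[OF _ b]) (use assms in auto)
qed

lemma op_scale_bounded:
  assumes "T \<in> bounded_ops S"
  shows "op_scale c T \<in> bounded_ops S" "op_norm S (op_scale c T) \<le> cmod c * op_norm S T"
proof -
  have b: "ell2_norm S (op_scale c T \<xi>) \<le> (cmod c * op_norm S T) * ell2_norm S \<xi>" if "\<xi> \<in> ell2 S" for \<xi>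
    using ell2_scale(2)[of "T \<xi>" S c] op_norm_ge[OF assms(1) that] assms
    by (simp add: op_scale_def mult.assoc mult_left_mono)
  show "op_scale c T \<in> bounded_ops S"
    by (rule bounded_opsI[OF _ _ _ _ b])
      (use assms in \<open>auto simp: op_scale_def ell2_scale bounded_opsD algebra_simps\<close>)
  show "op_norm S (op_scale c T) \<le> cmod c * op_norm S T"
    by (rule op_norm_le[OF _ b]) (use assms in auto)
qed

lemma op_diff_eq: "op_diff T U = op_add T (op_scale (-1) U)"
  by (simp add: op_diff_def op_add_def op_scale_def)

lemma op_diff_bounded:
  assumes "T \<in> bounded_ops S" "U \<in> bounded_ops S"
  shows "op_diff T U \<in> bounded_ops S" "op_norm S (op_diff T U) \<le> op_norm S T + op_norm S U"
  using op_add_bounded[OF assms(1) op_scale_bounded(1)[OF assms(2), of "-1"]]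
    op_scale_bounded(2)[OF assms(2), of "-1"] by (auto simp: op_diff_eq)

lemma op_comp_bounded:
  assumes "T \<in> bounded_ops S" "U \<in> bounded_ops S"
  shows "T \<circ> U \<in> bounded_ops S" "op_norm S (T \<circ> U) \<le> op_norm S T * op_norm S U"
proof -
  have b: "ell2_norm S ((T \<circ> U) \<xi>) \<le> (op_norm S T * op_norm S U) * ell2_norm S \<xi>" if "\<xi> \<in> ell2 S" for \<xi>
  proof -
    have "ell2_norm S (T (U \<xi>)) \<le> op_norm S T * ell2_norm S (U \<xi>)"
      by (intro op_norm_ge bounded_ops_ell2 assms)
    also have "\<dots> \<le> op_norm S T * (op_norm S U * ell2_norm S \<xi>)"
      using op_norm_ge[OF assms(2) that] assms by (intro mult_left_mono) auto
    finally show ?thesis by (simp add: mult.assoc)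
  qed
  show "T \<circ> U \<in> bounded_ops S"
    by (rule bounded_opsI[OF _ _ _ _ b])
      (use assms bounded_opsD(2)[OF assms(2)] bounded_ops_zero[OF assms(1)] in \<open>auto simp: bounded_opsD(3,4)[OF assms(1)] bounded_opsD(3,4)[OF assms(2)]\<close>)
  show "op_norm S (T \<circ> U) \<le> op_norm S T * op_norm S U"
    by (rule op_norm_le[OF _ b]) (use assms in auto)
qed

lemmas op_bounded = op_zero_bounded op_id_bounded op_add_bounded(1) op_scale_bounded(1)
  op_diff_bounded(1) op_comp_bounded(1)

lemma op_comp_add:
  assumes "T \<in> bounded_ops S" "U \<in> bounded_ops S" "V \<in> bounded_ops S"
  shows "T \<circ> op_add U V = op_add (T \<circ> U) (T \<circ> V)" "op_add U V \<circ> T = op_add (U \<circ> T) (V \<circ> T)"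
  using assms bounded_opsD(3)[OF assms(1), of "U _" "V _"] by (auto simp: op_add_def fun_eq_iff)

lemma op_comp_diff:
  assumes "T \<in> bounded_ops S" "U \<in> bounded_ops S" "V \<in> bounded_ops S"
  shows "T \<circ> op_diff U V = op_diff (T \<circ> U) (T \<circ> V)" "op_diff U V \<circ> T = op_diff (U \<circ> T) (V \<circ> T)"
  using assms bounded_ops_diff[OF assms(1), of "U _" "V _"] by (auto simp: op_diff_def fun_eq_iff)

lemma op_comp_scale:
  assumes "T \<in> bounded_ops S" "U \<in> bounded_ops S"
  shows "T \<circ> op_scale c U = op_scale c (T \<circ> U)" "op_scale c U \<circ> T = op_scale c (U \<circ> T)"
  using assms bounded_opsD(4)[OF assms(1), of "U _"] by (auto simp: op_scale_def fun_eq_iff)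

lemma op_comp_id:
  assumes "T \<in> bounded_ops S"
  shows "T \<circ> op_id S = T" "op_id S \<circ> T = T"
  using assms by (auto intro!: op_eqI[of _ S] op_comp_bounded)

lemma op_comp_zero:
  assumes "T \<in> bounded_ops S"
  shows "T \<circ> op_zero = op_zero" "op_zero \<circ> T = op_zero"
  using bounded_ops_zero[OF assms] by (auto simp: op_zero_def)

lemma op_scale_scale: "op_scale c (op_scale d T) = op_scale (c * d) T"
  by (simp add: op_scale_def mult.assoc)

lemma op_scale_one [simp]: "op_scale 1 T = T"
  by (simp add: op_scale_def)

lemma op_scale_zero: "op_scale 0 T = op_zero"
  by (simp add: op_scale_def op_zero_def)

lemma op_diff_triangle:
  assumes "T \<in> bounded_ops S" "U \<in> bounded_ops S" "V \<in> bounded_ops S"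
  shows "op_norm S (op_diff T V) \<le> op_norm S (op_diff T U) + op_norm S (op_diff U V)"
proof -
  have "op_diff T V = op_add (op_diff T U) (op_diff U V)" by (auto simp: op_add_def op_diff_def)
  then show ?thesis using op_add_bounded(2) op_diff_bounded(1) assms by metis
qed

lemma op_diff_commute_norm:
  assumes "T \<in> bounded_ops S" "U \<in> bounded_ops S"
  shows "op_norm S (op_diff T U) = op_norm S (op_diff U T)"
proof -
  have *: "op_norm S (op_diff T U) \<le> op_norm S (op_diff U T)" 
    if "T \<in> bounded_ops S" "U \<in> bounded_ops S" for T U
  proof -
    have "op_diff T U = op_scale (-1) (op_diff U T)" by (auto simp: op_diff_def op_scale_def)
    then show ?thesis using op_scale_bounded(2)[OF op_diff_bounded(1)[OF that(2,1)], of "-1"] by simp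
  qed
  then show ?thesis using assms by (simp add: antisym)
qed

lemma op_norm_eq_0:
  assumes "T \<in> bounded_ops S" "op_norm S T \<le> 0"
  shows "T = op_zero"
proof (rule op_eqI[OF assms(1) op_zero_bounded])
  fix \<xi> assume x: "\<xi> \<in> ell2 S"
  have "op_norm S T * ell2_norm S \<xi> \<le> 0"
    using assms(2) by (intro mult_nonpos_nonneg) auto
  with op_norm_ge[OF assms(1) x] have "ell2_norm S (T \<xi>) = 0"
    using ell2_norm_nonneg[of S "T \<xi>"] by linarith
  then show "T \<xi> = op_zero \<xi>" using ell2_norm_eq_0[of "T \<xi>" S] assms(1) by (simp add: op_zero_def)
qed

lemma op_diff_self: "op_diff T T = op_zero"
  by (simp add: op_diff_def op_zero_def)

lemma op_diff_eq_zeroD: "op_diff T U = op_zero \<Longrightarrow> T = U"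
  by (auto simp: op_diff_def op_zero_def fun_eq_iff)


section \<open>Adjoints\<close>

lemma ell2_finite_support:
  assumes "finite F" "F \<subseteq> S"
  shows "ell2_restrict F c \<in> ell2 S" "ell2_norm S (ell2_restrict F c) \<le> L2_set (\<lambda>x. cmod (c x)) F"
proof -
  have bd: "L2_set (\<lambda>x. cmod (ell2_restrict F c x)) H \<le> L2_set (\<lambda>x. cmod (c x)) F" if "finite H" for H
  proof -
    have "(\<Sum>x\<in>H. (cmod (ell2_restrict F c x))\<^sup>2) = (\<Sum>x\<in>H\<inter>F. (cmod (c x))\<^sup>2)"
      using that assms by (intro sum.mono_neutral_cong_right) (auto simp: ell2_restrict_def)
    also have "\<dots> \<le> (\<Sum>x\<in>F. (cmod (c x))\<^sup>2)"
      using assms by (intro sum_mono2) auto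
    finally show ?thesis by (simp add: L2_set_def)
  qed
  have off: "ell2_restrict F c x = 0" if "x \<notin> S" for x
    using that assms by (auto simp: ell2_restrict_def)
  show "ell2_restrict F c \<in> ell2 S" "ell2_norm S (ell2_restrict F c) \<le> L2_set (\<lambda>x. cmod (c x)) F"
    by (rule ell2_boundI[OF off bd]; assumption)+
qed

lemma bounded_ops_finite_support:
  assumes "T \<in> bounded_ops S" "\<eta> \<in> ell2 S" "finite F" "F \<subseteq> S"
  shows "ell2_inner S (T (ell2_restrict F c)) \<eta> = (\<Sum>y\<in>F. c y * ell2_inner S (T (ell2_basis y)) \<eta>)"
  using assms(3,4)
proof (induction F rule: finite_induct)
  case empty
  then show ?case by (simp add: ell2_restrict_def bounded_ops_zero[OF assms(1)])
next
  case (insert y F)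
  have eq: "ell2_restrict (insert y F) c = (\<lambda>x. (c y * ell2_basis y x) + ell2_restrict F c x)"
    using insert by (auto simp: ell2_restrict_def ell2_basis_def)
  have y: "ell2_basis y \<in> ell2 S" using insert by (auto intro: ell2_basis)
  have 1: "ell2_restrict F c \<in> ell2 S" using insert by (auto intro: ell2_finite_support)
  show ?case unfolding eq bounded_opsD(3)[OF assms(1) ell2_scale(1)[OF y] 1] bounded_opsD(4)[OF assms(1) y]
    using assms insert y 1 by (simp add: ell2_inner_add ell2_scale ell2_inner_scale)
qed

text \<open>The candidate for the adjoint has the matrix that it must have: the coordinate of \<open>U \<eta>\<close> at \<open>x\<close> is the
  inner product of \<open>\<eta>\<close> with \<open>T \<delta>\<^sub>x\<close>.  Evaluating \<open>T\<close> on truncations of \<open>U \<eta>\<close> itself bounds the norm of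
  \<open>U \<eta>\<close>, and the adjoint relation extends from finitely supported vectors by density.\<close>

lemma op_adjoint_exists:
  assumes T: "T \<in> bounded_ops S"
  shows "\<exists>U\<in>bounded_ops S. op_norm S U \<le> op_norm S T \<and>
    (\<forall>\<xi>\<in>ell2 S. \<forall>\<eta>\<in>ell2 S. ell2_inner S (T \<xi>) \<eta> = ell2_inner S \<xi> (U \<eta>))"
proof -
  define U :: "'a op2" where "U = (\<lambda>\<eta> x. if \<eta> \<in> ell2 S \<and> x \<in> S then ell2_inner S \<eta> (T (ell2_basis x)) else 0)"
  have b: "U \<eta> \<in> ell2 S" "ell2_norm S (U \<eta>) \<le> op_norm S T * ell2_norm S \<eta>" if \<eta>: "\<eta> \<in> ell2 S" for \<eta>
  proof -
    have bd: "L2_set (\<lambda>x. cmod (U \<eta> x)) F \<le> op_norm S T * ell2_norm S \<eta>" if F: "finite F" "F \<subseteq> S" for F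
    proof -
      let ?v = "ell2_restrict F (U \<eta>)" and ?L = "L2_set (\<lambda>x. cmod (U \<eta> x)) F"
      note v = ell2_finite_support[OF F, of "U \<eta>"]
      have "complex_of_real (?L\<^sup>2) = (\<Sum>y\<in>F. U \<eta> y * ell2_inner S (T (ell2_basis y)) \<eta>)"
        unfolding L2_set_def using F \<eta> 
        by (auto simp: sum_nonneg complex_norm_square U_def ell2_inner_commute[of S \<eta>] simp del: of_real_power intro!: sum.cong)
      also have "\<dots> = ell2_inner S (T ?v) \<eta>"
        using bounded_ops_finite_support[OF T \<eta> F] by simp
      finally have "?L\<^sup>2 = cmod (ell2_inner S (T ?v) \<eta>)"
        by (metis norm_of_real abs_of_nonneg zero_le_power2)
      also have "\<dots> \<le> ell2_norm S (T ?v) * ell2_norm S \<eta>"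
        by (intro ell2_cauchy_schwarz bounded_ops_ell2 T \<eta>)
      also have "\<dots> \<le> (op_norm S T * ?L) * ell2_norm S \<eta>"
        using order_trans[OF op_norm_ge[OF T v(1)] mult_left_mono[OF v(2)]] T
        by (intro mult_right_mono) auto
      finally have "?L * ?L \<le> (op_norm S T * ell2_norm S \<eta>) * ?L"
        by (simp add: power2_eq_square mult_ac)
      then show ?thesis
        using T L2_set_nonneg[of "\<lambda>x. cmod (U \<eta> x)" F]
        by (cases "?L = 0") (auto simp: mult_le_cancel_right)
    qed
    have off: "U \<eta> x = 0" if "x \<notin> S" for x using that by (simp add: U_def)
    show "U \<eta> \<in> ell2 S" "ell2_norm S (U \<eta>) \<le> op_norm S T * ell2_norm S \<eta>"
      by (rule ell2_boundI[OF off bd]; assumption)+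
  qed
  have U: "U \<in> bounded_ops S"
    by (rule bounded_opsI[OF b(1) _ _ _ b(2)])
      (use T in \<open>auto simp: U_def fun_eq_iff ell2_inner_add ell2_inner_scale ell2_add ell2_scale ell2_basis\<close>)
  have "ell2_inner S (T \<xi>) \<eta> = ell2_inner S \<xi> (U \<eta>)" if \<xi>: "\<xi> \<in> ell2 S" and \<eta>: "\<eta> \<in> ell2 S" for \<xi> \<eta>
  proof -
    let ?d = "cmod (ell2_inner S (T \<xi>) \<eta> - ell2_inner S \<xi> (U \<eta>))"
    let ?K = "op_norm S T * ell2_norm S \<eta> + ell2_norm S (U \<eta>)"
    have "?d \<le> e * (?K + 1)" if e: "e > 0" for e
    proof -
      obtain F where F: "finite F" "F \<subseteq> S" "ell2_norm S (\<lambda>x. \<xi> x - ell2_restrict F \<xi> x) < e"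
        using ell2_restrict_approx[OF \<xi> e] by blast
      let ?v = "ell2_restrict F \<xi>" let ?r = "\<lambda>x. \<xi> x - ?v x"
      have v: "?v \<in> ell2 S" and r: "?r \<in> ell2 S" by (auto intro: ell2_restrict ell2_diff \<xi>)
      have "ell2_inner S (T ?v) \<eta> = (\<Sum>y\<in>F. \<xi> y * cnj (U \<eta> y))"
        unfolding bounded_ops_finite_support[OF T \<eta> F(1,2)] using F \<eta>
        by (intro sum.cong) (auto simp: U_def ell2_inner_commute[of S \<eta>])
      also have "\<dots> = ell2_inner S ?v (U \<eta>)"
        unfolding ell2_inner_def using F(1,2)
        by (subst infsum_finite[OF F(1), symmetric]) (rule infsum_cong_neutral, auto simp: ell2_restrict_def)
      finally have eq: "ell2_inner S (T ?v) \<eta> = ell2_inner S ?v (U \<eta>)" .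
      have "ell2_inner S (T \<xi>) \<eta> - ell2_inner S \<xi> (U \<eta>) = ell2_inner S (T ?r) \<eta> - ell2_inner S ?r (U \<eta>)"
        using T U \<xi> \<eta> v eq by (simp add: bounded_ops_diff[OF T] ell2_inner_diff)
      then have "?d \<le> cmod (ell2_inner S (T ?r) \<eta>) + cmod (ell2_inner S ?r (U \<eta>))"
        by (simp add: norm_triangle_ineq4)
      also have "\<dots> \<le> ell2_norm S (T ?r) * ell2_norm S \<eta> + ell2_norm S ?r * ell2_norm S (U \<eta>)"
        using T U \<eta> r by (intro add_mono ell2_cauchy_schwarz) auto
      also have "\<dots> \<le> (op_norm S T * ell2_norm S ?r) * ell2_norm S \<eta> + ell2_norm S ?r * ell2_norm S (U \<eta>)"
        by (intro add_mono mult_right_mono op_norm_ge T r) auto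
      also have "\<dots> = ell2_norm S ?r * ?K" by (simp add: algebra_simps)
      also have "\<dots> \<le> e * (?K + 1)"
        using F(3) T e by (intro mult_mono) auto
      finally show ?thesis .
    qed
    note * = this
    have K: "?K + 1 > 0" using T by (intro add_nonneg_pos add_nonneg_nonneg) auto
    have "?d \<le> 0"
    proof (rule field_le_epsilon)
      fix e :: real assume "e > 0"
      then show "?d \<le> 0 + e" using *[of "e / (?K+1)"] K by simp
    qed
    then show ?thesis by simp
  qed
  moreover have "op_norm S U \<le> op_norm S T" by (rule op_norm_le[OF _ b(2)]) (use T in auto)
  ultimately show ?thesis using U by blast
qed

lemma op_adj_eqI:
  assumes "U \<in> bounded_ops S"
    and "\<And>\<xi> \<eta>. \<xi> \<in> ell2 S \<Longrightarrow> \<eta> \<in> ell2 S \<Longrightarrow> ell2_inner S (T \<xi>) \<eta> = ell2_inner S \<xi> (U \<eta>)"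
  shows "op_adj S T = U"
  unfolding op_adj_def
proof (rule the_equality)
  fix V assume V: "V \<in> bounded_ops S \<and>
     (\<forall>\<xi>\<in>ell2 S. \<forall>\<eta>\<in>ell2 S. ell2_inner S (T \<xi>) \<eta> = ell2_inner S \<xi> (V \<eta>))"
  show "V = U"
  proof (rule op_eqI)
    fix \<eta> assume \<eta>: "\<eta> \<in> ell2 S"
    show "V \<eta> = U \<eta>"
    proof
      fix x
      have "cnj (V \<eta> x) = cnj (U \<eta> x)" if "x \<in> S"
        using V assms(2)[OF ell2_basis(1)[OF that] \<eta>] \<eta> ell2_basis(1)[OF that]
        by (simp add: ell2_inner_basis(1)[OF that])
      moreover have "V \<eta> x = U \<eta> x" if "x \<notin> S"
        using that V assms(1) ell2_off[of "V \<eta>" S x] ell2_off[of "U \<eta>" S x] by simp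
      ultimately show "V \<eta> x = U \<eta> x" by (metis complex_cnj_cancel_iff)
    qed
  qed (use V assms(1) in auto)
qed (use assms in auto)

lemma op_adj:
  assumes "T \<in> bounded_ops S"
  shows op_adj_bounded: "op_adj S T \<in> bounded_ops S"
    and op_norm_adj_le: "op_norm S (op_adj S T) \<le> op_norm S T"
    and op_adj_inner: "\<xi> \<in> ell2 S \<Longrightarrow> \<eta> \<in> ell2 S \<Longrightarrow>
      ell2_inner S (T \<xi>) \<eta> = ell2_inner S \<xi> (op_adj S T \<eta>)"
proof -
  obtain U where U: "U \<in> bounded_ops S" "op_norm S U \<le> op_norm S T"
      "\<And>\<xi> \<eta>. \<xi> \<in> ell2 S \<Longrightarrow> \<eta> \<in> ell2 S \<Longrightarrow> ell2_inner S (T \<xi>) \<eta> = ell2_inner S \<xi> (U \<eta>)"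
    using op_adjoint_exists[OF assms] by blast
  then have "op_adj S T = U" by (intro op_adj_eqI)
  with U show "op_adj S T \<in> bounded_ops S" "op_norm S (op_adj S T) \<le> op_norm S T"
    "\<xi> \<in> ell2 S \<Longrightarrow> \<eta> \<in> ell2 S \<Longrightarrow> ell2_inner S (T \<xi>) \<eta> = ell2_inner S \<xi> (op_adj S T \<eta>)"
    by auto
qed

lemma op_adj_inner':
  assumes "T \<in> bounded_ops S" "\<xi> \<in> ell2 S" "\<eta> \<in> ell2 S"
  shows "ell2_inner S (op_adj S T \<xi>) \<eta> = ell2_inner S \<xi> (T \<eta>)"
  using op_adj_inner[OF assms(1,3,2)] by (metis ell2_inner_commute)

lemma op_adj_adj [simp]: "T \<in> bounded_ops S \<Longrightarrow> op_adj S (op_adj S T) = T"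
  by (rule op_adj_eqI) (auto intro: op_adj_inner')

lemma op_adj_id [simp]: "op_adj S (op_id S) = op_id S"
  by (rule op_adj_eqI) auto

lemma op_adj_zero [simp]: "op_adj S op_zero = op_zero"
  by (rule op_adj_eqI[OF op_zero_bounded]) (simp add: op_zero_def)

lemma op_adj_add:
  assumes "T \<in> bounded_ops S" "U \<in> bounded_ops S"
  shows "op_adj S (op_add T U) = op_add (op_adj S T) (op_adj S U)"
proof (rule op_adj_eqI)
  show "op_add (op_adj S T) (op_adj S U) \<in> bounded_ops S"
    by (intro op_bounded op_adj_bounded assms)
  fix \<xi> \<eta> assume "\<xi> \<in> ell2 S" "\<eta> \<in> ell2 S"
  then show "ell2_inner S (op_add T U \<xi>) \<eta> = ell2_inner S \<xi> (op_add (op_adj S T) (op_adj S U) \<eta>)"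
    using assms op_adj_bounded[OF assms(1)] op_adj_bounded[OF assms(2)]
    by (simp add: op_add_def ell2_inner_add op_adj_inner)
qed

lemma op_adj_scale:
  assumes "T \<in> bounded_ops S"
  shows "op_adj S (op_scale c T) = op_scale (cnj c) (op_adj S T)"
  by (rule op_adj_eqI)
    (use assms op_adj in \<open>auto intro!: op_bounded simp: op_scale_def[THEN fun_cong] ell2_inner_scale op_adj_inner\<close>)

lemma op_adj_diff:
  assumes "T \<in> bounded_ops S" "U \<in> bounded_ops S"
  shows "op_adj S (op_diff T U) = op_diff (op_adj S T) (op_adj S U)"
  using assms by (simp add: op_diff_eq op_adj_add op_adj_scale op_bounded)

lemma op_adj_comp:
  assumes "T \<in> bounded_ops S" "U \<in> bounded_ops S"
  shows "op_adj S (T \<circ> U) = op_adj S U \<circ> op_adj S T"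
  by (rule op_adj_eqI) (use assms op_adj_bounded[of _ S] in \<open>auto intro!: op_bounded simp: op_adj_inner\<close>)


section \<open>Norm limits of operators\<close>

definition op_lim :: "'a set \<Rightarrow> (nat \<Rightarrow> 'a op2) \<Rightarrow> 'a op2 \<Rightarrow> bool" where
  "op_lim S X T \<longleftrightarrow> (\<forall>k. X k \<in> bounded_ops S) \<and> T \<in> bounded_ops S \<and>
     (\<lambda>k. op_norm S (op_diff (X k) T)) \<longlonglongrightarrow> 0"

lemma op_limD:
  assumes "op_lim S X T"
  shows "X k \<in> bounded_ops S" "T \<in> bounded_ops S" "(\<lambda>k. op_norm S (op_diff (X k) T)) \<longlonglongrightarrow> 0"
  using assms by (auto simp: op_lim_def)

lemma op_lim_boundI:
  assumes "\<And>k. X k \<in> bounded_ops S" "T \<in> bounded_ops S" "f \<longlonglongrightarrow> 0"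
    and "\<And>k. op_norm S (op_diff (X k) T) \<le> f k"
  shows "op_lim S X T"
proof -
  have "norm (op_norm S (op_diff (X k) T)) \<le> f k" for k
    using assms(4)[of k] op_diff_bounded(1)[OF assms(1,2), of k] by simp
  then have "(\<lambda>k. op_norm S (op_diff (X k) T)) \<longlonglongrightarrow> 0"
    by (intro Lim_null_comparison[OF _ assms(3)] always_eventually allI)
  then show ?thesis using assms by (simp add: op_lim_def)
qed

lemma op_lim_const:
  assumes "T \<in> bounded_ops S"
  shows "op_lim S (\<lambda>k. T) T"
  by (rule op_lim_boundI[where f="\<lambda>_. 0"]) (simp_all add: assms op_diff_self)

lemma op_lim_add:
  assumes X: "op_lim S X T" and Y: "op_lim S Y U"
  shows "op_lim S (\<lambda>k. op_add (X k) (Y k)) (op_add T U)"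
proof (rule op_lim_boundI)
  show "(\<lambda>k. op_norm S (op_diff (X k) T) + op_norm S (op_diff (Y k) U)) \<longlonglongrightarrow> 0"
    using tendsto_add[OF op_limD(3)[OF X] op_limD(3)[OF Y]] by simp
  fix k
  have "op_diff (op_add (X k) (Y k)) (op_add T U) = op_add (op_diff (X k) T) (op_diff (Y k) U)"
    by (simp add: op_diff_def op_add_def fun_eq_iff)
  then show "op_norm S (op_diff (op_add (X k) (Y k)) (op_add T U)) \<le>
      op_norm S (op_diff (X k) T) + op_norm S (op_diff (Y k) U)"
    using op_add_bounded(2)[OF op_diff_bounded(1)[OF op_limD(1,2)[OF X]] op_diff_bounded(1)[OF op_limD(1,2)[OF Y]], of k k]
    by simp
qed (intro op_bounded op_limD[OF X] op_limD[OF Y])+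

lemma op_lim_scale:
  assumes X: "op_lim S X T"
  shows "op_lim S (\<lambda>k. op_scale c (X k)) (op_scale c T)"
proof (rule op_lim_boundI)
  show "(\<lambda>k. cmod c * op_norm S (op_diff (X k) T)) \<longlonglongrightarrow> 0"
    using tendsto_mult_right_zero[OF op_limD(3)[OF X]] by simp
  fix k
  have "op_diff (op_scale c (X k)) (op_scale c T) = op_scale c (op_diff (X k) T)"
    by (simp add: op_diff_def op_scale_def fun_eq_iff algebra_simps)
  then show "op_norm S (op_diff (op_scale c (X k)) (op_scale c T)) \<le> cmod c * op_norm S (op_diff (X k) T)"
    using op_scale_bounded(2)[OF op_diff_bounded(1)[OF op_limD(1,2)[OF X]], of c k] by simp
qed (intro op_bounded op_limD[OF X])+

lemma op_lim_adj:
  assumes X: "op_lim S X T"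
  shows "op_lim S (\<lambda>k. op_adj S (X k)) (op_adj S T)"
proof (rule op_lim_boundI[OF _ _ op_limD(3)[OF X]])
  fix k show "op_norm S (op_diff (op_adj S (X k)) (op_adj S T)) \<le> op_norm S (op_diff (X k) T)"
    using op_norm_adj_le[OF op_diff_bounded(1)[OF op_limD(1,2)[OF X]], of k]
    by (simp add: op_adj_diff[OF op_limD(1,2)[OF X]])
qed (intro op_adj_bounded op_limD[OF X])+

lemma op_lim_comp:
  assumes X: "op_lim S X T" and Y: "op_lim S Y U"
  shows "op_lim S (\<lambda>k. X k \<circ> Y k) (T \<circ> U)"
proof (rule op_lim_boundI)
  let ?x = "\<lambda>k. op_norm S (op_diff (X k) T)" and ?y = "\<lambda>k. op_norm S (op_diff (Y k) U)"
  have "(\<lambda>k. ?x k * (?y k + op_norm S U) + op_norm S T * ?y k) \<longlonglongrightarrow> 0 * (0 + op_norm S U) + op_norm S T * 0"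
    by (intro tendsto_intros op_limD(3)[OF X] op_limD(3)[OF Y])
  then show "(\<lambda>k. ?x k * (?y k + op_norm S U) + op_norm S T * ?y k) \<longlonglongrightarrow> 0" by simp
  fix k
  note b = op_limD(1,2)[OF X] op_limD(1,2)[OF Y]
  note d = op_diff_bounded(1)[OF b(1,2), of k] op_diff_bounded(1)[OF b(3,4), of k]
  have "Y k = op_add (op_diff (Y k) U) U" by (simp add: op_diff_def op_add_def)
  then have Yk: "op_norm S (Y k) \<le> ?y k + op_norm S U" using op_add_bounded(2)[OF d(2) b(4)] by simp
  have eq: "op_diff (X k \<circ> Y k) (T \<circ> U) = op_add (op_diff (X k) T \<circ> Y k) (T \<circ> op_diff (Y k) U)"
    unfolding op_comp_diff(1)[OF b(2,3,4)] op_comp_diff(2)[OF b(3,1,2)] by (simp add: op_diff_def op_add_def)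
  have "op_norm S (op_diff (X k \<circ> Y k) (T \<circ> U)) \<le> op_norm S (op_diff (X k) T \<circ> Y k) + op_norm S (T \<circ> op_diff (Y k) U)"
    unfolding eq by (intro op_add_bounded op_comp_bounded b d)
  also have "\<dots> \<le> ?x k * op_norm S (Y k) + op_norm S T * ?y k"
    by (intro add_mono op_comp_bounded b d)
  also have "\<dots> \<le> ?x k * (?y k + op_norm S U) + op_norm S T * ?y k"
    by (intro add_right_mono mult_left_mono Yk op_norm_nonneg d)
  finally show "op_norm S (op_diff (X k \<circ> Y k) (T \<circ> U)) \<le> ?x k * (?y k + op_norm S U) + op_norm S T * ?y k" .
qed (intro op_bounded op_limD[OF X] op_limD[OF Y])+

lemma op_lim_unique:
  assumes X: "op_lim S X T" "op_lim S X U"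
  shows "T = U"
proof -
  note b = op_limD(2)[OF X(1)] op_limD(2)[OF X(2)]
  have "op_norm S (op_diff T U) \<le> op_norm S (op_diff (X k) T) + op_norm S (op_diff (X k) U)" for k
    using op_diff_triangle[OF b(1) op_limD(1)[OF X(1)] b(2), of k] op_diff_commute_norm[OF b(1) op_limD(1)[OF X(1)], of k]
    by simp
  then have "op_norm S (op_diff T U) \<le> 0 + 0"
    by (intro LIMSEQ_le_const[OF tendsto_add[OF op_limD(3)[OF X(1)] op_limD(3)[OF X(2)]]] exI[of _ 0] allI impI)
  then show ?thesis using op_norm_eq_0[OF op_diff_bounded(1)[OF b]] op_diff_eq_zeroD by auto
qed

lemma op_norm_closed_lim:
  assumes "op_norm_closed S A" "op_lim S X T" "\<And>k. X k \<in> A"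
  shows "T \<in> A"
proof -
  have "\<exists>U\<in>A. op_norm S (op_diff T U) < e" if e: "e > 0" for e
  proof -
    obtain k where "norm (op_norm S (op_diff (X k) T) - 0) < e"
      using LIMSEQ_D[OF op_limD(3)[OF assms(2)] e] by blast
    then show ?thesis
      using op_diff_commute_norm[OF op_limD(1,2)[OF assms(2)], of k] assms(3)[of k] by (intro bexI[of _ "X k"]) auto
  qed
  then show ?thesis using assms(1) op_limD(2)[OF assms(2)] unfolding op_norm_closed_def by blast
qed

section \<open>Completeness and square roots\<close>

text \<open>The limit operator is the coordinatewise limit: coordinates are dominated by norms, and a bound on
  finitely many coordinates survives the passage to the limit.\<close>

lemma bounded_ops_complete:
  assumes T: "\<And>k. T k \<in> bounded_ops S"
    and Cauchy: "\<And>e. e > 0 \<Longrightarrow> \<exists>N. \<forall>j\<ge>N. \<forall>k\<ge>N. op_norm S (op_diff (T j) (T k)) \<le> e"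
  obtains U where "op_lim S T U"
proof -
  have d: "op_diff (T j) (T k) \<in> bounded_ops S" for j k using T by (simp add: op_bounded)
  have coord: "cmod (T j \<xi> x - T k \<xi> x) \<le> op_norm S (op_diff (T j) (T k)) * ell2_norm S \<xi>"
    if "\<xi> \<in> ell2 S" for \<xi> j k x
    using order_trans[OF ell2_norm_coordinate[OF bounded_ops_ell2[OF d], of j k \<xi> x] op_norm_ge[OF d that, of j k]]
    by (simp add: op_diff_def)
  have conv: "convergent (\<lambda>k. T k \<xi> x)" for \<xi> x
  proof (cases "\<xi> \<in> ell2 S")
    case True
    have "Cauchy (\<lambda>k. T k \<xi> x)"
    proof (rule metric_CauchyI)
      fix e :: real assume e: "e > 0"
      let ?K = "ell2_norm S \<xi> + 1"
      have K: "?K > 0" by (simp add: add_nonneg_pos)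
      obtain N where N: "\<And>j k. j \<ge> N \<Longrightarrow> k \<ge> N \<Longrightarrow> op_norm S (op_diff (T j) (T k)) \<le> e / 2 / ?K"
        using Cauchy[of "e / 2 / ?K"] e K by auto
      have "dist (T j \<xi> x) (T k \<xi> x) < e" if "j \<ge> N" "k \<ge> N" for j k
      proof -
        have "dist (T j \<xi> x) (T k \<xi> x) \<le> (e / 2 / ?K) * ?K"
          unfolding dist_norm
          by (rule order_trans[OF coord[OF True]], intro mult_mono N that) (use K e in auto)
        also have "\<dots> = e / 2" by (rule nonzero_eq_divide_eq[THEN iffD1, OF _ refl]) (use K in linarith)
        also have "\<dots> < e" using e by simp
        finally show ?thesis .
      qed
      then show "\<exists>M. \<forall>m\<ge>M. \<forall>n\<ge>M. dist (T m \<xi> x) (T n \<xi> x) < e" by blast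
    qed
    then show ?thesis by (simp add: Cauchy_convergent_iff)
  qed (simp add: bounded_opsD(2)[OF T] convergent_const)
  define U where "U = (\<lambda>\<xi> x. lim (\<lambda>k. T k \<xi> x))"
  have lim: "(\<lambda>k. T k \<xi> x) \<longlonglongrightarrow> U \<xi> x" for \<xi> x
    using conv by (simp add: U_def convergent_LIMSEQ_iff)
  have off: "U \<xi> = (\<lambda>x. 0)" if "\<xi> \<notin> ell2 S" for \<xi>
    using that by (simp add: U_def bounded_opsD(2)[OF T])
  have near: "(\<lambda>x. T j \<xi> x - U \<xi> x) \<in> ell2 S"
      "ell2_norm S (\<lambda>x. T j \<xi> x - U \<xi> x) \<le> e * ell2_norm S \<xi>"
    if \<xi>: "\<xi> \<in> ell2 S" and N: "\<And>j k. j \<ge> N \<Longrightarrow> k \<ge> N \<Longrightarrow> op_norm S (op_diff (T j) (T k)) \<le> e"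
      and j: "j \<ge> N" for \<xi> N e j
  proof -
    have bd: "L2_set (\<lambda>x. cmod (T j \<xi> x - U \<xi> x)) F \<le> e * ell2_norm S \<xi>" if F: "finite F" "F \<subseteq> S" for F
    proof (rule LIMSEQ_le_const2)
      show "(\<lambda>k. L2_set (\<lambda>x. cmod (T j \<xi> x - T k \<xi> x)) F) \<longlonglongrightarrow> L2_set (\<lambda>x. cmod (T j \<xi> x - U \<xi> x)) F"
        unfolding L2_set_def by (intro tendsto_intros lim)
      have "L2_set (\<lambda>x. cmod (T j \<xi> x - T k \<xi> x)) F \<le> e * ell2_norm S \<xi>" if "k \<ge> N" for k
      proof -
        have "L2_set (\<lambda>x. cmod (T j \<xi> x - T k \<xi> x)) F \<le> ell2_norm S (op_diff (T j) (T k) \<xi>)"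
          using L2_set_le_ell2_norm[OF bounded_ops_ell2[OF d] F, of j k \<xi>] by (simp add: op_diff_def)
        also have "\<dots> \<le> op_norm S (op_diff (T j) (T k)) * ell2_norm S \<xi>"
          by (rule op_norm_ge[OF d \<xi>])
        also have "\<dots> \<le> e * ell2_norm S \<xi>"
          using N[OF j that] by (intro mult_right_mono) auto
        finally show ?thesis .
      qed
      then show "\<exists>N. \<forall>k\<ge>N. L2_set (\<lambda>x. cmod (T j \<xi> x - T k \<xi> x)) F \<le> e * ell2_norm S \<xi>" by blast
    qed
    have off: "T j \<xi> x - U \<xi> x = 0" if "x \<notin> S" for x
      using that by (simp add: U_def ell2_off[OF bounded_ops_ell2[OF T]])
    show "(\<lambda>x. T j \<xi> x - U \<xi> x) \<in> ell2 S"
      "ell2_norm S (\<lambda>x. T j \<xi> x - U \<xi> x) \<le> e * ell2_norm S \<xi>"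
      by (rule ell2_boundI[OF off bd]; assumption)+
  qed
  obtain M where M: "\<And>j k. j \<ge> M \<Longrightarrow> k \<ge> M \<Longrightarrow> op_norm S (op_diff (T j) (T k)) \<le> 1"
    using Cauchy[of 1] by auto
  have U: "U \<in> bounded_ops S"
  proof (rule bounded_opsI)
    fix \<xi> assume \<xi>: "\<xi> \<in> ell2 S"
    have eq: "U \<xi> = (\<lambda>x. T M \<xi> x - (T M \<xi> x - U \<xi> x))" by auto
    have n: "(\<lambda>x. T M \<xi> x - U \<xi> x) \<in> ell2 S"
        "ell2_norm S (\<lambda>x. T M \<xi> x - U \<xi> x) \<le> 1 * ell2_norm S \<xi>"
      by (rule near[OF \<xi> _ order_refl[of M]], rule M, assumption+)+
    show "U \<xi> \<in> ell2 S" by (subst eq) (intro ell2_diff n bounded_ops_ell2 T)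
    show "ell2_norm S (U \<xi>) \<le> (op_norm S (T M) + 1) * ell2_norm S \<xi>"
      using ell2_diff(2)[OF bounded_ops_ell2[OF T[of M], of \<xi>] n(1)] n(2) op_norm_ge[OF T \<xi>, of M]
      unfolding eq[symmetric] by (simp add: algebra_simps)
  next
    fix \<xi> \<eta> assume "\<xi> \<in> ell2 S" "\<eta> \<in> ell2 S"
    then show "U (\<lambda>x. \<xi> x + \<eta> x) = (\<lambda>x. U \<xi> x + U \<eta> x)"
      using tendsto_add[OF lim lim] LIMSEQ_unique[OF lim]
      by (fastforce simp: bounded_opsD(3)[OF T] fun_eq_iff)
  next
    fix c \<xi> assume "\<xi> \<in> ell2 S"
    then show "U (\<lambda>x. c * \<xi> x) = (\<lambda>x. c * U \<xi> x)"
      using tendsto_mult_left[OF lim] LIMSEQ_unique[OF lim]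
      by (fastforce simp: bounded_opsD(4)[OF T] fun_eq_iff)
  qed (rule off)
  have "(\<lambda>k. op_norm S (op_diff (T k) U)) \<longlonglongrightarrow> 0"
  proof (rule LIMSEQ_I)
    fix e :: real assume e: "e > 0"
    then obtain N where N: "\<And>j k. j \<ge> N \<Longrightarrow> k \<ge> N \<Longrightarrow> op_norm S (op_diff (T j) (T k)) \<le> e / 2"
      using Cauchy[of "e/2"] by auto
    have "op_norm S (op_diff (T k) U) \<le> e / 2" if "k \<ge> N" for k
      by (rule op_norm_le) (use near(2)[OF _ N that] e in \<open>auto simp: op_diff_def\<close>)
    then show "\<exists>N. \<forall>k\<ge>N. norm (op_norm S (op_diff (T k) U) - 0) < e"
      using e T U by (force simp: op_bounded intro: exI[of _ N])
  qed
  with U T have "op_lim S T U" by (simp add: op_lim_def)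
  then show thesis by (rule that)
qed

lemma cstar_subalgebraD:
  assumes "cstar_subalgebra S A"
  shows "T \<in> A \<Longrightarrow> T \<in> bounded_ops S"
    and "op_zero \<in> A"
    and "T \<in> A \<Longrightarrow> U \<in> A \<Longrightarrow> op_add T U \<in> A"
    and "T \<in> A \<Longrightarrow> op_scale c T \<in> A"
    and "T \<in> A \<Longrightarrow> U \<in> A \<Longrightarrow> op_diff T U \<in> A"
    and "T \<in> A \<Longrightarrow> U \<in> A \<Longrightarrow> T \<circ> U \<in> A"
    and "T \<in> A \<Longrightarrow> op_adj S T \<in> A"
    and "T \<in> bounded_ops S \<Longrightarrow> (\<And>e. e > 0 \<Longrightarrow> \<exists>U\<in>A. op_norm S (op_diff T U) < e) \<Longrightarrow> T \<in> A"
  using assms unfolding cstar_subalgebra_def op_subspace_def op_norm_closed_def op_diff_eq by blast+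

text \<open>The iteration \<open>y \<mapsto> (x + y\<^sup>2) / 2\<close> started at zero stays in the ball of radius \<open>1/2\<close>, on which it halves
  distances.  Its limit \<open>Y\<close> satisfies \<open>2 Y = x + Y\<^sup>2\<close>, that is \<open>(1 - Y)\<^sup>2 = 1 - x\<close>.  The bound \<open>1/4\<close> is
  chosen for these constants; positivity of \<open>1 - x\<close> for small \<open>x\<close> is all that is wanted.\<close>

lemma op_sqrt_exists:
  assumes A: "cstar_subalgebra S A" and id: "op_id S \<in> A"
    and x: "x \<in> A" "op_adj S x = x" "op_norm S x \<le> 1/4"
  shows "\<exists>s\<in>A. op_adj S s = s \<and> s \<circ> s = op_diff (op_id S) x"
proof -
  note AD = cstar_subalgebraD[OF A]
  note B = AD(1) and AI = AD(2-7)
  define y where "y = rec_nat op_zero (\<lambda>_ z. op_scale (1/2) (op_add x (z \<circ> z)))"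
  have y0: "y 0 = op_zero" and yS: "y (Suc k) = op_scale (1/2) (op_add x (y k \<circ> y k))" for k
    by (simp_all add: y_def)
  have yA: "y k \<in> A" for k by (induction k) (auto simp: y0 yS intro: AI x)
  have adj: "op_adj S (y k) = y k" for k
    by (induction k) (simp_all add: y0 yS op_adj_scale op_adj_add op_adj_comp B AD yA x)
  have half: "op_norm S (op_scale (1/2) T) \<le> op_norm S T / 2" if "T \<in> A" for T
    using op_scale_bounded(2)[OF B[OF that], of "1/2"] by simp
  have bd: "op_norm S (y k) \<le> 1/2" for k
  proof (induction k)
    case (Suc k)
    have "op_norm S (y k \<circ> y k) \<le> 1/2 * (1/2)"
      by (rule order_trans[OF op_comp_bounded(2)[OF B B] mult_mono]) (use Suc yA B in auto)
    then have "op_norm S (op_add x (y k \<circ> y k)) \<le> 1"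
      using op_add_bounded(2)[OF B[OF x(1)] B[OF AD(6)[OF yA yA]], of k k] x(3) by linarith
    then show ?case unfolding yS using half[OF AD(3)[OF x(1) AD(6)[OF yA yA]], of k k] by linarith
  qed (simp add: y0)
  have step: "op_norm S (op_diff (y (Suc j)) (y (Suc k))) \<le> op_norm S (op_diff (y j) (y k)) / 2" for j k
  proof -
    let ?u = "y j" and ?v = "y k"
    have eq: "op_diff (y (Suc j)) (y (Suc k)) = op_scale (1/2) (op_add (?u \<circ> op_diff ?u ?v) (op_diff ?u ?v \<circ> ?v))"
      unfolding yS op_comp_diff(1)[OF B[OF yA] B[OF yA] B[OF yA]] op_comp_diff(2)[OF B[OF yA] B[OF yA] B[OF yA]]
      by (auto simp: op_diff_def op_add_def op_scale_def fun_eq_iff algebra_simps)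
    have d: "op_diff ?u ?v \<in> A" by (intro AD(5) yA)
    have 1: "op_norm S (?u \<circ> op_diff ?u ?v) \<le> 1/2 * op_norm S (op_diff ?u ?v)"
      by (rule order_trans[OF op_comp_bounded(2)[OF B B] mult_mono]) (use bd yA d B in auto)
    have 2: "op_norm S (op_diff ?u ?v \<circ> ?v) \<le> op_norm S (op_diff ?u ?v) * (1/2)"
      by (rule order_trans[OF op_comp_bounded(2)[OF B B] mult_mono]) (use bd yA d B in auto)
    show ?thesis
      unfolding eq using half[OF AD(3)[OF AD(6)[OF yA d] AD(6)[OF d yA]], of j k]
        op_add_bounded(2)[OF B[OF AD(6)[OF yA d]] B[OF AD(6)[OF d yA]], of j k] 1 2 by linarith
  qed
  \<comment> \<open>Applying \<open>step\<close> \<open>N\<close> times leads back to \<open>y k\<close> and \<open>y 0 = 0\<close>.\<close>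
  have tail: "op_norm S (op_diff (y (N + k)) (y N)) \<le> (1/2)^N" for N k
  proof (induction N)
    case 0
    have "op_diff (y k) op_zero = y k" by (simp add: op_diff_def op_zero_def)
    then show ?case using bd[of k] by (simp add: y0)
  next
    case (Suc N)
    then show ?case using step[of "N + k" N] by simp
  qed
  have cau: "\<exists>N. \<forall>j\<ge>N. \<forall>k\<ge>N. op_norm S (op_diff (y j) (y k)) \<le> e" if e: "e > 0" for e
  proof -
    obtain N where N: "(1/2)^N < e/2" using real_arch_pow_inv[of "e/2" "1/2"] e by auto
    have "op_norm S (op_diff (y j) (y k)) \<le> e" if "j \<ge> N" "k \<ge> N" for j k
    proof -
      have "op_norm S (op_diff (y j) (y k)) \<le> op_norm S (op_diff (y j) (y N)) + op_norm S (op_diff (y N) (y k))"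
        by (intro op_diff_triangle B yA)
      also have "\<dots> \<le> (1/2)^N + (1/2)^N"
        using tail[of N "j - N"] tail[of N "k - N"] that op_diff_commute_norm[OF B B, OF yA yA, of N k]
        by (intro add_mono) auto
      finally show ?thesis using N by simp
    qed
    then show ?thesis by blast
  qed
  obtain Y where Y: "op_lim S y Y"
    using bounded_ops_complete[of y S] cau B yA by blast
  have YA: "Y \<in> A"
    by (rule op_norm_closed_lim[OF _ Y yA]) (use A in \<open>simp add: cstar_subalgebra_def\<close>)
  note YB = B[OF YA]
  have "op_lim S (\<lambda>k. y (Suc k)) Y"
    using Y LIMSEQ_Suc[OF op_limD(3)[OF Y]] by (simp add: op_lim_def)
  moreover have "op_lim S (\<lambda>k. y (Suc k)) (op_scale (1/2) (op_add x (Y \<circ> Y)))"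
    unfolding yS by (intro op_lim_scale op_lim_add op_lim_const op_lim_comp Y B x)
  ultimately have fix_eq: "Y = op_scale (1/2) (op_add x (Y \<circ> Y))" by (rule op_lim_unique)
  have adjY: "op_adj S Y = Y"
    using op_lim_unique[OF op_lim_adj[OF Y]] Y by (simp only: adj)
  let ?s = "op_diff (op_id S) Y"
  have "?s \<circ> ?s = op_diff ?s (Y \<circ> ?s)"
    using op_comp_diff(2)[of ?s S "op_id S" Y] op_comp_id(2)[of ?s S] YB by (simp add: op_bounded)
  also have "\<dots> = op_diff ?s (op_diff Y (Y \<circ> Y))"
    using op_comp_diff(1)[of Y S "op_id S" Y] op_comp_id(1)[of Y S] YB by simp
  also have "\<dots> = op_diff (op_id S) x"
  proof (intro ext)
    fix \<xi> u
    have "2 * Y \<xi> u = x \<xi> u + (Y \<circ> Y) \<xi> u"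
      by (subst fix_eq) (simp add: op_scale_def op_add_def)
    then show "op_diff ?s (op_diff Y (Y \<circ> Y)) \<xi> u = op_diff (op_id S) x \<xi> u"
      by (simp add: op_diff_def algebra_simps)
  qed
  finally have "?s \<circ> ?s = op_diff (op_id S) x" .
  moreover have "op_adj S ?s = ?s" using YB by (simp add: op_adj_diff adjY)
  moreover have "?s \<in> A" by (intro AI id YA)
  ultimately show ?thesis by blast
qed

text \<open>Automatic continuity.  For self-adjoint \<open>x\<close> of norm at most \<open>1/4\<close> the element \<open>1 - x\<close> is the square of
  a self-adjoint one, so positivity gives \<open>\<phi> x \<le> 1\<close>; scaling yields the constant \<open>4\<close> for self-adjoint
  elements, and real and imaginary parts double it.\<close>

lemma tracial_state_bounded:
  assumes A: "cstar_subalgebra S A" and id: "op_id S \<in> A" and \<phi>: "tracial_state S A \<phi>" and T: "T \<in> A"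
  shows "cmod (\<phi> T) \<le> 8 * op_norm S T"
proof -
  note AD = cstar_subalgebraD[OF A]
  note B = AD(1) and AI = AD(2-7)
  have add: "\<phi> (op_add T U) = \<phi> T + \<phi> U" and scale: "\<phi> (op_scale c T) = c * \<phi> T"
    if "T \<in> A" "U \<in> A" for T U c
    using \<phi> that by (auto simp: tracial_state_def)
  have pos: "\<phi> (op_adj S T \<circ> T) \<in> \<real>" "0 \<le> Re (\<phi> (op_adj S T \<circ> T))" if "T \<in> A" for T
    using \<phi> that by (auto simp: tracial_state_def)
  have one: "\<phi> (op_id S) = 1" using \<phi> by (simp add: tracial_state_def)
  have small: "\<phi> x \<in> \<real> \<and> Re (\<phi> x) \<le> 1" if x: "x \<in> A" "op_adj S x = x" "op_norm S x \<le> 1/4" for x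
  proof -
    obtain s where s: "s \<in> A" "op_adj S s = s" "s \<circ> s = op_diff (op_id S) x"
      using op_sqrt_exists[OF A id x] by blast
    have "\<phi> (op_diff (op_id S) x) = 1 - \<phi> x"
      using add[OF id AD(4)[OF x(1)], of "-1"] scale[OF x(1) x(1), of "-1"] one by (simp add: op_diff_eq)
    with pos[OF s(1)] s have "1 - \<phi> x \<in> \<real>" "Re (1 - \<phi> x) \<ge> 0" by auto
    then show ?thesis using Reals_diff[of 1 "1 - \<phi> x"] by auto
  qed
  have sa: "cmod (\<phi> x) \<le> 4 * op_norm S x" if x: "x \<in> A" "op_adj S x = x" for x
  proof (rule field_le_epsilon)
    fix e :: real assume e: "e > 0"
    let ?K = "4 * op_norm S x + e"
    have K: "?K > 0" using B[OF x(1)] e by (simp add: add_nonneg_pos)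
    have *: "\<phi> x / of_real ?K \<in> \<real> \<and> s * Re (\<phi> x / of_real ?K) \<le> 1" if s: "s = 1 \<or> s = -1" for s :: real
    proof -
      have "op_norm S (op_scale (of_real (s / ?K)) x) \<le> cmod (of_real (s / ?K)) * op_norm S x"
        by (rule op_scale_bounded(2)[OF B[OF x(1)]])
      also have "\<dots> = op_norm S x / ?K" using s K by (auto simp: norm_divide simp del: of_real_add of_real_mult)
      also have "\<dots> \<le> 1/4" using K e by (simp add: field_simps)
      finally have "\<phi> (op_scale (of_real (s / ?K)) x) \<in> \<real> \<and> Re (\<phi> (op_scale (of_real (s / ?K)) x)) \<le> 1"
        by (intro small AI x) (simp_all add: op_adj_scale[OF B[OF x(1)]] x)
      moreover have "\<phi> (op_scale (of_real (s / ?K)) x) = of_real s * (\<phi> x / of_real ?K)"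
        using scale[OF x(1) x(1)] by simp
      ultimately show ?thesis using s by (auto simp: complex_is_Real_iff)
    qed
    have "\<phi> x / of_real ?K \<in> \<real>" and "Re (\<phi> x / of_real ?K) \<le> 1" "Re (\<phi> x / of_real ?K) \<ge> -1"
      using *[of 1] *[of "-1"] by auto
    moreover have "cmod z \<le> 1" if "z \<in> \<real>" "Re z \<le> 1" "Re z \<ge> -1" for z
      using that by (simp add: complex_is_Real_iff cmod_eq_Re)
    ultimately have "cmod (\<phi> x / of_real ?K) \<le> 1" by blast
    then show "cmod (\<phi> x) \<le> 4 * op_norm S x + e"
      using K by (simp add: norm_divide field_simps del: of_real_add of_real_mult)
  qed
  \<comment> \<open>The real and imaginary parts of \<open>T\<close>.\<close>
  define H where "H = op_scale (1/2) (op_add T (op_adj S T))"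
  define K where "K = op_scale (-\<i>/2) (op_diff T (op_adj S T))"
  note TB = B[OF T] op_adj_bounded[OF B[OF T]]
  have HA: "H \<in> A" and KA: "K \<in> A" unfolding H_def K_def by (intro AI T)+
  have "op_adj S H = H"
    unfolding H_def by (simp add: op_adj_scale op_adj_add op_bounded TB) (simp add: op_add_def add.commute)
  moreover have "op_norm S H \<le> op_norm S T"
    unfolding H_def
    using op_scale_bounded(2)[OF op_add_bounded(1)[OF TB], of "1/2"] op_add_bounded(2)[OF TB] op_norm_adj_le[OF TB(1)]
    by simp
  ultimately have h: "cmod (\<phi> H) \<le> 4 * op_norm S T" using sa[OF HA] by linarith
  have "op_adj S K = K"
    unfolding K_def using TB
    by (simp add: op_adj_scale op_adj_diff op_bounded) (simp add: op_diff_def op_scale_def fun_eq_iff algebra_simps)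
  moreover have "op_norm S K \<le> op_norm S T"
    unfolding K_def
    using op_scale_bounded(2)[OF op_diff_bounded(1)[OF TB], of "-\<i>/2"] op_diff_bounded(2)[OF TB] op_norm_adj_le[OF TB(1)]
    by (simp add: norm_divide)
  ultimately have k: "cmod (\<phi> K) \<le> 4 * op_norm S T" using sa[OF KA] by linarith
  have "T = op_add H (op_scale \<i> K)"
    by (simp add: H_def K_def op_add_def op_scale_def op_diff_def fun_eq_iff field_simps)
  then have "\<phi> T = \<phi> H + \<i> * \<phi> K" using add[OF HA AD(4)[OF KA]] scale[OF KA KA] by metis
  then have "cmod (\<phi> T) \<le> cmod (\<phi> H) + cmod (\<phi> K)"
    by (metis norm_triangle_ineq norm_mult norm_ii mult_1)
  with h k show ?thesis by linarith
qed


section \<open>Linear spans and norm closures\<close>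

text \<open>An inductive definition, so that statements linear in the operator are proved on generators by rule
  induction, without bookkeeping of coefficients.\<close>

inductive_set op_span :: "'a op2 set \<Rightarrow> 'a op2 set" for X where
  zero: "op_zero \<in> op_span X"
| base: "T \<in> X \<Longrightarrow> T \<in> op_span X"
| add: "T \<in> op_span X \<Longrightarrow> U \<in> op_span X \<Longrightarrow> op_add T U \<in> op_span X"
| scale: "T \<in> op_span X \<Longrightarrow> op_scale c T \<in> op_span X"

definition op_closure :: "'a set \<Rightarrow> 'a op2 set \<Rightarrow> 'a op2 set" where
  "op_closure S X = {T \<in> bounded_ops S. \<forall>e>0. \<exists>U\<in>X. op_norm S (op_diff T U) < e}"

lemma op_span_least:
  assumes "X \<subseteq> A" "op_subspace A"
  shows "op_span X \<subseteq> A"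
proof
  fix T assume "T \<in> op_span X"
  then show "T \<in> A" by induction (use assms in \<open>auto simp: op_subspace_def\<close>)
qed

lemma bounded_ops_subspace: "op_subspace (bounded_ops S)"
  by (auto simp: op_subspace_def op_bounded)

lemma op_span_bounded: "X \<subseteq> bounded_ops S \<Longrightarrow> T \<in> op_span X \<Longrightarrow> T \<in> bounded_ops S"
  using op_span_least[OF _ bounded_ops_subspace] by blast

lemma op_span_mono: "X \<subseteq> Y \<Longrightarrow> T \<in> op_span X \<Longrightarrow> T \<in> op_span Y"
  using op_span_least[of X "op_span Y"] by (auto simp: op_subspace_def intro: op_span.intros)

lemma op_span_comp:
  assumes X: "X \<subseteq> bounded_ops S" and comp: "\<And>T U. T \<in> X \<Longrightarrow> U \<in> X \<Longrightarrow> T \<circ> U \<in> op_span X"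
    and T: "T \<in> op_span X" and U: "U \<in> op_span X"
  shows "T \<circ> U \<in> op_span X"
proof -
  note B = op_span_bounded[OF X]
  have gen: "T \<circ> U \<in> op_span X" if T: "T \<in> X" and U: "U \<in> op_span X" for T U
  proof -
    have TB: "T \<in> bounded_ops S" using T X by blast
    show ?thesis using U
    proof (induction rule: op_span.induct)
      case zero
      show ?case unfolding op_comp_zero(1)[OF TB] by (rule op_span.zero)
    next
      case (base U)
      show ?case by (rule comp[OF T base])
    next
      case (add U V)
      show ?case unfolding op_comp_add(1)[OF TB B[OF add(1)] B[OF add(2)]]
        by (rule op_span.add) (fact add)+
    next
      case (scale U c)
      show ?case unfolding op_comp_scale(1)[OF TB B[OF scale(1)]]
        by (rule op_span.scale) (fact scale)
    qed
  qed
  show ?thesis using T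
  proof (induction rule: op_span.induct)
    case zero
    show ?case unfolding op_comp_zero(2)[OF B[OF U]] by (rule op_span.zero)
  next
    case (base T)
    show ?case by (rule gen[OF base U])
  next
    case (add T V)
    show ?case unfolding op_comp_add(2)[OF B[OF U] B[OF add(1)] B[OF add(2)]]
      by (rule op_span.add) (fact add)+
  next
    case (scale T c)
    show ?case unfolding op_comp_scale(2)[OF B[OF U] B[OF scale(1)]]
      by (rule op_span.scale) (fact scale)
  qed
qed

lemma op_span_adj:
  assumes X: "X \<subseteq> bounded_ops S" and adj: "\<And>T. T \<in> X \<Longrightarrow> op_adj S T \<in> op_span X"
    and T: "T \<in> op_span X"
  shows "op_adj S T \<in> op_span X"
  using T
proof induction
  case (add T U)
  then show ?case using op_span_bounded[OF X] by (simp add: op_adj_add op_span.add)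
next
  case (scale T c)
  then show ?case using op_span_bounded[OF X] by (simp add: op_adj_scale op_span.scale)
qed (auto intro: adj op_span.zero)

lemma op_closure_least:
  assumes "op_norm_closed S A" "X \<subseteq> A"
  shows "op_closure S X \<subseteq> A"
  using assms unfolding op_norm_closed_def op_closure_def by blast

lemma op_closure_subset: "X \<subseteq> bounded_ops S \<Longrightarrow> X \<subseteq> op_closure S X"
  unfolding op_closure_def using op_diff_self op_norm_zero by (smt (verit) mem_Collect_eq subset_iff)

lemma op_closure_lim:
  assumes X: "X \<subseteq> bounded_ops S" and T: "T \<in> op_closure S X"
  obtains Y where "op_lim S Y T" "\<And>k. Y k \<in> X"
proof -
  have TB: "T \<in> bounded_ops S" using T by (simp add: op_closure_def)
  have "\<exists>U. U \<in> X \<and> op_norm S (op_diff T U) < 1 / real (Suc k)" for k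
  proof -
    have "\<forall>e>0. \<exists>U\<in>X. op_norm S (op_diff T U) < e" using T by (simp add: op_closure_def)
    from this[rule_format, of "1 / real (Suc k)"] show ?thesis by auto
  qed
  then obtain Y where Y: "\<And>k. Y k \<in> X \<and> op_norm S (op_diff T (Y k)) < 1 / real (Suc k)" by metis
  have "op_lim S Y T"
  proof (rule op_lim_boundI[OF _ TB LIMSEQ_Suc[OF lim_1_over_n]])
    fix k show YB: "Y k \<in> bounded_ops S" using Y X by blast
    show "op_norm S (op_diff (Y k) T) \<le> 1 / of_nat (Suc k)"
      using Y[of k] op_diff_commute_norm[OF YB TB] by simp
  qed
  with Y that show thesis by blast
qed

lemma op_norm_closed_closure:
  assumes X: "X \<subseteq> bounded_ops S"
  shows "op_norm_closed S (op_closure S X)"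
  unfolding op_norm_closed_def
proof (intro ballI impI)
  fix T assume T: "T \<in> bounded_ops S" and close: "\<forall>e>0. \<exists>U\<in>op_closure S X. op_norm S (op_diff T U) < e"
  have "\<exists>V\<in>X. op_norm S (op_diff T V) < e" if e: "e > 0" for e
  proof -
    obtain U where U: "U \<in> op_closure S X" "op_norm S (op_diff T U) < e/2" using close half_gt_zero[OF e] by blast
    obtain V where V: "V \<in> X" "op_norm S (op_diff U V) < e/2"
      using U(1) half_gt_zero[OF e] unfolding op_closure_def by blast
    have "U \<in> bounded_ops S" "V \<in> bounded_ops S" using U V X by (auto simp: op_closure_def)
    with op_diff_triangle[OF T this] U V show ?thesis by force
  qed
  then show "T \<in> op_closure S X" using T by (simp add: op_closure_def)
qed

lemma cstar_subalgebra_op_closure: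
  assumes X: "X \<subseteq> bounded_ops S" "op_subspace X"
    and comp: "\<And>T U. T \<in> X \<Longrightarrow> U \<in> X \<Longrightarrow> T \<circ> U \<in> X"
    and adj: "\<And>T. T \<in> X \<Longrightarrow> op_adj S T \<in> X"
  shows "cstar_subalgebra S (op_closure S X)"
proof -
  note XI = subsetD[OF op_closure_subset[OF X(1)]]
  note lim = op_norm_closed_lim[OF op_norm_closed_closure[OF X(1)] _ XI]
  have "op_add T U \<in> op_closure S X \<and> T \<circ> U \<in> op_closure S X \<and> op_scale c T \<in> op_closure S X \<and>
      op_adj S T \<in> op_closure S X"
    if T: "T \<in> op_closure S X" and U: "U \<in> op_closure S X" for T U c
  proof -
    obtain Y where Y: "op_lim S Y T" "\<And>k. Y k \<in> X" by (rule op_closure_lim[OF X(1) T]) blast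
    obtain W where W: "op_lim S W U" "\<And>k. W k \<in> X" by (rule op_closure_lim[OF X(1) U]) blast
    have "op_add (Y k) (W k) \<in> X" "op_scale c (Y k) \<in> X" for k using Y W X(2) by (auto simp: op_subspace_def)
    then show ?thesis
      using lim[OF op_lim_add[OF Y(1) W(1)]] lim[OF op_lim_comp[OF Y(1) W(1)]] lim[OF op_lim_scale[OF Y(1)]]
        lim[OF op_lim_adj[OF Y(1)]] comp[OF Y(2) W(2)] adj[OF Y(2)] by blast
  qed
  moreover have "op_zero \<in> op_closure S X" using X(2) XI by (simp add: op_subspace_def)
  ultimately show ?thesis
    using op_norm_closed_closure[OF X(1)] unfolding cstar_subalgebra_def op_subspace_def
    by (auto simp: op_closure_def)
qed


section \<open>The twisted left regular representation\<close>

locale twisted_group = group G for G (structure) +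
  fixes \<sigma> :: "'a \<Rightarrow> 'a \<Rightarrow> complex"
  assumes cocycle: "\<sigma> \<in> two_cocycles G"
begin

abbreviation "S \<equiv> carrier G"
abbreviation "L \<equiv> twisted_regular G \<sigma>"
abbreviation "A \<equiv> reduced_twisted_cstar G \<sigma>"
abbreviation "\<delta> \<equiv> ell2_basis \<one>"

lemma cmod_cocycle [simp]: "g \<in> S \<Longrightarrow> h \<in> S \<Longrightarrow> cmod (\<sigma> g h) = 1"
  and cocycle_one [simp]: "g \<in> S \<Longrightarrow> \<sigma> g \<one> = 1" "g \<in> S \<Longrightarrow> \<sigma> \<one> g = 1"
  and cocycle_assoc: "g \<in> S \<Longrightarrow> h \<in> S \<Longrightarrow> k \<in> S \<Longrightarrow>
        \<sigma> g h * \<sigma> (g \<otimes> h) k = \<sigma> h k * \<sigma> g (h \<otimes> k)"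
  using cocycle by (auto simp: two_cocycles_def)

lemma cocycle_cnj [simp]: "g \<in> S \<Longrightarrow> h \<in> S \<Longrightarrow> \<sigma> g h * cnj (\<sigma> g h) = 1"
  by (metis cmod_cocycle complex_norm_square of_real_1 power_one)

lemma cocycle_inv: "g \<in> S \<Longrightarrow> \<sigma> (inv g) g = \<sigma> g (inv g)"
  using cocycle_assoc[of g "inv g" g] by simp

lemma bij_betw_translation: "g \<in> S \<Longrightarrow> bij_betw (\<lambda>h. g \<otimes> h) S S"
  by (rule bij_betw_byWitness[where f'="\<lambda>h. inv g \<otimes> h"]) (auto simp: m_assoc[symmetric])

lemma L_apply: "\<xi> \<in> ell2 S \<Longrightarrow> h \<in> S \<Longrightarrow> L g \<xi> h = \<sigma> g (inv g \<otimes> h) * \<xi> (inv g \<otimes> h)"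
  and L_off: "h \<notin> S \<Longrightarrow> L g \<xi> h = 0"
  and L_off': "\<xi> \<notin> ell2 S \<Longrightarrow> L g \<xi> = (\<lambda>x. 0)"
  by (auto simp: twisted_regular_def)

lemma L_apply_mult: "\<xi> \<in> ell2 S \<Longrightarrow> g \<in> S \<Longrightarrow> h \<in> S \<Longrightarrow> L g \<xi> (g \<otimes> h) = \<sigma> g h * \<xi> h"
  by (simp add: L_apply m_assoc[symmetric])

lemma L_ell2:
  assumes g: "g \<in> S" and \<xi>: "\<xi> \<in> ell2 S"
  shows "L g \<xi> \<in> ell2 S" "ell2_norm S (L g \<xi>) = ell2_norm S \<xi>"
proof -
  have bij: "bij_betw (\<lambda>h. inv g \<otimes> h) S S" using g by (intro bij_betw_translation) auto
  have eq: "(cmod (L g \<xi> h))\<^sup>2 = (cmod (\<xi> (inv g \<otimes> h)))\<^sup>2" if "h \<in> S" for h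
    using that g \<xi> by (simp add: L_apply norm_mult)
  have "(\<lambda>h. (cmod (\<xi> (inv g \<otimes> h)))\<^sup>2) summable_on S"
    using summable_on_reindex_bij_betw[OF bij, of "\<lambda>h. (cmod (\<xi> h))\<^sup>2"] ell2_summable[OF \<xi>] by simp
  moreover have "(\<lambda>h. (cmod (L g \<xi> h))\<^sup>2) summable_on S \<longleftrightarrow>
      (\<lambda>h. (cmod (\<xi> (inv g \<otimes> h)))\<^sup>2) summable_on S"
    by (rule summable_on_cong) (rule eq)
  ultimately have "(\<lambda>h. (cmod (L g \<xi> h))\<^sup>2) summable_on S" by blast
  then show "L g \<xi> \<in> ell2 S" by (simp add: ell2_def L_off)
  have "(\<Sum>\<^sub>\<infinity>h\<in>S. (cmod (L g \<xi> h))\<^sup>2) = (\<Sum>\<^sub>\<infinity>h\<in>S. (cmod (\<xi> (inv g \<otimes> h)))\<^sup>2)"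
    by (rule infsum_cong) (rule eq)
  then show "ell2_norm S (L g \<xi>) = ell2_norm S \<xi>"
    unfolding ell2_norm_def using infsum_reindex_bij_betw[OF bij, of "\<lambda>h. (cmod (\<xi> h))\<^sup>2"] by simp
qed

lemma L_bounded [simp]: "g \<in> S \<Longrightarrow> L g \<in> bounded_ops S"
proof (rule bounded_opsI[where K=1])
  fix \<xi> \<eta> assume g: "g \<in> S" and x: "\<xi> \<in> ell2 S" "\<eta> \<in> ell2 S"
  show "L g (\<lambda>x. \<xi> x + \<eta> x) = (\<lambda>x. L g \<xi> x + L g \<eta> x)"
  proof
    fix h show "L g (\<lambda>x. \<xi> x + \<eta> x) h = L g \<xi> h + L g \<eta> h"
      using g x ell2_add(1)[OF x] by (cases "h \<in> S") (auto simp: L_apply L_off algebra_simps)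
  qed
next
  fix c \<xi> assume g: "g \<in> S" and x: "\<xi> \<in> ell2 S"
  show "L g (\<lambda>x. c * \<xi> x) = (\<lambda>x. c * L g \<xi> x)"
  proof
    fix h show "L g (\<lambda>x. c * \<xi> x) h = c * L g \<xi> h"
      using g x ell2_scale(1)[OF x] by (cases "h \<in> S") (auto simp: L_apply L_off algebra_simps)
  qed
qed (auto simp: L_ell2 L_off')

lemma op_norm_L: "g \<in> S \<Longrightarrow> op_norm S (L g) \<le> 1"
  by (rule op_norm_le) (auto simp: L_ell2)

text \<open>At the point \<open>g h m\<close> this is the cocycle identity for \<open>g\<close>, \<open>h\<close>, \<open>m\<close>.\<close>

lemma L_comp:
  assumes g: "g \<in> S" and h: "h \<in> S"
  shows "L g \<circ> L h = op_scale (\<sigma> g h) (L (g \<otimes> h))"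
proof (rule op_eqI[of _ S])
  fix \<xi> assume \<xi>: "\<xi> \<in> ell2 S"
  show "(L g \<circ> L h) \<xi> = op_scale (\<sigma> g h) (L (g \<otimes> h)) \<xi>"
  proof
    fix k
    show "(L g \<circ> L h) \<xi> k = op_scale (\<sigma> g h) (L (g \<otimes> h)) \<xi> k"
    proof (cases "k \<in> S")
      case True
      define m where "m = inv (g \<otimes> h) \<otimes> k"
      have m: "m \<in> S" using True g h by (simp add: m_def)
      have k: "k = g \<otimes> (h \<otimes> m)" "k = (g \<otimes> h) \<otimes> m"
        using True g h by (simp_all add: m_def inv_mult_group m_assoc[symmetric] r_inv)
          (simp_all add: m_assoc)
      have "(L g \<circ> L h) \<xi> k = \<sigma> g (h \<otimes> m) * (\<sigma> h m * \<xi> m)"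
        unfolding k(1) using g h m \<xi> by (simp add: L_apply_mult L_ell2)
      also have "\<dots> = \<sigma> g h * (\<sigma> (g \<otimes> h) m * \<xi> m)"
        using cocycle_assoc[OF g h m] by (metis mult.assoc mult.commute)
      also have "\<dots> = op_scale (\<sigma> g h) (L (g \<otimes> h)) \<xi> k"
        unfolding k(2) op_scale_def using g h m \<xi> by (simp add: L_apply_mult)
      finally show ?thesis .
    qed (simp add: L_off op_scale_def)
  qed
qed (use g h in \<open>auto intro!: op_bounded\<close>)

lemma L_one: "L \<one> = op_id S"
proof (rule op_eqI[of _ S])
  fix \<xi> assume \<xi>: "\<xi> \<in> ell2 S"
  show "L \<one> \<xi> = op_id S \<xi>"
  proof
    fix h show "L \<one> \<xi> h = op_id S \<xi> h"
      using \<xi> by (cases "h \<in> S") (auto simp: L_apply L_off ell2_off)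
  qed
qed auto

lemma L_adj:
  assumes g: "g \<in> S"
  shows "op_adj S (L g) = op_scale (cnj (\<sigma> g (inv g))) (L (inv g))"
proof (rule op_adj_eqI)
  fix \<xi> \<eta> assume x: "\<xi> \<in> ell2 S" "\<eta> \<in> ell2 S"
  have "ell2_inner S (L g \<xi>) \<eta> = (\<Sum>\<^sub>\<infinity>m\<in>S. L g \<xi> (g \<otimes> m) * cnj (\<eta> (g \<otimes> m)))"
    unfolding ell2_inner_def
    using infsum_reindex_bij_betw[OF bij_betw_translation[OF g], of "\<lambda>h. L g \<xi> h * cnj (\<eta> h)"] by simp
  also have "\<dots> = ell2_inner S \<xi> (op_scale (cnj (\<sigma> g (inv g))) (L (inv g)) \<eta>)"
    unfolding ell2_inner_def
  proof (rule infsum_cong)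
    fix m assume m: "m \<in> S"
    have inv: "inv g \<otimes> (g \<otimes> m) = m" using g m by (simp add: m_assoc[symmetric])
    have "L (inv g) \<eta> m = \<sigma> (inv g) (g \<otimes> m) * \<eta> (g \<otimes> m)"
      using L_apply_mult[OF x(2), of "inv g" "g \<otimes> m"] g m inv by simp
    moreover have "\<sigma> g (inv g) = \<sigma> (inv g) (g \<otimes> m) * \<sigma> g m"
      using cocycle_assoc[of g "inv g" "g \<otimes> m"] g m inv by simp
    moreover have "\<sigma> (inv g) (g \<otimes> m) * cnj (\<sigma> (inv g) (g \<otimes> m)) = 1" using g m by simp
    ultimately show "L g \<xi> (g \<otimes> m) * cnj (\<eta> (g \<otimes> m))
        = \<xi> m * cnj (op_scale (cnj (\<sigma> g (inv g))) (L (inv g)) \<eta> m)"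
      unfolding op_scale_def using g m x by (simp add: L_apply_mult mult_ac)
  qed
  finally show "ell2_inner S (L g \<xi>) \<eta> = ell2_inner S \<xi> (op_scale (cnj (\<sigma> g (inv g))) (L (inv g)) \<eta>)" .
qed (use g in \<open>auto intro!: op_bounded\<close>)

lemma L_unitary:
  assumes g: "g \<in> S"
  shows "op_adj S (L g) \<circ> L g = op_id S" "L g \<circ> op_adj S (L g) = op_id S"
proof -
  have gi: "inv g \<in> S" using g by simp
  show "op_adj S (L g) \<circ> L g = op_id S"
    unfolding L_adj[OF g] op_comp_scale(2)[OF L_bounded[OF g] L_bounded[OF gi]] L_comp[OF gi g] op_scale_scale
    using g cocycle_cnj[of g "inv g"] by (simp add: cocycle_inv L_one mult.commute)
  show "L g \<circ> op_adj S (L g) = op_id S"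
    unfolding L_adj[OF g] op_comp_scale(1)[OF L_bounded[OF g] L_bounded[OF gi]] L_comp[OF g gi] op_scale_scale
    using g cocycle_cnj[of g "inv g"] by (simp add: L_one mult.commute)
qed

lemma L_basis:
  assumes "g \<in> S" "h \<in> S"
  shows "L g (ell2_basis h) = (\<lambda>x. \<sigma> g h * ell2_basis (g \<otimes> h) x)"
proof
  fix x
  show "L g (ell2_basis h) x = \<sigma> g h * ell2_basis (g \<otimes> h) x"
  proof (cases "x \<in> S")
    case True
    have "inv g \<otimes> x = h \<longleftrightarrow> x = g \<otimes> h" using True assms by (metis inv_solve_left)
    then show ?thesis
      unfolding L_apply[OF ell2_basis(1)[OF assms(2)] True] by (auto simp: ell2_basis_def)
  qed (use assms in \<open>auto simp: L_off ell2_basis_def\<close>)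
qed

lemma L_subset_bounded: "L ` S \<subseteq> bounded_ops S"
  by auto

lemma op_span_L_bounded: "T \<in> op_span (L ` S) \<Longrightarrow> T \<in> bounded_ops S"
  by (rule op_span_bounded[OF L_subset_bounded])

lemma cstar_subalgebra_closure: "cstar_subalgebra S (op_closure S (op_span (L ` S)))"
proof (rule cstar_subalgebra_op_closure)
  show "op_span (L ` S) \<subseteq> bounded_ops S" using op_span_L_bounded by blast
  show "op_subspace (op_span (L ` S))" unfolding op_subspace_def by (blast intro: op_span.intros)
next
  fix T U assume "T \<in> op_span (L ` S)" "U \<in> op_span (L ` S)"
  then show "T \<circ> U \<in> op_span (L ` S)"
  proof (rule op_span_comp[OF L_subset_bounded, rotated])
    fix T U assume "T \<in> L ` S" "U \<in> L ` S"
    then obtain g h where gh: "g \<in> S" "h \<in> S" "T = L g" "U = L h" by blast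
    show "T \<circ> U \<in> op_span (L ` S)"
      unfolding gh(3,4) L_comp[OF gh(1,2)]
      by (intro op_span.scale op_span.base imageI m_closed gh)
  qed
next
  fix T assume "T \<in> op_span (L ` S)"
  then show "op_adj S T \<in> op_span (L ` S)"
  proof (rule op_span_adj[OF L_subset_bounded, rotated])
    fix T assume "T \<in> L ` S"
    then obtain g where g: "g \<in> S" "T = L g" by blast
    show "op_adj S T \<in> op_span (L ` S)"
      unfolding g(2) L_adj[OF g(1)] by (intro op_span.scale op_span.base imageI inv_closed g)
  qed
qed

text \<open>The span of the \<open>\<lambda>\<^sub>\<sigma>(g)\<close> is closed under products and adjoints because these unitaries are so up to
  scalars.  Hence its closure is already a C*-algebra.\<close>

lemma reduced_eq_closure: "A = op_closure S (op_span (L ` S))"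
proof
  note c = cstar_subalgebra_closure
  have "L ` S \<subseteq> op_closure S (op_span (L ` S))"
    using op_closure_subset[of "op_span (L ` S)" S] op_span_L_bounded by (blast intro: op_span.base)
  with c show "A \<subseteq> op_closure S (op_span (L ` S))"
    unfolding reduced_twisted_cstar_def cstar_generated_def by blast
  show "op_closure S (op_span (L ` S)) \<subseteq> A"
    unfolding reduced_twisted_cstar_def cstar_generated_def
  proof (intro Inter_greatest)
    fix B assume "B \<in> {A. cstar_subalgebra S A \<and> L ` S \<subseteq> A}"
    then show "op_closure S (op_span (L ` S)) \<subseteq> B"
      by (intro op_closure_least op_span_least) (auto simp: cstar_subalgebra_def)
  qed
qed

lemma cstar_subalgebra_A: "cstar_subalgebra S A"
  unfolding reduced_eq_closure by (rule cstar_subalgebra_closure)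

lemmas AD = cstar_subalgebraD[OF cstar_subalgebra_A]
lemmas AB = AD(1)

lemma span_in_A: "T \<in> op_span (L ` S) \<Longrightarrow> T \<in> A"
  unfolding reduced_eq_closure using op_closure_subset[of "op_span (L ` S)" S] op_span_L_bounded by blast

lemma L_in_A [simp]: "g \<in> S \<Longrightarrow> L g \<in> A"
  by (auto intro: span_in_A op_span.base)

lemma id_in_A [simp]: "op_id S \<in> A"
  using L_in_A[of \<one>] by (simp add: L_one)

lemma A_approx:
  assumes "T \<in> A" "e > 0"
  obtains U where "U \<in> op_span (L ` S)" "op_norm S (op_diff T U) < e"
  using assms by (auto simp: reduced_eq_closure op_closure_def)

lemma A_lim:
  assumes "T \<in> A"
  obtains X where "op_lim S X T" "\<And>k. X k \<in> op_span (L ` S)"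
  by (rule op_closure_lim[of "op_span (L ` S)" S T]) (use assms op_span_L_bounded in \<open>auto simp: reduced_eq_closure\<close>)

lemma commute_if_commute_generators:
  assumes V: "V \<in> bounded_ops S" and gen: "\<And>g. g \<in> S \<Longrightarrow> V \<circ> L g = L g \<circ> V" and T: "T \<in> A"
  shows "V \<circ> T = T \<circ> V"
proof -
  have sp: "V \<circ> U = U \<circ> V" if "U \<in> op_span (L ` S)" for U
    using that
  proof (induction rule: op_span.induct)
    case zero
    show ?case by (simp only: op_comp_zero[OF V])
  next
    case (base T)
    then show ?case using gen by blast
  next
    case (add T U)
    note B = op_span_L_bounded[OF add(1)] op_span_L_bounded[OF add(2)]
    show ?case by (simp only: op_comp_add[OF V B] add)
  next
    case (scale T c)
    show ?case by (simp only: op_comp_scale[OF V op_span_L_bounded[OF scale(1)]] scale)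
  qed
  obtain X where X: "op_lim S X T" "\<And>k. X k \<in> op_span (L ` S)" by (rule A_lim[OF T]) blast
  show ?thesis
    using op_lim_unique[OF op_lim_comp[OF op_lim_const[OF V] X(1)]] op_lim_comp[OF X(1) op_lim_const[OF V]]
    by (simp only: sp[OF X(2)])
qed


section \<open>The canonical trace\<close>

definition canonical_trace :: "'a op2 \<Rightarrow> complex" ("\<tau>") where
  "\<tau> T = T \<delta> \<one>"

lemma delta_ell2 [simp]: "\<delta> \<in> ell2 S" "ell2_norm S \<delta> = 1"
  by (simp_all add: ell2_basis)

lemma trace_inner: "\<tau> T = ell2_inner S (T \<delta>) \<delta>"
  by (simp add: canonical_trace_def ell2_inner_basis)

lemma trace_bound: "T \<in> bounded_ops S \<Longrightarrow> cmod (\<tau> T) \<le> op_norm S T"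
  using ell2_norm_coordinate[of "T \<delta>" S \<one>] op_norm_ge[of T S \<delta>] by (simp add: canonical_trace_def)

lemma trace_linear:
  "\<tau> (op_add T U) = \<tau> T + \<tau> U" "\<tau> (op_scale c T) = c * \<tau> T" "\<tau> (op_diff T U) = \<tau> T - \<tau> U"
  "\<tau> op_zero = 0" "\<tau> (op_id S) = 1"
  by (simp_all add: canonical_trace_def op_add_def op_scale_def op_diff_def op_zero_def)
    (simp add: ell2_basis_def)

lemma trace_L: "g \<in> S \<Longrightarrow> \<tau> (L g) = (if g = \<one> then 1 else 0)"
  by (simp add: canonical_trace_def L_basis) (simp add: ell2_basis_def)

text \<open>Both sides vanish unless \<open>h\<close> is the inverse of \<open>g\<close>, where \<open>cocycle_inv\<close> applies.\<close>

lemma trace_commute_L: "g \<in> S \<Longrightarrow> h \<in> S \<Longrightarrow> \<tau> (L g \<circ> L h) = \<tau> (L h \<circ> L g)"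
  by (auto simp: L_comp trace_linear trace_L cocycle_inv dest: inv_equality)

lemma trace_lim:
  assumes X: "op_lim S X T"
  shows "(\<lambda>k. \<tau> (X k)) \<longlonglongrightarrow> \<tau> T"
proof (rule LIM_zero_cancel)
  have "norm (\<tau> (X k) - \<tau> T) \<le> op_norm S (op_diff (X k) T)" for k
    using trace_bound[OF op_diff_bounded(1)[OF op_limD(1,2)[OF X]], of k] by (simp add: trace_linear)
  then show "(\<lambda>k. \<tau> (X k) - \<tau> T) \<longlonglongrightarrow> 0"
    by (intro Lim_null_comparison[OF _ op_limD(3)[OF X]] always_eventually allI)
qed

lemma trace_commute_generator:
  assumes U: "U \<in> bounded_ops S" and gen: "\<And>g. g \<in> S \<Longrightarrow> \<tau> (L g \<circ> U) = \<tau> (U \<circ> L g)" and T: "T \<in> A"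
  shows "\<tau> (T \<circ> U) = \<tau> (U \<circ> T)"
proof -
  have sp: "\<tau> (T \<circ> U) = \<tau> (U \<circ> T)" if "T \<in> op_span (L ` S)" for T
    using that
  proof (induction rule: op_span.induct)
    case zero
    show ?case by (simp only: op_comp_zero[OF U])
  next
    case (base T)
    then show ?case using gen by blast
  next
    case (add T V)
    note B = op_span_L_bounded[OF add(1)] op_span_L_bounded[OF add(2)]
    show ?case by (simp only: op_comp_add[OF U B] trace_linear add)
  next
    case (scale T c)
    show ?case by (simp only: op_comp_scale[OF U op_span_L_bounded[OF scale(1)]] trace_linear scale)
  qed
  obtain X where X: "op_lim S X T" "\<And>k. X k \<in> op_span (L ` S)" by (rule A_lim[OF T]) blast
  show ?thesis
    using LIMSEQ_unique[OF trace_lim[OF op_lim_comp[OF X(1) op_lim_const[OF U]]]]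
      trace_lim[OF op_lim_comp[OF op_lim_const[OF U] X(1)]]
    by (simp only: sp[OF X(2)])
qed

lemma trace_commute:
  assumes T: "T \<in> A" and U: "U \<in> A"
  shows "\<tau> (T \<circ> U) = \<tau> (U \<circ> T)"
  by (rule trace_commute_generator[OF AB[OF U] _ T])
    (rule trace_commute_generator[OF _ _ U, symmetric]; simp add: trace_commute_L)

lemma trace_adj_self: "T \<in> bounded_ops S \<Longrightarrow> \<tau> (op_adj S T \<circ> T) = of_real ((ell2_norm S (T \<delta>))\<^sup>2)"
  by (simp add: trace_inner op_adj_inner' ell2_inner_self)

lemma tracial_state_canonical: "tracial_state S A (restrict \<tau> A)"
proof -
  have r: "restrict \<tau> A T = \<tau> T" if "T \<in> A" for T using that by simp
  have pos: "\<tau> (op_adj S T \<circ> T) \<in> \<real> \<and> 0 \<le> Re (\<tau> (op_adj S T \<circ> T))" if "T \<in> A" for T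
    unfolding trace_adj_self[OF AB[OF that]] by simp
  show ?thesis
    unfolding tracial_state_def
    by (intro conjI ballI allI restrict_extensional)
      (simp_all only: r AD(2-7) id_in_A trace_linear pos, rule trace_commute)
qed

text \<open>The hypothesis says that \<open>T\<close> kills \<open>\<delta>\<close>.  By the trace property it applies to \<open>T \<lambda>\<^sub>\<sigma>(g)\<close> as well, so \<open>T\<close> kills
  every basis vector.\<close>

lemma trace_faithful:
  assumes T: "T \<in> A" and zero: "\<tau> (op_adj S T \<circ> T) = 0"
  shows "T = op_zero"
proof -
  have Tg: "T (ell2_basis g) = (\<lambda>x. 0)" if g: "g \<in> S" for g
  proof -
    have Lg: "L g \<delta> = ell2_basis g" using g by (simp add: L_basis)
    let ?U = "T \<circ> L g"
    have U: "?U \<in> A" by (intro AD(6) T L_in_A g)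
    have 1: "op_adj S ?U \<circ> ?U = op_adj S (L g) \<circ> ((op_adj S T \<circ> T) \<circ> L g)"
      by (simp only: op_adj_comp[OF AB[OF T] L_bounded[OF g]] o_assoc)
    have 2: "((op_adj S T \<circ> T) \<circ> L g) \<circ> op_adj S (L g) = op_adj S T \<circ> T"
      by (simp only: comp_assoc L_unitary(2)[OF g] op_comp_id(1)[OF AB[OF T]])
    have "\<tau> (op_adj S ?U \<circ> ?U) = \<tau> (((op_adj S T \<circ> T) \<circ> L g) \<circ> op_adj S (L g))"
      unfolding 1 by (intro trace_commute AD(6,7) T L_in_A g)
    also have "\<dots> = 0" by (simp only: 2 zero)
    finally have "\<tau> (op_adj S ?U \<circ> ?U) = 0" .
    then have "ell2_norm S (?U \<delta>) = 0" using trace_adj_self[OF AB[OF U]] by simp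
    then show ?thesis using ell2_norm_eq_0[of "?U \<delta>" S] AB[OF U] AB[OF T] Lg by simp
  qed
  show ?thesis
  proof (rule op_eqI[OF AB[OF T] op_zero_bounded])
    fix \<xi> assume \<xi>: "\<xi> \<in> ell2 S"
    show "T \<xi> = op_zero \<xi>"
    proof
      fix x
      have "T \<xi> x = 0" if x: "x \<in> S"
      proof -
        have adj: "op_adj S T (ell2_basis x) = (\<lambda>x. 0)"
        proof
          fix g show "op_adj S T (ell2_basis x) g = 0"
          proof (cases "g \<in> S")
            case True
            then show ?thesis using ell2_inner_basis(2)[OF True, of "op_adj S T (ell2_basis x)"]
              op_adj_inner'[OF AB[OF T] ell2_basis(1)[OF x] ell2_basis(1)[OF True]] Tg[OF True] by simp
          qed (use ell2_off[of "op_adj S T (ell2_basis x)" S g] op_adj_bounded[OF AB[OF T]] in auto)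
        qed
        have "T \<xi> x = ell2_inner S (T \<xi>) (ell2_basis x)" using ell2_inner_basis(2)[OF x] by simp
        also have "\<dots> = 0" using op_adj_inner[OF AB[OF T] \<xi> ell2_basis(1)[OF x]] adj by simp
        finally show ?thesis .
      qed
      then show "T \<xi> x = op_zero \<xi> x"
        using ell2_off[of "T \<xi>" S x] AB[OF T] by (cases "x \<in> S") (auto simp: op_zero_def)
    qed
  qed
qed

end


section \<open>Averaging over conjugations\<close>

definition op_sum :: "'i set \<Rightarrow> ('i \<Rightarrow> 'a op2) \<Rightarrow> 'a op2" where
  "op_sum I T = (\<lambda>\<xi> x. \<Sum>i\<in>I. T i \<xi> x)"

lemma op_sum_Suc: "op_sum {..<0::nat} T = op_zero" "op_sum {..<Suc N} T = op_add (op_sum {..<N} T) (T N)"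
  by (simp_all add: op_sum_def op_zero_def op_add_def)

lemma op_sum_subspace:
  fixes N :: nat
  assumes "op_subspace J" "\<And>i. i < N \<Longrightarrow> T i \<in> J"
  shows "op_sum {..<N} T \<in> J"
  using assms(2)
proof (induction N)
  case 0
  show ?case unfolding op_sum_Suc using assms(1) by (simp add: op_subspace_def)
next
  case (Suc N)
  then have "op_sum {..<N} T \<in> J" "T N \<in> J" by auto
  then show ?case unfolding op_sum_Suc using assms(1) by (simp add: op_subspace_def)
qed

lemma op_norm_sum_le:
  fixes N :: nat
  assumes "\<And>i. i < N \<Longrightarrow> T i \<in> bounded_ops S \<and> op_norm S (T i) \<le> K"
  shows "op_norm S (op_sum {..<N} T) \<le> real N * K"
  using assms
proof (induction N)
  case 0
  show ?case unfolding op_sum_Suc by simp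
next
  case (Suc N)
  have "op_sum {..<N} T \<in> bounded_ops S"
    by (rule op_sum_subspace[OF bounded_ops_subspace]) (use Suc.prems in auto)
  moreover have "op_norm S (op_sum {..<N} T) \<le> real N * K" by (rule Suc.IH) (use Suc.prems in auto)
  ultimately show ?case
    unfolding op_sum_Suc using op_add_bounded(2)[of "op_sum {..<N} T" S "T N"] Suc.prems[of N]
    by (simp add: algebra_simps)
qed

context twisted_group
begin

definition Ad :: "'a \<Rightarrow> 'a op2 \<Rightarrow> 'a op2" where
  "Ad g T = L g \<circ> T \<circ> op_adj S (L g)"

lemma L_adj_bounded: "g \<in> S \<Longrightarrow> op_adj S (L g) \<in> bounded_ops S"
  by (intro op_adj_bounded L_bounded)

lemma Ad_bounded: "g \<in> S \<Longrightarrow> T \<in> bounded_ops S \<Longrightarrow> Ad g T \<in> bounded_ops S"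
  unfolding Ad_def by (intro op_comp_bounded L_bounded L_adj_bounded)

lemma Ad_norm:
  assumes g: "g \<in> S" and T: "T \<in> bounded_ops S"
  shows "op_norm S (Ad g T) \<le> op_norm S T"
proof -
  have 1: "op_norm S (L g \<circ> T) \<le> 1 * op_norm S T"
    by (rule order_trans[OF op_comp_bounded(2)[OF L_bounded[OF g] T] mult_right_mono])
      (use op_norm_L[OF g] T in auto)
  have 2: "op_norm S (op_adj S (L g)) \<le> 1"
    using op_norm_adj_le[OF L_bounded[OF g]] op_norm_L[OF g] by linarith
  have "op_norm S (Ad g T) \<le> op_norm S (L g \<circ> T) * op_norm S (op_adj S (L g))"
    unfolding Ad_def by (intro op_comp_bounded L_bounded L_adj_bounded g T)
  also have "\<dots> \<le> (1 * op_norm S T) * 1"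
    by (rule mult_mono[OF 1 2]) (use T L_adj_bounded[OF g] in auto)
  finally show ?thesis by simp
qed

lemma Ad_linear:
  assumes g: "g \<in> S" and T: "T \<in> bounded_ops S" and U: "U \<in> bounded_ops S"
  shows "Ad g (op_add T U) = op_add (Ad g T) (Ad g U)"
    and "Ad g (op_scale c T) = op_scale c (Ad g T)"
  unfolding Ad_def
    op_comp_add(1)[OF L_bounded[OF g] T U] op_comp_scale(1)[OF L_bounded[OF g] T]
    op_comp_add(2)[OF L_adj_bounded[OF g] op_comp_bounded(1)[OF L_bounded[OF g] T] op_comp_bounded(1)[OF L_bounded[OF g] U]]
    op_comp_scale(2)[OF L_adj_bounded[OF g] op_comp_bounded(1)[OF L_bounded[OF g] T]]
  by (rule refl)+

lemma Ad_mult: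
  assumes g: "g \<in> S" and h: "h \<in> S" and T: "T \<in> bounded_ops S"
  shows "Ad (g \<otimes> h) T = Ad g (Ad h T)"
proof -
  let ?c = "\<sigma> g h" and ?W = "L g \<circ> L h"
  have cc: "cnj ?c * ?c = 1" using cocycle_cnj[OF g h] by (simp add: mult.commute)
  have W: "?W \<in> bounded_ops S" by (intro op_comp_bounded L_bounded g h)
  have eq: "L (g \<otimes> h) = op_scale (cnj ?c) ?W"
    unfolding L_comp[OF g h] op_scale_scale cc by simp
  have adj: "op_adj S (L (g \<otimes> h)) = op_scale ?c (op_adj S ?W)"
    unfolding eq op_adj_scale[OF W] by simp
  have "Ad (g \<otimes> h) T = op_scale (cnj ?c * ?c) (?W \<circ> T \<circ> op_adj S ?W)"
    unfolding Ad_def adj unfolding eq op_comp_scale(2)[OF T W]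
      op_comp_scale(2)[OF op_scale_bounded(1)[OF op_adj_bounded[OF W]] op_comp_bounded(1)[OF W T]]
      op_comp_scale(1)[OF op_comp_bounded(1)[OF W T] op_adj_bounded[OF W]] op_scale_scale
    by (rule refl)
  then show ?thesis
    unfolding cc op_scale_one Ad_def op_adj_comp[OF L_bounded[OF g] L_bounded[OF h]] by (simp only: o_assoc)
qed

lemma Ad_one: "g \<in> S \<Longrightarrow> Ad g (op_id S) = op_id S"
  unfolding Ad_def by (simp only: op_comp_id(1)[OF L_bounded] L_unitary(2))

lemma Ad_in_A: "g \<in> S \<Longrightarrow> T \<in> A \<Longrightarrow> Ad g T \<in> A"
  unfolding Ad_def by (intro AD(6,7) L_in_A)

lemma Ad_central:
  assumes g: "g \<in> S" and z: "z \<in> S" and comm: "g \<otimes> z = z \<otimes> g"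
  shows "Ad g (L z) = op_scale (\<sigma> g z * cnj (\<sigma> z g)) (L z)"
proof -
  have "L g \<circ> L z = op_scale (\<sigma> g z * (cnj (\<sigma> z g) * \<sigma> z g)) (L (z \<otimes> g))"
    unfolding L_comp[OF g z] comm using cocycle_cnj[OF z g] by (simp add: mult.commute)
  also have "\<dots> = op_scale (\<sigma> g z * cnj (\<sigma> z g)) (L z \<circ> L g)"
    unfolding L_comp[OF z g] op_scale_scale by (simp add: mult.assoc)
  finally have "Ad g (L z) = op_scale (\<sigma> g z * cnj (\<sigma> z g)) (L z \<circ> L g \<circ> op_adj S (L g))"
    unfolding Ad_def using op_comp_scale(2)[OF L_adj_bounded[OF g] op_comp_bounded(1)[OF L_bounded[OF z] L_bounded[OF g]]]
    by (simp only:)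
  then show ?thesis
    unfolding comp_assoc L_unitary(2)[OF g] op_comp_id(1)[OF L_bounded[OF z]] .
qed

definition conj_mean :: "nat \<Rightarrow> (nat \<Rightarrow> 'a) \<Rightarrow> 'a op2 \<Rightarrow> 'a op2" where
  "conj_mean N g T = op_scale (1 / of_nat N) (op_sum {..<N} (\<lambda>i. Ad (g i) T))"

text \<open>Compositions of means over conjugations.  They are maps on operators, because one and the
  same averaging process has to be applied to all summands of an operator.\<close>

inductive averaging :: "('a op2 \<Rightarrow> 'a op2) \<Rightarrow> bool" where
  avg_id: "averaging (\<lambda>T. T)"
| avg_mean: "averaging \<Phi> \<Longrightarrow> 0 < N \<Longrightarrow> (\<And>i. i < N \<Longrightarrow> g i \<in> S) \<Longrightarrow> averaging (\<lambda>T. conj_mean N g (\<Phi> T))"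

lemma averaging_compose:
  assumes "averaging \<Psi>" "averaging \<Phi>"
  shows "averaging (\<lambda>T. \<Psi> (\<Phi> T))"
  using assms(1)
proof (induction rule: averaging.induct)
  case avg_id
  show ?case by (rule assms(2))
next
  case (avg_mean \<Psi> N g)
  show ?case by (rule averaging.avg_mean[OF avg_mean(4,2,3)])
qed

lemma conj_mean_subspace:
  assumes J: "op_subspace J" and Ad: "\<And>g T. g \<in> S \<Longrightarrow> T \<in> J \<Longrightarrow> Ad g T \<in> J"
    and g: "\<And>i. i < N \<Longrightarrow> g i \<in> S" and T: "T \<in> J"
  shows "conj_mean N g T \<in> J"
proof -
  have "op_sum {..<N} (\<lambda>i. Ad (g i) T) \<in> J" by (intro op_sum_subspace J Ad g T)
  then show ?thesis using J by (simp add: conj_mean_def op_subspace_def)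
qed

text \<open>Applied to the algebra, to an ideal, and to the line spanned by the unitary of a central element.\<close>

lemma averaging_subspace:
  assumes "averaging \<Phi>" and "op_subspace J" "\<And>g T. g \<in> S \<Longrightarrow> T \<in> J \<Longrightarrow> Ad g T \<in> J" and "T \<in> J"
  shows "\<Phi> T \<in> J"
  using assms(1)
proof (induction rule: averaging.induct)
  case avg_id
  show ?case by (rule assms(4))
next
  case (avg_mean \<Phi> N g)
  show ?case by (rule conj_mean_subspace[OF assms(2,3) avg_mean(3,4)])
qed

lemma averaging_bounded:
  assumes "averaging \<Phi>" "T \<in> bounded_ops S"
  shows "\<Phi> T \<in> bounded_ops S"
  by (rule averaging_subspace[OF assms(1) bounded_ops_subspace Ad_bounded assms(2)])

lemma A_subspace: "op_subspace A"
  using cstar_subalgebra_A by (simp add: cstar_subalgebra_def)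

lemma averaging_in_A:
  assumes "averaging \<Phi>" "T \<in> A"
  shows "\<Phi> T \<in> A"
  by (rule averaging_subspace[OF assms(1) A_subspace Ad_in_A assms(2)])

lemma conj_mean_norm:
  assumes g: "\<And>i. i < N \<Longrightarrow> g i \<in> S" and N: "0 < N" and T: "T \<in> bounded_ops S"
  shows "op_norm S (conj_mean N g T) \<le> op_norm S T"
proof -
  have s: "op_sum {..<N} (\<lambda>i. Ad (g i) T) \<in> bounded_ops S"
    by (intro op_sum_subspace bounded_ops_subspace Ad_bounded g T)
  have "op_norm S (op_sum {..<N} (\<lambda>i. Ad (g i) T)) \<le> real N * op_norm S T"
    by (rule op_norm_sum_le) (auto intro: Ad_bounded Ad_norm g T)
  then have "cmod (1 / of_nat N) * op_norm S (op_sum {..<N} (\<lambda>i. Ad (g i) T)) \<le> op_norm S T"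
    using N by (simp add: norm_divide pos_divide_le_eq mult.commute)
  then show ?thesis unfolding conj_mean_def using op_scale_bounded(2)[OF s, of "1 / of_nat N"] by linarith
qed

lemma averaging_norm:
  assumes "averaging \<Phi>" and T: "T \<in> bounded_ops S"
  shows "op_norm S (\<Phi> T) \<le> op_norm S T"
  using assms(1)
proof (induction rule: averaging.induct)
  case (avg_mean \<Phi> N g)
  then show ?case
    using conj_mean_norm[of N g "\<Phi> T"] averaging_bounded[OF avg_mean(1) T] by force
qed simp

lemma conj_mean_linear:
  assumes g: "\<And>i. i < N \<Longrightarrow> g i \<in> S" and T: "T \<in> bounded_ops S" and U: "U \<in> bounded_ops S"
  shows "conj_mean N g (op_add T U) = op_add (conj_mean N g T) (conj_mean N g U)"
    and "conj_mean N g (op_scale c T) = op_scale c (conj_mean N g T)"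
proof -
  have "op_sum {..<N} (\<lambda>i. Ad (g i) (op_add T U)) =
      op_add (op_sum {..<N} (\<lambda>i. Ad (g i) T)) (op_sum {..<N} (\<lambda>i. Ad (g i) U))"
    unfolding op_sum_def op_add_def sum.distrib[symmetric]
    by (intro ext sum.cong refl) (use Ad_linear(1)[OF g T U] in \<open>simp add: op_add_def\<close>)
  then show "conj_mean N g (op_add T U) = op_add (conj_mean N g T) (conj_mean N g U)"
    by (simp add: conj_mean_def op_scale_def op_add_def distrib_left)
  have "op_sum {..<N} (\<lambda>i. Ad (g i) (op_scale c T)) = op_scale c (op_sum {..<N} (\<lambda>i. Ad (g i) T))"
    unfolding op_sum_def op_scale_def sum_distrib_left
    by (intro ext sum.cong refl) (use Ad_linear(2)[OF g T U] in \<open>simp add: op_scale_def\<close>)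
  then show "conj_mean N g (op_scale c T) = op_scale c (conj_mean N g T)"
    by (simp add: conj_mean_def op_scale_scale mult.commute)
qed

lemma averaging_linear:
  assumes "averaging \<Phi>" and T: "T \<in> bounded_ops S" and U: "U \<in> bounded_ops S"
  shows "\<Phi> (op_add T U) = op_add (\<Phi> T) (\<Phi> U)" and "\<Phi> (op_scale c T) = op_scale c (\<Phi> T)"
proof -
  have "\<Phi> (op_add T U) = op_add (\<Phi> T) (\<Phi> U) \<and> \<Phi> (op_scale c T) = op_scale c (\<Phi> T)"
    using assms(1)
  proof (induction rule: averaging.induct)
    case avg_id
    show ?case by simp
  next
    case (avg_mean \<Phi> N g)
    note b = averaging_bounded[OF avg_mean(1) T] averaging_bounded[OF avg_mean(1) U]
    have "conj_mean N g (op_add (\<Phi> T) (\<Phi> U)) = op_add (conj_mean N g (\<Phi> T)) (conj_mean N g (\<Phi> U))"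
        "conj_mean N g (op_scale c (\<Phi> T)) = op_scale c (conj_mean N g (\<Phi> T))"
      by (rule conj_mean_linear[OF _ b]; fact avg_mean(3))+
    then show ?case using avg_mean(4) by (simp only:)
  qed
  then show "\<Phi> (op_add T U) = op_add (\<Phi> T) (\<Phi> U)" and "\<Phi> (op_scale c T) = op_scale c (\<Phi> T)"
    by blast+
qed

lemma averaging_diff:
  assumes "averaging \<Phi>" "T \<in> bounded_ops S" "U \<in> bounded_ops S"
  shows "\<Phi> (op_diff T U) = op_diff (\<Phi> T) (\<Phi> U)"
  by (simp only: op_diff_eq averaging_linear(1)[OF assms(1,2) op_scale_bounded(1)[OF assms(3)]]
      averaging_linear(2)[OF assms(1,3,3)])

lemma op_sum_const: "op_sum {..<N} (\<lambda>i. op_scale (c i) T) = op_scale (\<Sum>i<N. c i) T"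
  by (simp add: op_sum_def op_scale_def sum_distrib_right)

lemma averaging_one:
  assumes "averaging \<Phi>"
  shows "\<Phi> (op_id S) = op_id S"
  using assms
proof (induction rule: averaging.induct)
  case (avg_mean \<Phi> N g)
  have "op_sum {..<N} (\<lambda>i. Ad (g i) (op_id S)) = op_sum {..<N} (\<lambda>i. op_scale 1 (op_id S))"
    unfolding op_sum_def by (intro ext sum.cong refl) (use avg_mean in \<open>simp add: Ad_one\<close>)
  also have "\<dots> = op_scale (of_nat N) (op_id S)" unfolding op_sum_const by simp
  finally show ?case using avg_mean by (simp add: conj_mean_def op_scale_scale)
qed simp

lemma averaging_central:
  assumes "averaging \<Phi>" and z: "z \<in> S" "\<And>g. g \<in> S \<Longrightarrow> g \<otimes> z = z \<otimes> g"
  shows "\<exists>c. \<Phi> (L z) = op_scale c (L z)"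
proof -
  have sub: "op_subspace (range (\<lambda>c. op_scale c (L z)))"
    unfolding op_subspace_def
  proof (intro conjI ballI allI)
    have "op_zero = op_scale 0 (L z)" by (simp add: op_zero_def op_scale_def)
    then show "op_zero \<in> range (\<lambda>c. op_scale c (L z))" by blast
  next
    fix T U assume "T \<in> range (\<lambda>c. op_scale c (L z))" "U \<in> range (\<lambda>c. op_scale c (L z))"
    then obtain c d where "T = op_scale c (L z)" "U = op_scale d (L z)" by blast
    then have "op_add T U = op_scale (c + d) (L z)" by (simp add: op_add_def op_scale_def distrib_right)
    then show "op_add T U \<in> range (\<lambda>c. op_scale c (L z))" by blast
  next
    fix c T assume "T \<in> range (\<lambda>c. op_scale c (L z))"
    then show "op_scale c T \<in> range (\<lambda>c. op_scale c (L z))" by (auto simp: op_scale_scale)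
  qed
  have "Ad g T \<in> range (\<lambda>c. op_scale c (L z))" if g: "g \<in> S" and T: "T \<in> range (\<lambda>c. op_scale c (L z))" for g T
  proof -
    obtain c where c: "T = op_scale c (L z)" using T by blast
    show ?thesis
      unfolding c Ad_linear(2)[OF g L_bounded[OF z(1)] L_bounded[OF z(1)]] Ad_central[OF g z(1) z(2)[OF g]]
        op_scale_scale by blast
  qed
  moreover have "L z \<in> range (\<lambda>c. op_scale c (L z))" using rangeI[of "\<lambda>c. op_scale c (L z)" 1] by simp
  ultimately show ?thesis using averaging_subspace[OF assms(1) sub, of "L z"] by blast
qed

text \<open>Conjugation by a unitary does not change the value of a trace.\<close>

lemma tracial_state_averaging:
  assumes \<phi>: "tracial_state S A \<phi>" and "averaging \<Phi>" and T: "T \<in> A"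
  shows "\<phi> (\<Phi> T) = \<phi> T"
  using assms(2)
proof (induction rule: averaging.induct)
  case (avg_mean \<Phi> N g)
  have add: "\<phi> (op_add T U) = \<phi> T + \<phi> U" and scale: "\<phi> (op_scale c T) = c * \<phi> T"
      and comm: "\<phi> (T \<circ> U) = \<phi> (U \<circ> T)"
    if "T \<in> A" "U \<in> A" for T U c
    using \<phi> that by (simp_all only: tracial_state_def)
  have PT: "\<Phi> T \<in> A" by (rule averaging_in_A[OF avg_mean(1) T])
  have zero: "\<phi> op_zero = 0"
    using scale[OF AD(2) AD(2), where c=0] by (simp add: op_scale_def op_zero_def)
  have Ad: "\<phi> (Ad h (\<Phi> T)) = \<phi> (\<Phi> T)" if h: "h \<in> S" for h
  proof -
    have "\<phi> (Ad h (\<Phi> T)) = \<phi> (op_adj S (L h) \<circ> (L h \<circ> \<Phi> T))"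
      unfolding Ad_def by (intro comm AD(6,7) L_in_A h PT)
    also have "op_adj S (L h) \<circ> (L h \<circ> \<Phi> T) = \<Phi> T"
      by (simp only: o_assoc L_unitary(1)[OF h] op_comp_id(2)[OF AB[OF PT]])
    finally show ?thesis .
  qed
  have "op_sum {..<M} (\<lambda>i. Ad (g i) (\<Phi> T)) \<in> A \<and>
      \<phi> (op_sum {..<M} (\<lambda>i. Ad (g i) (\<Phi> T))) = of_nat M * \<phi> (\<Phi> T)" if "M \<le> N" for M
    using that
  proof (induction M)
    case 0
    show ?case unfolding op_sum_Suc by (simp add: zero AD(2))
  next
    case (Suc M)
    then have IH: "op_sum {..<M} (\<lambda>i. Ad (g i) (\<Phi> T)) \<in> A"
      "\<phi> (op_sum {..<M} (\<lambda>i. Ad (g i) (\<Phi> T))) = of_nat M * \<phi> (\<Phi> T)" by auto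
    have gM: "g M \<in> S" using avg_mean(3)[of M] Suc.prems by simp
    show ?case
      unfolding op_sum_Suc add[OF IH(1) Ad_in_A[OF gM PT]] IH(2) Ad[OF gM]
      using AD(3)[OF IH(1) Ad_in_A[OF gM PT]] by (simp add: algebra_simps)
  qed
  note sum = this[OF order_refl]
  have "\<phi> (conj_mean N g (\<Phi> T)) = 1 / of_nat N * (of_nat N * \<phi> (\<Phi> T))"
    unfolding conj_mean_def scale[OF conjunct1[OF sum] conjunct1[OF sum]] conjunct2[OF sum] by (rule refl)
  then show ?case using avg_mean(2,4) by simp
qed simp


section \<open>Averaging away central elements that are not regular\<close>

lemma Ad_pow_central:
  assumes h: "h \<in> S" and z: "z \<in> S" and comm: "h \<otimes> z = z \<otimes> h"
  shows "Ad (h [^] (i::nat)) (L z) = op_scale ((\<sigma> h z * cnj (\<sigma> z h)) ^ i) (L z)"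
proof (induction i)
  case 0
  show ?case using Ad_central[OF one_closed z] z by simp
next
  case (Suc i)
  note Lz = L_bounded[OF z]
  have "Ad (h [^] Suc i) (L z) = Ad (h [^] i) (Ad h (L z))"
    using Ad_mult[OF nat_pow_closed[OF h] h Lz] by simp
  also have "\<dots> = op_scale ((\<sigma> h z * cnj (\<sigma> z h)) ^ Suc i) (L z)"
    unfolding Ad_central[OF h z comm] Ad_linear(2)[OF nat_pow_closed[OF h] Lz Lz] Suc op_scale_scale by simp
  finally show ?case .
qed

text \<open>A non-regular central \<open>z\<close> has a witness \<open>h\<close>, and conjugation by \<open>\<lambda>\<^sub>\<sigma>(h)\<close> multiplies \<open>\<lambda>\<^sub>\<sigma>(z)\<close> by a number
  \<open>w \<noteq> 1\<close> of modulus one.  The mean over \<open>N\<close> powers of \<open>h\<close> multiplies it by \<open>(1 + w + \<dots> + w\<^sup>N\<^sup>-\<^sup>1) / N\<close>, whose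
  modulus is at most \<open>2 / (N |w - 1|)\<close>.\<close>

lemma central_averaging_small:
  assumes z: "z \<in> S" "\<And>g. g \<in> S \<Longrightarrow> g \<otimes> z = z \<otimes> g" and nreg: "\<not> sigma_regular G \<sigma> z" and e: "e > 0"
  obtains \<Phi> where "averaging \<Phi>" "op_norm S (\<Phi> (L z)) < e"
proof -
  obtain h where h: "h \<in> S" "\<sigma> z h \<noteq> \<sigma> h z" using nreg z by (auto simp: sigma_regular_def)
  define w where "w = \<sigma> h z * cnj (\<sigma> z h)"
  have w1: "cmod w = 1" using h z by (simp add: w_def norm_mult)
  have w: "w \<noteq> 1"
  proof
    assume "w = 1"
    then have "\<sigma> h z * (cnj (\<sigma> z h) * \<sigma> z h) = \<sigma> z h" by (simp add: w_def flip: mult.assoc)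
    then show False using cocycle_cnj[OF z(1) h(1)] h(2) by (simp add: mult.commute)
  qed
  obtain N :: nat where N: "2 / cmod (w - 1) / e < real N" using reals_Archimedean2 by blast
  have "0 < cmod (w - 1)" using w by simp
  then have N0: "N > 0" using N e by (metis divide_pos_pos less_trans of_nat_0_less_iff zero_less_numeral)
  have "cmod (\<Sum>i<N. w ^ i) = cmod (w ^ N - 1) / cmod (w - 1)"
    using geometric_sum[OF w, of N] by (simp add: norm_divide)
  also have "\<dots> \<le> 2 / cmod (w - 1)"
    using norm_triangle_ineq4[of "w ^ N" 1] w1 by (intro divide_right_mono) (auto simp: norm_power)
  finally have s: "cmod (\<Sum>i<N. w ^ i) \<le> 2 / cmod (w - 1)" .
  have eq: "conj_mean N (\<lambda>i. h [^] i) (L z) = op_scale (1 / of_nat N * (\<Sum>i<N. w ^ i)) (L z)"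
    unfolding conj_mean_def Ad_pow_central[OF h(1) z(1) z(2)[OF h(1)]] op_sum_const op_scale_scale w_def by (rule refl)
  have "op_norm S (conj_mean N (\<lambda>i. h [^] i) (L z)) \<le> cmod (1 / of_nat N * (\<Sum>i<N. w ^ i)) * op_norm S (L z)"
    unfolding eq by (intro op_scale_bounded L_bounded z)
  also have "\<dots> \<le> cmod (1 / of_nat N * (\<Sum>i<N. w ^ i)) * 1"
    by (intro mult_left_mono op_norm_L z) auto
  also have "\<dots> = cmod (\<Sum>i<N. w ^ i) / real N" by (simp add: norm_mult norm_divide)
  also have "\<dots> \<le> 2 / cmod (w - 1) / real N" by (intro divide_right_mono s) auto
  also have "\<dots> < e"
  proof -
    have "2 / cmod (w - 1) < real N * e" using N e by (simp only: pos_divide_less_eq)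
    then show ?thesis using N0 by (simp only: pos_divide_less_eq of_nat_0_less_iff mult.commute)
  qed
  finally have "op_norm S (conj_mean N (\<lambda>i. h [^] i) (L z)) < e" .
  moreover have "averaging (\<lambda>T. conj_mean N (\<lambda>i. h [^] i) T)"
    by (intro avg_mean avg_id N0 nat_pow_closed h)
  ultimately show thesis by (rule that[rotated])
qed

text \<open>The quantifier over \<open>\<Psi>\<close> is what makes the property additive: the averaging that serves one summand
  becomes part of \<open>\<Psi>\<close> for the next one.\<close>

definition averages_away :: "'a op2 \<Rightarrow> bool" where
  "averages_away T \<longleftrightarrow> (\<forall>\<Psi>. averaging \<Psi> \<longrightarrow> (\<forall>e>0. \<exists>\<Phi>. averaging \<Phi> \<and> op_norm S (\<Phi> (\<Psi> T)) < e))"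

lemma averages_awayD:
  assumes "averages_away T" "averaging \<Psi>" "e > 0"
  obtains \<Phi> where "averaging \<Phi>" "op_norm S (\<Phi> (\<Psi> T)) < e"
  using assms unfolding averages_away_def by meson

lemma averages_away_scale:
  assumes T: "averages_away T" "T \<in> bounded_ops S"
  shows "averages_away (op_scale c T)"
  unfolding averages_away_def
proof (intro allI impI)
  fix \<Psi> and e :: real assume \<Psi>: "averaging \<Psi>" and e: "e > 0"
  note TB = averaging_bounded[OF \<Psi> T(2)]
  have c0: "cmod c + 1 > 0" by (simp add: add_nonneg_pos)
  obtain \<Phi> where \<Phi>: "averaging \<Phi>" "op_norm S (\<Phi> (\<Psi> T)) < e / (cmod c + 1)"
    by (rule averages_awayD[OF T(1) \<Psi> divide_pos_pos[OF e c0]])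
  note bd = averaging_bounded[OF \<Phi>(1) TB]
  have "op_norm S (\<Phi> (\<Psi> (op_scale c T))) = op_norm S (op_scale c (\<Phi> (\<Psi> T)))"
    by (simp only: averaging_linear(2)[OF \<Psi> T(2) T(2)] averaging_linear(2)[OF \<Phi>(1) TB TB])
  also have "\<dots> \<le> cmod c * op_norm S (\<Phi> (\<Psi> T))" by (rule op_scale_bounded(2)[OF bd])
  also have "\<dots> \<le> (cmod c + 1) * op_norm S (\<Phi> (\<Psi> T))"
    by (intro mult_right_mono op_norm_nonneg bd) simp
  also have "\<dots> < e" using \<Phi>(2) unfolding pos_less_divide_eq[OF c0] by (simp only: mult.commute)
  finally show "\<exists>\<Phi>. averaging \<Phi> \<and> op_norm S (\<Phi> (\<Psi> (op_scale c T))) < e"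
    by (intro exI[of _ \<Phi>] conjI \<Phi>(1))
qed

lemma averages_away_central:
  assumes z: "z \<in> S" "\<And>g. g \<in> S \<Longrightarrow> g \<otimes> z = z \<otimes> g" and nreg: "\<not> sigma_regular G \<sigma> z"
  shows "averages_away (L z)"
  unfolding averages_away_def
proof (intro allI impI)
  fix \<Psi> and e :: real assume \<Psi>: "averaging \<Psi>" and e: "e > 0"
  obtain c where c: "\<Psi> (L z) = op_scale c (L z)" using averaging_central[OF \<Psi> z] by blast
  have c0: "cmod c + 1 > 0" by (simp add: add_nonneg_pos)
  obtain \<Phi> where \<Phi>: "averaging \<Phi>" "op_norm S (\<Phi> (L z)) < e / (cmod c + 1)"
    by (rule central_averaging_small[OF z nreg divide_pos_pos[OF e c0]])
  note Lz = L_bounded[OF z(1)]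
  note bd = averaging_bounded[OF \<Phi>(1) Lz]
  have "op_norm S (\<Phi> (\<Psi> (L z))) = op_norm S (op_scale c (\<Phi> (L z)))"
    by (simp only: c averaging_linear(2)[OF \<Phi>(1) Lz Lz])
  also have "\<dots> \<le> cmod c * op_norm S (\<Phi> (L z))" by (rule op_scale_bounded(2)[OF bd])
  also have "\<dots> \<le> (cmod c + 1) * op_norm S (\<Phi> (L z))"
    by (intro mult_right_mono op_norm_nonneg bd) simp
  also have "\<dots> < e" using \<Phi>(2) unfolding pos_less_divide_eq[OF c0] by (simp only: mult.commute)
  finally show "\<exists>\<Phi>. averaging \<Phi> \<and> op_norm S (\<Phi> (\<Psi> (L z))) < e"
    by (intro exI[of _ \<Phi>] conjI \<Phi>(1))
qed

lemma averages_away_add: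
  assumes T: "averages_away T" "T \<in> bounded_ops S" and U: "averages_away U" "U \<in> bounded_ops S"
  shows "averages_away (op_add T U)"
  unfolding averages_away_def
proof (intro allI impI)
  fix \<Psi> and e :: real assume \<Psi>: "averaging \<Psi>" and e: "e > 0"
  note TB = averaging_bounded[OF \<Psi> T(2)] and UB = averaging_bounded[OF \<Psi> U(2)]
  have e2: "e / 2 > 0" using e by simp
  obtain \<Phi>1 where 1: "averaging \<Phi>1" "op_norm S (\<Phi>1 (\<Psi> T)) < e / 2"
    by (rule averages_awayD[OF T(1) \<Psi> e2])
  obtain \<Phi>2 where 2: "averaging \<Phi>2" "op_norm S (\<Phi>2 (\<Phi>1 (\<Psi> U))) < e / 2"
    by (rule averages_awayD[OF U(1) averaging_compose[OF 1(1) \<Psi>] e2])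
  note 12 = averaging_compose[OF 2(1) 1(1)]
  have "op_norm S (\<Phi>2 (\<Phi>1 (\<Psi> (op_add T U)))) = op_norm S (op_add (\<Phi>2 (\<Phi>1 (\<Psi> T))) (\<Phi>2 (\<Phi>1 (\<Psi> U))))"
    by (simp only: averaging_linear(1)[OF \<Psi> T(2) U(2)] averaging_linear(1)[OF 12 TB UB])
  also have "\<dots> \<le> op_norm S (\<Phi>2 (\<Phi>1 (\<Psi> T))) + op_norm S (\<Phi>2 (\<Phi>1 (\<Psi> U)))"
    by (intro op_add_bounded averaging_bounded[OF 12 TB] averaging_bounded[OF 12 UB])
  also have "op_norm S (\<Phi>2 (\<Phi>1 (\<Psi> T))) \<le> op_norm S (\<Phi>1 (\<Psi> T))"
    by (intro averaging_norm[OF 2(1)] averaging_bounded[OF 1(1) TB])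
  finally have "op_norm S (\<Phi>2 (\<Phi>1 (\<Psi> (op_add T U)))) < e" using 1(2) 2(2) by linarith
  then show "\<exists>\<Phi>. averaging \<Phi> \<and> op_norm S (\<Phi> (\<Psi> (op_add T U))) < e"
    by (intro exI[of _ "\<lambda>T. \<Phi>2 (\<Phi>1 T)"] conjI 12)
qed

lemma averages_away_span:
  assumes K: "\<And>z. z \<in> K \<Longrightarrow> z \<in> S \<and> (\<forall>g\<in>S. g \<otimes> z = z \<otimes> g) \<and> \<not> sigma_regular G \<sigma> z"
    and T: "T \<in> op_span (L ` K)"
  shows "averages_away T"
proof -
  have B: "U \<in> bounded_ops S" if "U \<in> op_span (L ` K)" for U
    by (rule op_span_bounded[OF _ that]) (use K in auto)
  show ?thesis using T
  proof (induction rule: op_span.induct)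
    case zero
    show ?case
      unfolding averages_away_def
    proof (intro allI impI)
      fix \<Psi> and e :: real assume "averaging \<Psi>" "e > 0"
      then show "\<exists>\<Phi>. averaging \<Phi> \<and> op_norm S (\<Phi> (\<Psi> op_zero)) < e"
        using averaging_linear(2)[OF _ op_zero_bounded op_zero_bounded, of \<Psi> 0]
        by (intro exI[of _ "\<lambda>T. T"]) (simp add: op_scale_zero avg_id)
    qed
  next
    case (base T)
    then show ?case using K averages_away_central by blast
  qed (auto intro: averages_away_add averages_away_scale B)
qed

end


section \<open>Powers' averaging relative to a central set\<close>

text \<open>Powers' property of the quotient by \<open>Z\<close>, expressed by subsets and elements of the group itself.\<close>

definition relative_powers :: "('a, 'b) monoid_scheme \<Rightarrow> 'a set \<Rightarrow> bool" where
  "relative_powers G Z \<longleftrightarrow> (\<forall>F (N::nat). finite F \<and> F \<subseteq> carrier G - Z \<longrightarrow>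
     (\<exists>C g. C \<subseteq> carrier G \<and> (\<forall>i<N. g i \<in> carrier G) \<and>
        (\<forall>f\<in>F. \<forall>x\<in>C. f \<otimes>\<^bsub>G\<^esub> x \<notin> C) \<and>
        (\<forall>i<N. \<forall>j<N. i \<noteq> j \<longrightarrow> (\<forall>x\<in>carrier G - C. \<forall>y\<in>carrier G - C. g i \<otimes>\<^bsub>G\<^esub> x \<noteq> g j \<otimes>\<^bsub>G\<^esub> y))))"

lemma ell2_norm_disjoint_add:
  assumes f: "f \<in> ell2 S" and g: "g \<in> ell2 S" and disj: "\<And>x. f x = 0 \<or> g x = 0"
  shows "(ell2_norm S (\<lambda>x. f x + g x))\<^sup>2 = (ell2_norm S f)\<^sup>2 + (ell2_norm S g)\<^sup>2"
proof -
  have "(cmod (f x + g x))\<^sup>2 = (cmod (f x))\<^sup>2 + (cmod (g x))\<^sup>2" for x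
    using disj[of x] by auto
  then show ?thesis
    unfolding ell2_norm_square by (simp add: infsum_add[OF ell2_summable[OF f] ell2_summable[OF g]])
qed

lemma ell2_norm_disjoint_sum:
  fixes N :: nat
  assumes b: "\<And>i. i < N \<Longrightarrow> b i \<in> ell2 S" and disj: "\<And>i j. i < N \<Longrightarrow> j < N \<Longrightarrow> i \<noteq> j \<Longrightarrow> Y i \<inter> Y j = {}"
  shows "(ell2_norm S (\<lambda>x. \<Sum>i<N. ell2_restrict (Y i) (b i) x))\<^sup>2 = (\<Sum>i<N. (ell2_norm S (ell2_restrict (Y i) (b i)))\<^sup>2)"
  using assms
proof (induction N)
  case (Suc N)
  have 1: "(\<lambda>x. \<Sum>i<N. ell2_restrict (Y i) (b i) x) \<in> ell2 S"
    by (intro ell2_sum(1) ell2_restrict(1) Suc.prems) auto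
  have 2: "ell2_restrict (Y N) (b N) \<in> ell2 S" by (intro ell2_restrict(1) Suc.prems) simp
  have 3: "(\<Sum>i<N. ell2_restrict (Y i) (b i) x) = 0 \<or> ell2_restrict (Y N) (b N) x = 0" for x
  proof (cases "x \<in> Y N")
    case True
    have "ell2_restrict (Y i) (b i) x = 0" if "i < N" for i
      using True Suc.prems(2)[of i N] that by (auto simp: ell2_restrict_def)
    then show ?thesis by simp
  qed (simp add: ell2_restrict_def)
  have IH: "(ell2_norm S (\<lambda>x. \<Sum>i<N. ell2_restrict (Y i) (b i) x))\<^sup>2 = (\<Sum>i<N. (ell2_norm S (ell2_restrict (Y i) (b i)))\<^sup>2)"
    by (rule Suc.IH) (use Suc.prems in auto)
  show ?case using ell2_norm_disjoint_add[OF 1 2 3] IH by simp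
qed simp

context twisted_group
begin

lemma L_restrict:
  assumes g: "g \<in> S" and D: "D \<subseteq> S" and \<eta>: "\<eta> \<in> ell2 S"
  shows "L g (ell2_restrict D \<eta>) = ell2_restrict ((\<lambda>d. g \<otimes> d) ` D) (L g \<eta>)"
proof
  fix x
  show "L g (ell2_restrict D \<eta>) x = ell2_restrict ((\<lambda>d. g \<otimes> d) ` D) (L g \<eta>) x"
  proof (cases "x \<in> S")
    case True
    have "x \<in> (\<lambda>d. g \<otimes> d) ` D \<longleftrightarrow> inv g \<otimes> x \<in> D"
    proof
      assume "x \<in> (\<lambda>d. g \<otimes> d) ` D"
      then obtain d where "d \<in> D" "x = g \<otimes> d" by blast
      then show "inv g \<otimes> x \<in> D" using g D by (auto simp: m_assoc[symmetric])
    next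
      assume "inv g \<otimes> x \<in> D"
      then show "x \<in> (\<lambda>d. g \<otimes> d) ` D"
        using g True by (intro image_eqI[of _ _ "inv g \<otimes> x"]) (auto simp: m_assoc[symmetric])
    qed
    then show ?thesis
      unfolding L_apply[OF ell2_restrict(1)[OF \<eta>] True]
      by (simp add: L_apply[OF \<eta> True] ell2_restrict_def)
  qed (simp add: L_off ell2_restrict_def)
qed

text \<open>Let \<open>D\<close> be the complement of \<open>C\<close>, and write \<open>P\<^sub>C\<close>, \<open>P\<^sub>D\<close> for the coordinate projections.  By hypothesis
  \<open>P\<^sub>C T P\<^sub>C = 0\<close>, so \<open>T = P\<^sub>D T + P\<^sub>C T P\<^sub>D\<close>.  After conjugation with \<open>g\<^sub>i\<close> the first terms have ranges supported
  in the disjoint sets \<open>g\<^sub>i D\<close>, and the second terms depend only on the restrictions of the vector to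
  these sets.  By orthogonality and the Cauchy-Schwarz inequality each of the two sums has norm at most \<open>\<surd>N \<parallel>T\<parallel>\<close> instead of \<open>N \<parallel>T\<parallel>\<close>.\<close>

lemma powers_estimate:
  assumes T: "T \<in> bounded_ops S" and C: "C \<subseteq> S" and g: "\<And>i. i < N \<Longrightarrow> g i \<in> S"
    and corner: "\<And>\<xi> x. \<xi> \<in> ell2 S \<Longrightarrow> (\<And>y. y \<notin> C \<Longrightarrow> \<xi> y = 0) \<Longrightarrow> x \<in> C \<Longrightarrow> T \<xi> x = 0"
    and disj: "\<And>i j x y. i < N \<Longrightarrow> j < N \<Longrightarrow> i \<noteq> j \<Longrightarrow> x \<in> S - C \<Longrightarrow> y \<in> S - C \<Longrightarrow> g i \<otimes> x \<noteq> g j \<otimes> y"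
  shows "op_norm S (op_sum {..<N} (\<lambda>i. Ad (g i) T)) \<le> 2 * sqrt (real N) * op_norm S T"
proof (rule op_norm_le)
  show "0 \<le> 2 * sqrt (real N) * op_norm S T" using T by simp
  fix \<xi> assume \<xi>: "\<xi> \<in> ell2 S"
  define D where "D = S - C"
  define Y where "Y i = (\<lambda>d. g i \<otimes> d) ` D" for i
  define \<eta> where "\<eta> i = op_adj S (L (g i)) \<xi>" for i
  have DS: "D \<subseteq> S" by (auto simp: D_def)
  have Yd: "Y i \<inter> Y j = {}" if "i < N" "j < N" "i \<noteq> j" for i j
    using disj[OF that] by (auto simp: Y_def D_def)
  have \<eta>: "\<eta> i \<in> ell2 S" and L\<eta>: "L (g i) (\<eta> i) = \<xi>" if "i < N" for i
  proof -
    show "\<eta> i \<in> ell2 S" using L_adj_bounded[OF g[OF that]] by (simp add: \<eta>_def)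
    show "L (g i) (\<eta> i) = \<xi>" using fun_cong[OF L_unitary(2)[OF g[OF that]], of \<xi>] \<xi> by (simp add: \<eta>_def)
  qed
  define a where "a i = ell2_restrict (Y i) (Ad (g i) T \<xi>)" for i
  \<comment> \<open>Since \<open>T\<close> maps vectors supported in \<open>C\<close> off \<open>C\<close>, \<open>b i\<close> sees only the part of \<open>\<xi>\<close> on \<open>Y i\<close>.\<close>
  define b where "b i = L (g i) (ell2_restrict C (T (\<eta> i)))" for i
  have AdE: "Ad (g i) T \<xi> = L (g i) (T (\<eta> i))" for i by (simp add: Ad_def \<eta>_def)
  have split: "Ad (g i) T \<xi> x = a i x + b i x" if i: "i < N" for i x
  proof -
    have TE: "T (\<eta> i) \<in> ell2 S" using T by simp
    have "T (\<eta> i) = (\<lambda>x. ell2_restrict D (T (\<eta> i)) x + ell2_restrict C (T (\<eta> i)) x)"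
      using ell2_off[OF TE] by (auto simp: ell2_restrict_def D_def)
    then have "Ad (g i) T \<xi> = (\<lambda>x. L (g i) (ell2_restrict D (T (\<eta> i))) x + b i x)"
      unfolding AdE b_def using bounded_opsD(3)[OF L_bounded[OF g[OF i]] ell2_restrict(1)[OF TE] ell2_restrict(1)[OF TE], of D C] by simp
    from fun_cong[OF this, of x] show ?thesis
      unfolding a_def AdE Y_def L_restrict[OF g[OF i] DS TE] .
  qed
  have AdB: "Ad (g i) T \<in> bounded_ops S" if "i < N" for i by (intro Ad_bounded g that T)
  have aE: "a i \<in> ell2 S" if "i < N" for i
    unfolding a_def by (intro ell2_restrict(1) bounded_ops_ell2 AdB that)
  have bE: "b i \<in> ell2 S" if "i < N" for i
    unfolding b_def by (intro bounded_ops_ell2 L_bounded g that)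
  have na: "ell2_norm S (a i) \<le> op_norm S T * ell2_norm S \<xi>" if i: "i < N" for i
  proof -
    have "ell2_norm S (a i) \<le> ell2_norm S (Ad (g i) T \<xi>)"
      unfolding a_def by (intro ell2_restrict(2) bounded_ops_ell2 AdB i)
    also have "\<dots> \<le> op_norm S (Ad (g i) T) * ell2_norm S \<xi>" by (rule op_norm_ge[OF AdB[OF i] \<xi>])
    also have "\<dots> \<le> op_norm S T * ell2_norm S \<xi>" by (intro mult_right_mono Ad_norm g i T) simp
    finally show ?thesis .
  qed
  have nb: "ell2_norm S (b i) \<le> op_norm S T * ell2_norm S (ell2_restrict (Y i) \<xi>)" if i: "i < N" for i
  proof -
    let ?c = "ell2_restrict C (\<eta> i)" and ?d = "ell2_restrict D (\<eta> i)"
    have cd: "?c \<in> ell2 S" "?d \<in> ell2 S" by (intro ell2_restrict(1) \<eta> i)+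
    have "\<eta> i = (\<lambda>x. ?c x + ?d x)"
      using ell2_off[OF \<eta>[OF i]] by (auto simp: ell2_restrict_def D_def)
    then have "T (\<eta> i) = (\<lambda>x. T ?c x + T ?d x)" using bounded_opsD(3)[OF T cd] by simp
    moreover have "T ?c x = 0" if "x \<in> C" for x
      by (rule corner[OF cd(1) _ that]) (simp add: ell2_restrict_def)
    ultimately have eq: "ell2_restrict C (T (\<eta> i)) = ell2_restrict C (T ?d)"
      by (auto simp: ell2_restrict_def)
    have "ell2_norm S (b i) = ell2_norm S (ell2_restrict C (T ?d))"
      unfolding b_def eq by (intro L_ell2(2) g i ell2_restrict(1) bounded_ops_ell2 T)
    also have "\<dots> \<le> ell2_norm S (T ?d)" by (intro ell2_restrict(2) bounded_ops_ell2 T)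
    also have "\<dots> \<le> op_norm S T * ell2_norm S ?d" by (rule op_norm_ge[OF T cd(2)])
    also have "ell2_norm S ?d = ell2_norm S (L (g i) ?d)" using L_ell2(2)[OF g[OF i] cd(2)] by simp
    also have "L (g i) ?d = ell2_restrict (Y i) \<xi>" unfolding L_restrict[OF g[OF i] DS \<eta>[OF i]] L\<eta>[OF i] Y_def by (rule refl)
    finally show ?thesis .
  qed
  have "(ell2_norm S (\<lambda>x. \<Sum>i<N. a i x))\<^sup>2 = (\<Sum>i<N. (ell2_norm S (a i))\<^sup>2)"
    unfolding a_def by (rule ell2_norm_disjoint_sum[OF _ Yd]) (intro bounded_ops_ell2 AdB)
  also have "\<dots> \<le> (\<Sum>i<N. (op_norm S T * ell2_norm S \<xi>)\<^sup>2)"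
    by (intro sum_mono power_mono na) auto
  also have "\<dots> = (sqrt (real N) * (op_norm S T * ell2_norm S \<xi>))\<^sup>2" by (simp add: power_mult_distrib)
  finally have A1: "ell2_norm S (\<lambda>x. \<Sum>i<N. a i x) \<le> sqrt (real N) * (op_norm S T * ell2_norm S \<xi>)"
    by (rule power2_le_imp_le) (use T in simp)
  have "(\<Sum>i<N. (ell2_norm S (ell2_restrict (Y i) \<xi>))\<^sup>2) = (ell2_norm S (\<lambda>x. \<Sum>i<N. ell2_restrict (Y i) \<xi> x))\<^sup>2"
    by (rule ell2_norm_disjoint_sum[OF \<xi> Yd, symmetric])
  also have "(\<lambda>x. \<Sum>i<N. ell2_restrict (Y i) \<xi> x) = ell2_restrict (\<Union>i<N. Y i) \<xi>"
  proof
    fix x show "(\<Sum>i<N. ell2_restrict (Y i) \<xi> x) = ell2_restrict (\<Union>i<N. Y i) \<xi> x"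
    proof (cases "\<exists>i<N. x \<in> Y i")
      case True
      then obtain i where i: "i < N" "x \<in> Y i" by blast
      have "(\<Sum>j<N. ell2_restrict (Y j) \<xi> x) = (\<Sum>j<N. if j = i then \<xi> x else 0)"
        by (rule sum.cong) (use i Yd[of i] in \<open>auto simp: ell2_restrict_def\<close>)
      then show ?thesis using i by (auto simp: ell2_restrict_def)
    qed (auto simp: ell2_restrict_def intro!: sum.neutral)
  qed
  also have "(ell2_norm S (ell2_restrict (\<Union>i<N. Y i) \<xi>))\<^sup>2 \<le> (ell2_norm S \<xi>)\<^sup>2"
    by (intro power_mono ell2_restrict(2) \<xi>) simp
  finally have sq: "(\<Sum>i<N. (ell2_norm S (ell2_restrict (Y i) \<xi>))\<^sup>2) \<le> (ell2_norm S \<xi>)\<^sup>2" .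
  have "(\<Sum>i<N. ell2_norm S (ell2_restrict (Y i) \<xi>)) =
      (\<Sum>i<N. \<bar>ell2_norm S (ell2_restrict (Y i) \<xi>)\<bar> * \<bar>1\<bar>)" by simp
  also have "\<dots> \<le> L2_set (\<lambda>i. ell2_norm S (ell2_restrict (Y i) \<xi>)) {..<N} * L2_set (\<lambda>_. 1) {..<N}"
    by (rule L2_set_mult_ineq)
  also have "\<dots> \<le> ell2_norm S \<xi> * sqrt (real N)"
  proof (rule mult_mono)
    show "L2_set (\<lambda>i. ell2_norm S (ell2_restrict (Y i) \<xi>)) {..<N} \<le> ell2_norm S \<xi>"
      unfolding L2_set_def by (rule real_le_lsqrt) (use sq in \<open>auto simp: sum_nonneg\<close>)
  qed (auto simp: L2_set_def)
  finally have cs: "(\<Sum>i<N. ell2_norm S (ell2_restrict (Y i) \<xi>)) \<le> sqrt (real N) * ell2_norm S \<xi>"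
    by (simp only: mult.commute)
  have "ell2_norm S (\<lambda>x. \<Sum>i<N. b i x) \<le> (\<Sum>i<N. ell2_norm S (b i))"
    by (rule ell2_sum(2)) (simp add: bE)
  also have "\<dots> \<le> (\<Sum>i<N. op_norm S T * ell2_norm S (ell2_restrict (Y i) \<xi>))"
    by (intro sum_mono nb) simp
  also have "\<dots> = op_norm S T * (\<Sum>i<N. ell2_norm S (ell2_restrict (Y i) \<xi>))" by (simp only: sum_distrib_left)
  also have "\<dots> \<le> op_norm S T * (sqrt (real N) * ell2_norm S \<xi>)" by (intro mult_left_mono cs op_norm_nonneg T)
  finally have B1: "ell2_norm S (\<lambda>x. \<Sum>i<N. b i x) \<le> op_norm S T * (sqrt (real N) * ell2_norm S \<xi>)" .
  have "op_sum {..<N} (\<lambda>i. Ad (g i) T) \<xi> = (\<lambda>x. (\<Sum>i<N. a i x) + (\<Sum>i<N. b i x))"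
    unfolding op_sum_def using split by (simp add: sum.distrib)
  then have "ell2_norm S (op_sum {..<N} (\<lambda>i. Ad (g i) T) \<xi>) \<le>
      ell2_norm S (\<lambda>x. \<Sum>i<N. a i x) + ell2_norm S (\<lambda>x. \<Sum>i<N. b i x)"
    using ell2_add(2)[OF ell2_sum(1)[of "{..<N}" a S] ell2_sum(1)[of "{..<N}" b S]] aE bE by simp
  with A1 B1 show "ell2_norm S (op_sum {..<N} (\<lambda>i. Ad (g i) T) \<xi>) \<le> 2 * sqrt (real N) * op_norm S T * ell2_norm S \<xi>"
    by (simp add: mult_ac)
qed

text \<open>This feeds \<open>powers_estimate\<close>: elements that move \<open>C\<close> off itself have vanishing compression to \<open>C\<close>.\<close>

lemma op_span_corner:
  assumes F: "F \<subseteq> S" and C: "C \<subseteq> S" "\<And>f x. f \<in> F \<Longrightarrow> x \<in> C \<Longrightarrow> f \<otimes> x \<notin> C"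
    and T: "T \<in> op_span (L ` F)" and \<xi>: "\<xi> \<in> ell2 S" "\<And>y. y \<notin> C \<Longrightarrow> \<xi> y = 0" and x: "x \<in> C"
  shows "T \<xi> x = 0"
  using T
proof (induction rule: op_span.induct)
  case (base T)
  then obtain f where f: "f \<in> F" "T = L f" by blast
  have S: "f \<in> S" "x \<in> S" using f F C x by auto
  have "f \<otimes> (inv f \<otimes> x) = x" using S by (simp add: m_assoc[symmetric])
  then have "inv f \<otimes> x \<notin> C" using C(2)[OF f(1)] x by metis
  then show ?case using S by (simp add: f L_apply[OF \<xi>(1)] \<xi>(2))
qed (simp_all add: op_zero_def op_add_def op_scale_def)

lemma powers_averaging_small:
  assumes P: "relative_powers G Z" and F: "finite F" "F \<subseteq> S - Z" and T: "T \<in> op_span (L ` F)" and e: "e > 0"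
  shows "\<exists>\<Phi>. averaging \<Phi> \<and> op_norm S (\<Phi> T) < e"
proof -
  have TB: "T \<in> bounded_ops S" by (rule op_span_bounded[OF _ T]) (use F in auto)
  let ?t = "2 * op_norm S T / e"
  \<comment> \<open>Large enough for \<open>2 * op_norm S T / sqrt N0\<close> to be below \<open>e\<close>.\<close>
  obtain N0 :: nat where N0: "?t\<^sup>2 < real N0" using reals_Archimedean2 by blast
  have t0: "0 \<le> ?t" using TB e by simp
  have N: "N0 > 0" using N0 by (metis le_less_trans of_nat_0_less_iff zero_le_power2)
  have rt: "?t < sqrt (real N0)" using N0 t0 real_less_rsqrt by blast
  obtain C g where C: "C \<subseteq> S" and g: "\<forall>i<N0. g i \<in> S" and FC: "\<forall>f\<in>F. \<forall>x\<in>C. f \<otimes> x \<notin> C"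
    and d: "\<forall>i<N0. \<forall>j<N0. i \<noteq> j \<longrightarrow> (\<forall>x\<in>S - C. \<forall>y\<in>S - C. g i \<otimes> x \<noteq> g j \<otimes> y)"
    using P[unfolded relative_powers_def, rule_format, of F N0] F by blast
  have FS: "F \<subseteq> S" using F by blast
  have est: "op_norm S (op_sum {..<N0} (\<lambda>i. Ad (g i) T)) \<le> 2 * sqrt (real N0) * op_norm S T"
  proof (rule powers_estimate[OF TB C])
    fix i assume "i < N0" then show "g i \<in> S" using g by blast
  next
    fix \<xi> x assume \<xi>: "\<xi> \<in> ell2 S" "\<And>y. y \<notin> C \<Longrightarrow> \<xi> y = 0" "x \<in> C"
    show "T \<xi> x = 0" by (rule op_span_corner[OF FS C _ T \<xi>]) (use FC in blast)
  next
    fix i j x y assume "i < N0" "j < N0" "i \<noteq> j" "x \<in> S - C" "y \<in> S - C"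
    then show "g i \<otimes> x \<noteq> g j \<otimes> y" using d by blast
  qed
  have sB: "op_sum {..<N0} (\<lambda>i. Ad (g i) T) \<in> bounded_ops S"
    by (rule op_sum_subspace[OF bounded_ops_subspace]) (use g TB in \<open>blast intro: Ad_bounded\<close>)
  have "op_norm S (conj_mean N0 g T) \<le> cmod (1 / of_nat N0) * op_norm S (op_sum {..<N0} (\<lambda>i. Ad (g i) T))"
    unfolding conj_mean_def by (rule op_scale_bounded(2)[OF sB])
  also have "\<dots> \<le> cmod (1 / of_nat N0) * (2 * sqrt (real N0) * op_norm S T)"
    by (intro mult_left_mono est) simp
  also have "\<dots> = 2 * op_norm S T / sqrt (real N0)"
  proof -
    define r where "r = sqrt (real N0)"
    have r: "r > 0" "real N0 = r * r" using N by (simp_all add: r_def)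
    have "cmod (1 / of_nat N0) = 1 / (r * r)" by (simp add: norm_divide flip: r(2))
    then show ?thesis unfolding r_def[symmetric] using r(1) by (simp add: field_simps)
  qed
  also have "\<dots> < e"
  proof -
    have "2 * op_norm S T < sqrt (real N0) * e" using rt e by (simp only: pos_divide_less_eq)
    then show ?thesis using N by (simp only: pos_divide_less_eq real_sqrt_gt_0_iff of_nat_0_less_iff mult.commute)
  qed
  finally have "op_norm S (conj_mean N0 g T) < e" .
  moreover have "averaging (\<lambda>T. conj_mean N0 g T)"
    by (rule avg_mean[OF avg_id N]) (use g in blast)
  ultimately show ?thesis by (intro exI[of _ "\<lambda>T. conj_mean N0 g T"] conjI)
qed

lemma op_span_split:
  assumes T: "T \<in> op_span (L ` S)"
  shows "\<exists>c T1 T2 F. T1 \<in> op_span (L ` (S \<inter> Z - {\<one>})) \<and> finite F \<and> F \<subseteq> S - Z \<and> T2 \<in> op_span (L ` F) \<and>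
    T = op_add (op_scale c (op_id S)) (op_add T1 T2)"
  using T
proof (induction rule: op_span.induct)
  case zero
  have "op_zero = op_add (op_scale 0 (op_id S)) (op_add op_zero op_zero)"
    by (simp add: op_zero_def op_add_def op_scale_def)
  then show ?case using op_span.zero by blast
next
  case (base T)
  then obtain g where g: "g \<in> S" "T = L g" by blast
  consider "g = \<one>" | "g \<in> S \<inter> Z - {\<one>}" | "g \<in> S - Z" using g by blast
  then show ?case
  proof cases
    case 1
    then have "T = op_add (op_scale 1 (op_id S)) (op_add op_zero op_zero)"
      by (simp add: g L_one op_zero_def op_add_def)
    then show ?thesis using op_span.zero by blast
  next
    case 2
    then have "T = op_add (op_scale 0 (op_id S)) (op_add T op_zero)"
      by (simp add: op_zero_def op_add_def op_scale_def)
    moreover have "T \<in> op_span (L ` (S \<inter> Z - {\<one>}))" unfolding g by (intro op_span.base imageI 2)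
    ultimately show ?thesis using op_span.zero by blast
  next
    case 3
    then have "T = op_add (op_scale 0 (op_id S)) (op_add op_zero T)"
      by (simp add: op_zero_def op_add_def op_scale_def)
    moreover have "T \<in> op_span (L ` {g})" unfolding g by (intro op_span.base imageI) simp
    ultimately show ?thesis using op_span.zero 3 by blast
  qed
next
  case (add T U)
  obtain c T1 T2 F where T: "T1 \<in> op_span (L ` (S \<inter> Z - {\<one>}))" "finite F" "F \<subseteq> S - Z" "T2 \<in> op_span (L ` F)"
    "T = op_add (op_scale c (op_id S)) (op_add T1 T2)" using add(3) by blast
  obtain d U1 U2 H where U: "U1 \<in> op_span (L ` (S \<inter> Z - {\<one>}))" "finite H" "H \<subseteq> S - Z" "U2 \<in> op_span (L ` H)"
    "U = op_add (op_scale d (op_id S)) (op_add U1 U2)" using add(4) by blast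
  have "op_add T U = op_add (op_scale (c + d) (op_id S)) (op_add (op_add T1 U1) (op_add T2 U2))"
    unfolding T(5) U(5) by (simp add: op_add_def op_scale_def fun_eq_iff algebra_simps)
  moreover have "op_add T1 U1 \<in> op_span (L ` (S \<inter> Z - {\<one>}))" by (intro op_span.add T U)
  moreover have "op_add T2 U2 \<in> op_span (L ` (F \<union> H))"
    by (rule op_span.add; rule op_span_mono[rotated], rule T U) auto
  moreover have "finite (F \<union> H)" "F \<union> H \<subseteq> S - Z" using T U by auto
  ultimately show ?case by blast
next
  case (scale T c)
  obtain d T1 T2 F where T: "T1 \<in> op_span (L ` (S \<inter> Z - {\<one>}))" "finite F" "F \<subseteq> S - Z" "T2 \<in> op_span (L ` F)"
    "T = op_add (op_scale d (op_id S)) (op_add T1 T2)" using scale(2) by blast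
  have "op_scale c T = op_add (op_scale (c * d) (op_id S)) (op_add (op_scale c T1) (op_scale c T2))"
    unfolding T(5) by (simp add: op_add_def op_scale_def fun_eq_iff algebra_simps)
  then show ?case
    by (intro exI[of _ "c * d"] exI[of _ "op_scale c T1"] exI[of _ "op_scale c T2"] exI[of _ F] conjI
        op_span.scale T)
qed

text \<open>Approximate by a finite combination and split it by support.  Powers' averaging comes first: it only
  multiplies the unitaries of central elements by scalars, so the second averaging can still remove
  them, and it does not increase what the first one has made small.\<close>

theorem dixmier_averaging:
  assumes P: "relative_powers G Z"
    and Z: "\<And>z g. z \<in> Z \<Longrightarrow> g \<in> S \<Longrightarrow> g \<otimes> z = z \<otimes> g"
    and nreg: "\<And>z. z \<in> S \<Longrightarrow> z \<in> Z \<Longrightarrow> z \<noteq> \<one> \<Longrightarrow> \<not> sigma_regular G \<sigma> z"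
    and T: "T \<in> A" and e: "e > 0"
  shows "\<exists>\<Phi> c. averaging \<Phi> \<and> op_norm S (op_diff (\<Phi> T) (op_scale c (op_id S))) < e"
proof -
  obtain U where U: "U \<in> op_span (L ` S)" "op_norm S (op_diff T U) < e/3" using A_approx[OF T, of "e/3"] e by auto
  obtain c U1 U2 F where s: "U1 \<in> op_span (L ` (S \<inter> Z - {\<one>}))" "finite F" "F \<subseteq> S - Z" "U2 \<in> op_span (L ` F)"
    "U = op_add (op_scale c (op_id S)) (op_add U1 U2)" using op_span_split[OF U(1), of Z] by blast
  obtain \<Phi>1 where 1: "averaging \<Phi>1" "op_norm S (\<Phi>1 U2) < e/3"
    using powers_averaging_small[OF P s(2,3,4), of "e/3"] e by auto
  obtain \<Phi>2 where 2: "averaging \<Phi>2" "op_norm S (\<Phi>2 (\<Phi>1 U1)) < e/3"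
  proof (rule averages_awayD)
    show "averages_away U1" by (rule averages_away_span[OF _ s(1)]) (use Z nreg in auto)
    show "averaging \<Phi>1" "e/3 > 0" using 1 e by auto
  qed
  define \<Phi> where "\<Phi> T = \<Phi>2 (\<Phi>1 T)" for T
  have avg: "averaging \<Phi>" unfolding \<Phi>_def by (rule averaging_compose[OF 2(1) 1(1)])
  have U1B: "U1 \<in> bounded_ops S" and U2B: "U2 \<in> bounded_ops S"
    by (rule op_span_bounded[OF _ s(1)], use L_bounded in blast, rule op_span_bounded[OF _ s(4)], use s(3) in auto)
  note TB = AB[OF T] and UB = op_span_L_bounded[OF U(1)]
  note idB = op_scale_bounded(1)[OF op_id_bounded]
  note bb = averaging_bounded[OF avg]
  have PU: "\<Phi> U = op_add (op_scale c (op_id S)) (op_add (\<Phi> U1) (\<Phi> U2))"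
    unfolding s(5) by (simp only: averaging_linear(1)[OF avg idB op_add_bounded(1)[OF U1B U2B]]
        averaging_linear(1)[OF avg U1B U2B] averaging_linear(2)[OF avg op_id_bounded op_id_bounded] averaging_one[OF avg])
  have eq: "op_diff (\<Phi> T) (op_scale c (op_id S)) = op_add (\<Phi> (op_diff T U)) (op_add (\<Phi> U1) (\<Phi> U2))"
    unfolding averaging_diff[OF avg TB UB] PU by (simp add: op_diff_def op_add_def fun_eq_iff)
  have "op_norm S (op_diff (\<Phi> T) (op_scale c (op_id S))) \<le>
      op_norm S (\<Phi> (op_diff T U)) + op_norm S (op_add (\<Phi> U1) (\<Phi> U2))"
    unfolding eq by (intro op_add_bounded bb op_diff_bounded TB UB U1B U2B)
  also have "op_norm S (\<Phi> (op_diff T U)) \<le> op_norm S (op_diff T U)"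
    by (intro averaging_norm[OF avg] op_diff_bounded TB UB)
  also have "op_norm S (op_add (\<Phi> U1) (\<Phi> U2)) \<le> op_norm S (\<Phi> U1) + op_norm S (\<Phi> U2)"
    by (intro op_add_bounded bb U1B U2B)
  also have "op_norm S (\<Phi> U2) \<le> op_norm S (\<Phi>1 U2)"
    unfolding \<Phi>_def by (intro averaging_norm[OF 2(1)] averaging_bounded[OF 1(1)] U2B)
  finally have "op_norm S (op_diff (\<Phi> T) (op_scale c (op_id S))) < e"
    using 1(2) 2(2) U(2) unfolding \<Phi>_def by linarith
  then show ?thesis by (intro exI[of _ \<Phi>] exI[of _ c] conjI avg)
qed

lemma dixmier_trace_eq:
  assumes avg: "averaging \<Phi>" and T: "T \<in> A" and close: "op_norm S (op_diff (\<Phi> T) (op_scale c (op_id S))) < e"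
    and \<phi>: "tracial_state S A \<phi>"
  shows "cmod (\<phi> T - c) \<le> 8 * e"
proof -
  have PT: "\<Phi> T \<in> A" by (rule averaging_in_A[OF avg T])
  have cA: "op_scale d (op_id S) \<in> A" for d by (intro AD(4) id_in_A)
  have add: "\<phi> (op_add T U) = \<phi> T + \<phi> U" and scale: "\<phi> (op_scale d T) = d * \<phi> T" and one: "\<phi> (op_id S) = 1"
    if "T \<in> A" "U \<in> A" for T U d
    using \<phi> that by (simp_all only: tracial_state_def)
  have "\<phi> (op_diff (\<Phi> T) (op_scale c (op_id S))) = \<phi> (\<Phi> T) - c"
    unfolding op_diff_eq op_scale_scale add[OF PT cA] scale[OF id_in_A id_in_A] one[OF id_in_A id_in_A] by simp
  then have "cmod (\<phi> T - c) = cmod (\<phi> (op_diff (\<Phi> T) (op_scale c (op_id S))))"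
    by (simp only: tracial_state_averaging[OF \<phi> avg T])
  also have "\<dots> \<le> 8 * op_norm S (op_diff (\<Phi> T) (op_scale c (op_id S)))"
    by (intro tracial_state_bounded[OF cstar_subalgebra_A id_in_A \<phi>] AD(5) PT cA)
  finally show ?thesis using close by linarith
qed

end


section \<open>Kleppner's condition, simplicity and unique trace\<close>

locale relative_powers_group = twisted_group G \<sigma> for G (structure) and \<sigma> +
  fixes Z :: "'a set"
  assumes Z_subset: "Z \<subseteq> S"
    and Z_central: "z \<in> Z \<Longrightarrow> g \<in> S \<Longrightarrow> g \<otimes> z = z \<otimes> g"
    and Z_torsion_free: "z \<in> Z \<Longrightarrow> z \<noteq> \<one> \<Longrightarrow> 0 < k \<Longrightarrow> z [^] (k::nat) \<noteq> \<one>"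
    and powers: "relative_powers G Z"
begin

lemma conj_class_central: "z \<in> Z \<Longrightarrow> conj_class G z = {z}"
proof -
  assume z: "z \<in> Z"
  have "h \<otimes> z \<otimes> inv h = z" if "h \<in> S" for h
    using Z_central[OF z that] Z_subset z that by (auto simp: m_assoc)
  then show ?thesis unfolding conj_class_def using one_closed by (auto simp: image_iff)
qed

text \<open>Suppose that the class \<open>F\<close> is finite, and apply Powers' property to \<open>F\<close> with three translations
  \<open>k\<^sub>0\<close>, \<open>k\<^sub>1\<close>, \<open>k\<^sub>2\<close>.  Every point lies outside \<open>k\<^sub>i C\<close> for at most one \<open>i\<close>, so \<open>1\<close> lies in two of these sets.
  But conjugates of \<open>g\<close> move \<open>C\<close> off itself, so \<open>g\<close> moves \<open>1\<close> out of both of them.\<close>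

lemma conj_class_infinite:
  assumes g: "g \<in> S" "g \<notin> Z"
  shows "infinite (conj_class G g)"
proof
  assume fin: "finite (conj_class G g)"
  have sub: "conj_class G g \<subseteq> S - Z"
  proof
    fix x assume "x \<in> conj_class G g"
    then obtain h where h: "h \<in> S" "x = h \<otimes> g \<otimes> inv h" by (auto simp: conj_class_def)
    have "x \<notin> Z"
    proof
      assume x: "x \<in> Z"
      have "inv h \<otimes> x = x \<otimes> inv h" using Z_central[OF x] h by simp
      moreover have "inv h \<otimes> x = g \<otimes> inv h" using h g by (simp add: m_assoc[symmetric])
      ultimately have "x \<otimes> inv h = g \<otimes> inv h" by simp
      then have "x = g" using right_cancel[of "inv h" x g] x Z_subset h(1) g(1) by auto
      then show False using x g by simp
    qed
    then show "x \<in> S - Z" using h g by simp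
  qed
  obtain C k where C: "C \<subseteq> S" and "\<forall>i<(3::nat). k i \<in> S" and "\<forall>f\<in>conj_class G g. \<forall>x\<in>C. f \<otimes> x \<notin> C"
    and "\<forall>i<3. \<forall>j<3. i \<noteq> j \<longrightarrow> (\<forall>x\<in>S - C. \<forall>y\<in>S - C. k i \<otimes> x \<noteq> k j \<otimes> y)"
    using powers[unfolded relative_powers_def, THEN spec, THEN spec, THEN mp, OF conjI[OF fin sub], of 3] by blast
  then have k: "\<And>i. i < (3::nat) \<Longrightarrow> k i \<in> S"
    and move: "\<And>f x. f \<in> conj_class G g \<Longrightarrow> x \<in> C \<Longrightarrow> f \<otimes> x \<notin> C"
    and disj: "\<And>i j x y. i < 3 \<Longrightarrow> j < 3 \<Longrightarrow> i \<noteq> j \<Longrightarrow> x \<in> S - C \<Longrightarrow> y \<in> S - C \<Longrightarrow> k i \<otimes> x \<noteq> k j \<otimes> y"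
    by blast+
  have cancel: "k i \<otimes> (inv (k i) \<otimes> x) = x" if "i < 3" "x \<in> S" for i x
    using k[OF that(1)] that(2) by (simp add: m_assoc[symmetric])
  have in_one: "i = j" if "i < 3" "j < 3" "x \<in> S" "inv (k i) \<otimes> x \<notin> C" "inv (k j) \<otimes> x \<notin> C" for i j x
    using disj[of i j "inv (k i) \<otimes> x" "inv (k j) \<otimes> x"] that cancel k by auto
  have flip: "inv (k i) \<otimes> g \<notin> C" if i: "i < 3" and c: "inv (k i) \<in> C" for i
  proof -
    have "inv (k i) \<otimes> g \<otimes> inv (inv (k i)) \<in> conj_class G g"
      unfolding conj_class_def using k[OF i] by blast
    from move[OF this c] show ?thesis using k[OF i] g by (simp add: m_assoc)
  qed
  have "\<exists>i<3. \<exists>j<3. i \<noteq> j \<and> inv (k i) \<in> C \<and> inv (k j) \<in> C"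
  proof -
    have one: "inv (k i) \<otimes> \<one> = inv (k i)" if "i < 3" for i using k[OF that] by simp
    have "inv (k i) \<in> C \<or> inv (k j) \<in> C" if "i < 3" "j < 3" "i \<noteq> j" for i j
      using in_one[OF that(1,2) one_closed] one that by auto
    from this[of 0 1] this[of 0 2] this[of 1 2]
    consider "inv (k 0) \<in> C" "inv (k 1) \<in> C" | "inv (k 0) \<in> C" "inv (k 2) \<in> C" | "inv (k 1) \<in> C" "inv (k 2) \<in> C"
      by auto
    then show ?thesis
    proof cases
      case 1 show ?thesis by (rule exI[of _ 0], rule conjI, simp, rule exI[of _ 1], use 1 in simp)
    next
      case 2 show ?thesis by (rule exI[of _ 0], rule conjI, simp, rule exI[of _ 2], use 2 in simp)
    next
      case 3 show ?thesis by (rule exI[of _ 1], rule conjI, simp, rule exI[of _ 2], use 3 in simp)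
    qed
  qed
  then obtain i j where "i < 3" "j < 3" "i \<noteq> j" "inv (k i) \<in> C" "inv (k j) \<in> C" by blast
  with flip in_one[of i j g] g(1) show False by blast
qed

lemma kleppner_iff:
  "kleppner_condition G \<sigma> \<longleftrightarrow> (\<forall>z\<in>Z. z \<noteq> \<one> \<longrightarrow> \<not> sigma_regular G \<sigma> z)"
proof
  assume K: "kleppner_condition G \<sigma>"
  show "\<forall>z\<in>Z. z \<noteq> \<one> \<longrightarrow> \<not> sigma_regular G \<sigma> z"
  proof (intro ballI impI notI)
    fix z assume "z \<in> Z" "z \<noteq> \<one>" "sigma_regular G \<sigma> z"
    then have "infinite (conj_class G z)" using K Z_subset unfolding kleppner_condition_def by blast
    then show False by (simp add: conj_class_central[OF \<open>z \<in> Z\<close>])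
  qed
next
  assume "\<forall>z\<in>Z. z \<noteq> \<one> \<longrightarrow> \<not> sigma_regular G \<sigma> z"
  then show "kleppner_condition G \<sigma>"
    unfolding kleppner_condition_def using conj_class_infinite by blast
qed

lemma averaging_to_scalar:
  assumes K: "kleppner_condition G \<sigma>" and T: "T \<in> A" and e: "e > 0"
  obtains \<Phi> c where "averaging \<Phi>" "op_norm S (op_diff (\<Phi> T) (op_scale c (op_id S))) < e"
  using dixmier_averaging[OF powers Z_central _ T e] K[unfolded kleppner_iff] by blast

text \<open>The ideal contains \<open>X = T\<^sup>*T\<close> and all means of \<open>X\<close>.  These come close to \<open>\<tau>(X) \<noteq> 0\<close>, so the identity
  is a limit of elements of the ideal.\<close>

theorem kleppner_imp_simple:
  assumes K: "kleppner_condition G \<sigma>"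
  shows "twisted_cstar_simple G \<sigma>"
  unfolding twisted_cstar_simple_def cstar_simple_algebra_def
proof (intro allI impI)
  fix J assume J: "closed_two_sided_ideal S A J"
  have JA: "J \<subseteq> A" and Jsub: "op_subspace J" and Jmult: "\<And>T U. T \<in> A \<Longrightarrow> U \<in> J \<Longrightarrow> T \<circ> U \<in> J \<and> U \<circ> T \<in> J"
    and Jcl: "\<And>T. T \<in> bounded_ops S \<Longrightarrow> (\<And>e. e > 0 \<Longrightarrow> \<exists>U\<in>J. op_norm S (op_diff T U) < e) \<Longrightarrow> T \<in> J"
    using J unfolding closed_two_sided_ideal_def op_norm_closed_def by blast+
  have J0: "op_zero \<in> J" using Jsub by (simp add: op_subspace_def)
  show "J = {op_zero} \<or> J = A"
  proof (cases "J = {op_zero}")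
    case False
    then obtain T where T: "T \<in> J" "T \<noteq> op_zero" using J0 by blast
    have TA: "T \<in> A" using T JA by blast
    define X where "X = op_adj S T \<circ> T"
    have XJ: "X \<in> J" unfolding X_def using Jmult[OF AD(7)[OF TA] T(1)] by blast
    have XA: "X \<in> A" using XJ JA by blast
    define t where "t = \<tau> X"
    have t: "t \<noteq> 0" using trace_faithful[OF TA] T(2) by (auto simp: t_def X_def)
    have AdJ: "Ad g U \<in> J" if g: "g \<in> S" and U: "U \<in> J" for g U
    proof -
      have "L g \<circ> U \<in> J" using Jmult[OF L_in_A[OF g] U] by simp
      from Jmult[OF AD(7)[OF L_in_A[OF g]] this] show ?thesis unfolding Ad_def by simp
    qed
    have "op_id S \<in> J"
    proof (rule Jcl[OF op_id_bounded])
      fix e :: real assume e: "e > 0"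
      \<comment> \<open>The mean of \<open>X\<close> will be within \<open>?d + 8 * ?d\<close> of \<open>t\<close>, and \<open>9 / 10 < 1\<close>.\<close>
      let ?d = "e * cmod t / 10"
      have d: "?d > 0" using e t by simp
      obtain \<Phi> c where \<Phi>: "averaging \<Phi>" "op_norm S (op_diff (\<Phi> X) (op_scale c (op_id S))) < ?d"
        by (rule averaging_to_scalar[OF K XA d])
      have tc: "cmod (t - c) \<le> 8 * ?d"
        using dixmier_trace_eq[where \<Phi>=\<Phi> and T=X, OF \<Phi>(1) XA \<Phi>(2) tracial_state_canonical] XA by (simp add: t_def)
      have PJ: "\<Phi> X \<in> J" by (rule averaging_subspace[OF \<Phi>(1) Jsub AdJ XJ])
      have PB: "\<Phi> X \<in> bounded_ops S" using AB PJ JA by blast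
      note cB = op_scale_bounded(1)[OF op_id_bounded]
      have eq: "op_diff (op_id S) (op_scale (1/t) (\<Phi> X)) =
          op_scale (-1/t) (op_add (op_diff (\<Phi> X) (op_scale c (op_id S))) (op_scale (c - t) (op_id S)))"
        using t by (simp add: op_diff_def op_add_def op_scale_def fun_eq_iff field_simps)
      have "op_norm S (op_diff (op_id S) (op_scale (1/t) (\<Phi> X))) \<le>
          cmod (-1/t) * op_norm S (op_add (op_diff (\<Phi> X) (op_scale c (op_id S))) (op_scale (c - t) (op_id S)))"
        unfolding eq by (intro op_scale_bounded(2) op_add_bounded op_diff_bounded PB cB)
      also have "\<dots> \<le> cmod (-1/t) * (?d + 8 * ?d)"
      proof (rule mult_left_mono)
        have "op_norm S (op_scale (c - t) (op_id S)) \<le> cmod (c - t) * op_norm S (op_id S)"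
          by (rule op_scale_bounded(2)[OF op_id_bounded])
        also have "\<dots> \<le> cmod (c - t) * 1" by (intro mult_left_mono op_norm_id) simp
        also have "\<dots> \<le> 8 * ?d" using tc by (simp add: norm_minus_commute)
        finally show "op_norm S (op_add (op_diff (\<Phi> X) (op_scale c (op_id S))) (op_scale (c - t) (op_id S))) \<le> ?d + 8 * ?d"
          using op_add_bounded(2)[OF op_diff_bounded(1)[OF PB cB] cB, of c "c - t"] \<Phi>(2) by linarith
      qed simp
      also have "\<dots> = e * 9 / 10" using t by (simp add: norm_divide)
      also have "\<dots> < e" using e by simp
      finally show "\<exists>U\<in>J. op_norm S (op_diff (op_id S) U) < e"
        using PJ Jsub unfolding op_subspace_def by blast
    qed
    then have "A \<subseteq> J" using Jmult op_comp_id(1)[OF AB] by (metis subsetI)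
    then show ?thesis using JA by blast
  qed simp
qed

theorem kleppner_imp_unique_trace:
  assumes K: "kleppner_condition G \<sigma>"
  shows "unique_trace_property G \<sigma>"
  unfolding unique_trace_property_def
proof (rule ex1I)
  show can: "tracial_state S A (restrict \<tau> A)" by (rule tracial_state_canonical)
  fix \<phi> assume \<phi>: "tracial_state S A \<phi>"
  show "\<phi> = restrict \<tau> A"
  proof (rule extensionalityI)
    show "\<phi> \<in> extensional A" using \<phi> by (simp add: tracial_state_def)
    fix T assume T: "T \<in> A"
    have "cmod (\<phi> T - restrict \<tau> A T) \<le> 0"
    proof (rule field_le_epsilon)
      fix e :: real assume "e > 0"
      then have e: "e / 16 > 0" by simp
      obtain \<Phi> c where \<Phi>: "averaging \<Phi>" "op_norm S (op_diff (\<Phi> T) (op_scale c (op_id S))) < e / 16"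
        by (rule averaging_to_scalar[OF K T e])
      have "cmod (\<phi> T - restrict \<tau> A T) \<le> cmod (\<phi> T - c) + cmod (restrict \<tau> A T - c)"
        using norm_triangle_ineq4[of "\<phi> T - c" "restrict \<tau> A T - c"] by simp
      then show "cmod (\<phi> T - restrict \<tau> A T) \<le> 0 + e"
        using dixmier_trace_eq[where \<Phi>=\<Phi> and T=T, OF \<Phi>(1) T \<Phi>(2) \<phi>] dixmier_trace_eq[where \<Phi>=\<Phi> and T=T, OF \<Phi>(1) T \<Phi>(2) can] by linarith
    qed
    then show "\<phi> T = restrict \<tau> A T" by simp
  qed (rule restrict_extensional)
qed

end


section \<open>Regular central elements obstruct simplicity and uniqueness of the trace\<close>

locale regular_central = twisted_group G \<sigma> for G (structure) and \<sigma> +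
  fixes z :: 'a
  assumes z: "z \<in> S" and z_central: "\<And>g. g \<in> S \<Longrightarrow> g \<otimes> z = z \<otimes> g"
    and z_regular: "sigma_regular G \<sigma> z"
    and z_order: "\<And>k. 0 < k \<Longrightarrow> z [^] (k::nat) \<noteq> \<one>"
begin

lemma L_z_commute:
  assumes "T \<in> A"
  shows "L z \<circ> T = T \<circ> L z"
proof (rule commute_if_commute_generators[OF L_bounded[OF z] _ assms])
  fix g assume g: "g \<in> S"
  have "\<sigma> z g = \<sigma> g z" using z_regular z_central[OF g] g by (simp add: sigma_regular_def)
  then show "L z \<circ> L g = L g \<circ> L z" unfolding L_comp[OF z g] L_comp[OF g z] by (simp only: z_central[OF g])
qed

lemma pow_inj:
  assumes "z [^] (i::nat) = z [^] (j::nat)"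
  shows "i = j"
proof -
  have *: "i = j" if "i \<le> j" "z [^] i = z [^] j" for i j :: nat
  proof (rule ccontr)
    assume "i \<noteq> j"
    have "z [^] i \<otimes> z [^] (j - i) = z [^] i"
      using that z nat_pow_mult[OF z, of i "j - i"] by simp
    then have "z [^] (j - i) = \<one>" using z by (simp only: l_cancel_one nat_pow_closed)
    then show False using z_order[of "j - i"] \<open>i \<noteq> j\<close> \<open>i \<le> j\<close> by simp
  qed
  show ?thesis using *[of i j] *[of j i] assms by (cases "i \<le> j") auto
qed

lemma L_pow_basis: "\<exists>w. cmod w = 1 \<and> (L z ^^ j) \<delta> = (\<lambda>x. w * ell2_basis (z [^] j) x)"
proof (induction j)
  case 0
  show ?case by (intro exI[of _ 1]) simp
next
  case (Suc j)
  then obtain w where w: "cmod w = 1" "(L z ^^ j) \<delta> = (\<lambda>x. w * ell2_basis (z [^] j) x)" by blast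
  have zj: "z [^] j \<in> S" using z by simp
  have "z \<otimes> z [^] j = z [^] Suc j" using z_central[OF zj] z by simp
  then have "(L z ^^ Suc j) \<delta> = (\<lambda>x. w * (\<sigma> z (z [^] j) * ell2_basis (z [^] Suc j) x))"
    using w(2) bounded_opsD(4)[OF L_bounded[OF z] ell2_basis(1)[OF zj]] L_basis[OF z zj] by simp
  then show ?case using w(1) z zj
    by (intro exI[of _ "w * \<sigma> z (z [^] j)"]) (simp add: norm_mult mult.assoc)
qed

text \<open>Unnormalized: the norm is \<open>\<surd>m\<close>, while \<open>L z\<close> moves the vector by at most \<open>2\<close>.\<close>

definition almost_fixed :: "nat \<Rightarrow> 'a vec2" where
  "almost_fixed m = (\<lambda>x. \<Sum>j<m. (L z ^^ j) \<delta> x)"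

lemma L_pow_ell2: "(L z ^^ j) \<delta> \<in> ell2 S" "ell2_norm S ((L z ^^ j) \<delta>) = 1"
  by (induction j) (auto simp: L_ell2[OF z])

lemma almost_fixed_ell2 [simp]: "almost_fixed m \<in> ell2 S"
  unfolding almost_fixed_def by (intro ell2_sum(1) L_pow_ell2)

lemma almost_fixed_norm: "ell2_norm S (almost_fixed m) = sqrt (real m)"
proof -
  have r: "ell2_restrict {z [^] j} ((L z ^^ j) \<delta>) = (L z ^^ j) \<delta>" for j
    using L_pow_basis[of j] by (auto simp: ell2_restrict_def ell2_basis_def)
  have "(ell2_norm S (\<lambda>x. \<Sum>j<m. ell2_restrict {z [^] j} ((L z ^^ j) \<delta>) x))\<^sup>2 =
      (\<Sum>j<m. (ell2_norm S (ell2_restrict {z [^] j} ((L z ^^ j) \<delta>)))\<^sup>2)"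
    by (rule ell2_norm_disjoint_sum) (auto intro: L_pow_ell2 dest: pow_inj)
  then have "(ell2_norm S (almost_fixed m))\<^sup>2 = real m"
    by (simp add: r L_pow_ell2 almost_fixed_def)
  then show ?thesis by (metis ell2_norm_nonneg real_sqrt_unique)
qed

lemma almost_fixed_shift: "ell2_norm S (\<lambda>x. L z (almost_fixed m) x - almost_fixed m x) \<le> 2"
proof -
  have "L z (almost_fixed m) = (\<lambda>x. \<Sum>j<m. (L z ^^ Suc j) \<delta> x)"
    unfolding almost_fixed_def using bounded_ops_sum[OF L_bounded[OF z], of "{..<m}" "\<lambda>j. (L z ^^ j) \<delta>"] L_pow_ell2 by simp
  then have "(\<lambda>x. L z (almost_fixed m) x - almost_fixed m x) = (\<lambda>x. (L z ^^ m) \<delta> x - \<delta> x)"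
    unfolding almost_fixed_def
    by (simp add: sum_subtractf[symmetric] sum_lessThan_telescope[of "\<lambda>j. (L z ^^ j) \<delta> _"] del: funpow.simps(2))
  then show ?thesis using ell2_diff(2)[OF L_pow_ell2(1)[of m] delta_ell2(1)] L_pow_ell2(2)[of m] by simp
qed

definition drift :: "'a op2 \<Rightarrow> nat \<Rightarrow> real" where
  "drift T m = ell2_norm S (T (almost_fixed m)) / sqrt (real m)"

text \<open>The universally quantified \<open>U\<close> makes this set a right ideal; it is a left ideal because operators are
  bounded.\<close>

definition vanishing_ideal :: "'a op2 set" where
  "vanishing_ideal = {T \<in> A. \<forall>U\<in>A. drift (T \<circ> U) \<longlonglongrightarrow> 0}"

lemma drift_nonneg: "0 \<le> drift T m"
  by (simp add: drift_def)

lemma drift_le_norm: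
  assumes "T \<in> bounded_ops S"
  shows "drift T m \<le> op_norm S T"
  using op_norm_ge[OF assms almost_fixed_ell2, of m] assms
  by (cases "m = 0") (auto simp: drift_def almost_fixed_norm pos_divide_le_eq)

lemma drift_add:
  assumes "T \<in> bounded_ops S" "U \<in> bounded_ops S"
  shows "drift (op_add T U) m \<le> drift T m + drift U m"
  unfolding drift_def op_add_def add_divide_distrib[symmetric]
  by (intro divide_right_mono ell2_add(2) bounded_ops_ell2 assms) simp

lemma drift_scale: "T \<in> bounded_ops S \<Longrightarrow> drift (op_scale c T) m = cmod c * drift T m"
  by (simp add: drift_def op_scale_def ell2_scale)

lemma drift_comp:
  assumes "T \<in> bounded_ops S" "U \<in> bounded_ops S"
  shows "drift (T \<circ> U) m \<le> op_norm S T * drift U m"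
  unfolding drift_def o_apply times_divide_eq_right
  by (intro divide_right_mono op_norm_ge bounded_ops_ell2 assms) simp

lemma drift_null:
  assumes "f \<longlonglongrightarrow> 0" "\<And>m. drift T m \<le> f m"
  shows "drift T \<longlonglongrightarrow> 0"
  by (rule Lim_null_comparison[OF _ assms(1)]) (use assms(2) drift_nonneg in auto)

lemma vanishing_ideal_closed: "closed_two_sided_ideal S A vanishing_ideal"
  unfolding closed_two_sided_ideal_def op_subspace_def op_norm_closed_def
proof (intro conjI ballI allI impI)
  have VA: "T \<in> A" if "T \<in> vanishing_ideal" for T using that by (simp add: vanishing_ideal_def)
  have VD: "drift (T \<circ> U) \<longlonglongrightarrow> 0" if "T \<in> vanishing_ideal" "U \<in> A" for T U
    using that by (simp add: vanishing_ideal_def)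
  have VI: "T \<in> vanishing_ideal" if "T \<in> A" "\<And>U. U \<in> A \<Longrightarrow> drift (T \<circ> U) \<longlonglongrightarrow> 0" for T
    using that by (simp add: vanishing_ideal_def)
  show "vanishing_ideal \<subseteq> A" using VA by blast
  show "op_zero \<in> vanishing_ideal"
    by (rule VI[OF AD(2)], rule drift_null[OF tendsto_const]) (simp add: drift_def op_zero_def)
  { fix T U assume T: "T \<in> vanishing_ideal" and U: "U \<in> vanishing_ideal"
    show "op_add T U \<in> vanishing_ideal"
    proof (rule VI[OF AD(3)[OF VA[OF T] VA[OF U]]])
      fix V assume V: "V \<in> A"
      have "(\<lambda>m. drift (T \<circ> V) m + drift (U \<circ> V) m) \<longlonglongrightarrow> 0"
        using tendsto_add[OF VD[OF T V] VD[OF U V]] by simp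
      then show "drift (op_add T U \<circ> V) \<longlonglongrightarrow> 0"
        unfolding op_comp_add(2)[OF AB[OF V] AB[OF VA[OF T]] AB[OF VA[OF U]]]
        by (rule drift_null) (intro drift_add op_comp_bounded AB VA T U V)
    qed }
  { fix c T assume T: "T \<in> vanishing_ideal"
    show "op_scale c T \<in> vanishing_ideal"
    proof (rule VI[OF AD(4)[OF VA[OF T]]])
      fix V assume V: "V \<in> A"
      show "drift (op_scale c T \<circ> V) \<longlonglongrightarrow> 0"
        unfolding op_comp_scale(2)[OF AB[OF V] AB[OF VA[OF T]]]
        by (rule drift_null[OF tendsto_mult_right_zero[OF VD[OF T V], of "cmod c"]])
          (simp add: drift_scale[OF AB[OF AD(6)[OF VA[OF T] V]]])
    qed }
  { fix T U assume T: "T \<in> A" and U: "U \<in> vanishing_ideal"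
    show "T \<circ> U \<in> vanishing_ideal"
    proof (rule VI[OF AD(6)[OF T VA[OF U]]])
      fix V assume V: "V \<in> A"
      show "drift (T \<circ> U \<circ> V) \<longlonglongrightarrow> 0"
        unfolding comp_assoc
        by (rule drift_null[OF tendsto_mult_right_zero[OF VD[OF U V], of "op_norm S T"]])
          (intro drift_comp op_comp_bounded AB T VA U V)
    qed
    show "U \<circ> T \<in> vanishing_ideal"
    proof (rule VI[OF AD(6)[OF VA[OF U] T]])
      fix V assume V: "V \<in> A"
      show "drift (U \<circ> T \<circ> V) \<longlonglongrightarrow> 0" unfolding comp_assoc by (rule VD[OF U AD(6)[OF T V]])
    qed }
  fix T assume T: "T \<in> bounded_ops S" and close: "\<forall>e>0. \<exists>U\<in>vanishing_ideal. op_norm S (op_diff T U) < e"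
  have TA: "T \<in> A" by (rule AD(8)[OF T]) (use close VA in blast)
  show "T \<in> vanishing_ideal"
  proof (rule VI[OF TA])
    fix V assume V: "V \<in> A"
    show "drift (T \<circ> V) \<longlonglongrightarrow> 0"
    proof (rule LIMSEQ_I)
      fix e :: real assume e: "e > 0"
      define v where "v = op_norm S V + 1"
      have v: "v > 0" "op_norm S V \<le> v" using AB[OF V] by (simp_all add: v_def add_nonneg_pos)
      obtain U where U: "U \<in> vanishing_ideal" "op_norm S (op_diff T U) < e / 2 / v"
        using close e v(1) by (metis half_gt_zero divide_pos_pos)
      note UB = AB[OF VA[OF U(1)]] and VB = AB[OF V]
      note dB = op_diff_bounded(1)[OF T UB]
      obtain M where M: "\<And>m. m \<ge> M \<Longrightarrow> norm (drift (U \<circ> V) m - 0) < e / 2"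
        using LIMSEQ_D[OF VD[OF U(1) V] half_gt_zero[OF e]] by blast
      have eq: "T \<circ> V = op_add (op_diff T U \<circ> V) (U \<circ> V)"
        unfolding op_comp_diff(2)[OF VB T UB] by (simp add: op_diff_def op_add_def fun_eq_iff)
      have "norm (drift (T \<circ> V) m - 0) < e" if m: "m \<ge> M" for m
      proof -
        have "op_norm S (op_diff T U) * drift V m \<le> (e / 2 / v) * v"
          using U(2) drift_le_norm[OF VB, of m] v e by (intro mult_mono) (auto simp: drift_nonneg)
        also have "\<dots> = e / 2" using v by simp
        finally have "drift (op_diff T U \<circ> V) m \<le> e / 2" using drift_comp[OF dB VB, of m] by linarith
        moreover have "drift (T \<circ> V) m \<le> drift (op_diff T U \<circ> V) m + drift (U \<circ> V) m"
          unfolding eq by (intro drift_add op_comp_bounded dB UB VB)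
        ultimately have "drift (T \<circ> V) m \<le> e / 2 + drift (U \<circ> V) m" by linarith
        then show ?thesis using M[OF m] drift_nonneg[of "T \<circ> V" m] unfolding real_norm_def by linarith
      qed
      then show "\<exists>M. \<forall>m\<ge>M. norm (drift (T \<circ> V) m - 0) < e" by blast
    qed
  qed
qed

text \<open>Since \<open>L z\<close> commutes with \<open>U\<close>, it suffices that it almost fixes the vectors \<open>almost_fixed m\<close>.\<close>

lemma shift_in_vanishing_ideal: "op_diff (L z) (op_id S) \<in> vanishing_ideal"
  unfolding vanishing_ideal_def
proof (intro CollectI conjI ballI)
  show "op_diff (L z) (op_id S) \<in> A" by (intro AD(5) L_in_A id_in_A z)
  fix U assume U: "U \<in> A"
  note UB = AB[OF U]
  have "drift (op_diff (L z) (op_id S) \<circ> U) m \<le> op_norm S U * 2 / sqrt (real m)" for m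
  proof -
    have W: "(op_diff (L z) (op_id S) \<circ> U) (almost_fixed m) = U (\<lambda>x. L z (almost_fixed m) x - almost_fixed m x)"
      unfolding bounded_ops_diff[OF UB bounded_ops_ell2[OF L_bounded[OF z]] almost_fixed_ell2]
      using fun_cong[OF L_z_commute[OF U], of "almost_fixed m"] UB by (simp add: op_diff_def)
    have "ell2_norm S ((op_diff (L z) (op_id S) \<circ> U) (almost_fixed m)) \<le>
        op_norm S U * ell2_norm S (\<lambda>x. L z (almost_fixed m) x - almost_fixed m x)"
      unfolding W by (intro op_norm_ge UB ell2_diff(1) almost_fixed_ell2 bounded_ops_ell2 L_bounded z)
    also have "\<dots> \<le> op_norm S U * 2" by (intro mult_left_mono almost_fixed_shift op_norm_nonneg UB)
    finally show ?thesis unfolding drift_def by (intro divide_right_mono) auto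
  qed
  moreover have "(\<lambda>m. op_norm S U * 2 / sqrt (real m)) \<longlonglongrightarrow> 0"
    by (intro tendsto_divide_0[OF tendsto_const] filterlim_at_top_imp_at_infinity
        filterlim_compose[OF sqrt_at_top filterlim_real_sequentially])
  ultimately show "drift (op_diff (L z) (op_id S) \<circ> U) \<longlonglongrightarrow> 0" by (intro drift_null)
qed

lemma z_not_one: "z \<noteq> \<one>"
  using z_order[of 1] z by auto

theorem not_simple: "\<not> twisted_cstar_simple G \<sigma>"
proof
  assume "twisted_cstar_simple G \<sigma>"
  then consider "vanishing_ideal = {op_zero}" | "vanishing_ideal = A"
    using vanishing_ideal_closed unfolding twisted_cstar_simple_def cstar_simple_algebra_def by blast
  then show False
  proof cases
    case 1
    then have "op_diff (L z) (op_id S) \<delta> \<one> = 0" using shift_in_vanishing_ideal by (simp add: op_zero_def)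
    then show False using z z_not_one by (simp add: op_diff_def L_basis) (simp add: ell2_basis_def)
  next
    case 2
    then have "drift (op_id S \<circ> op_id S) \<longlonglongrightarrow> 0" unfolding vanishing_ideal_def using id_in_A by blast
    then obtain M where M: "\<And>m. m \<ge> M \<Longrightarrow> norm (drift (op_id S \<circ> op_id S) m - 0) < 1"
      using LIMSEQ_D zero_less_one by blast
    have "drift (op_id S \<circ> op_id S) (Suc M) = 1" by (simp add: drift_def almost_fixed_norm)
    then show False using M[of "Suc M"] by simp
  qed
qed

text \<open>The element \<open>y = 1 + L z\<close> is central, so \<open>T \<mapsto> \<tau>(y\<^sup>* T y) / 2\<close> is a tracial state.  At \<open>L z\<close> it has the
  value \<open>1/2\<close>, because \<open>z\<^sup>2 \<noteq> 1\<close>, whereas \<open>\<tau>\<close> vanishes there.\<close>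

theorem not_unique_trace: "\<not> unique_trace_property G \<sigma>"
proof
  assume uniq: "unique_trace_property G \<sigma>"
  define y where "y = op_add (op_id S) (L z)"
  define \<phi> where "\<phi> T = 1/2 * \<tau> (op_adj S y \<circ> (T \<circ> y))" for T
  have yA: "y \<in> A" unfolding y_def by (intro AD(3) id_in_A L_in_A z)
  note yB = AB[OF yA] and yadj = AD(7)[OF yA]
  note ysB = AB[OF yadj]
  have yc: "y \<circ> T = T \<circ> y" if T: "T \<in> A" for T
    unfolding y_def op_comp_add(1)[OF AB[OF T] op_id_bounded L_bounded[OF z]]
      op_comp_add(2)[OF AB[OF T] op_id_bounded L_bounded[OF z]] op_comp_id[OF AB[OF T]] L_z_commute[OF T] by (rule refl)
  have ysc: "op_adj S y \<circ> T = T \<circ> op_adj S y" if T: "T \<in> A" for T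
  proof -
    have "op_adj S (op_adj S T \<circ> y) = op_adj S (y \<circ> op_adj S T)" by (simp only: yc[OF AD(7)[OF T]])
    then show ?thesis
      unfolding op_adj_comp[OF AB[OF AD(7)[OF T]] yB] op_adj_comp[OF yB AB[OF AD(7)[OF T]]] op_adj_adj[OF AB[OF T]] .
  qed
  have \<phi>_pos: "\<phi> (op_adj S T \<circ> T) = of_real (1/2 * (ell2_norm S (T (y \<delta>)))\<^sup>2)" if T: "T \<in> A" for T
  proof -
    have "op_adj S y \<circ> (op_adj S T \<circ> T \<circ> y) = op_adj S (T \<circ> y) \<circ> (T \<circ> y)"
      unfolding op_adj_comp[OF AB[OF T] yB] by (simp only: o_assoc)
    then show ?thesis
      unfolding \<phi>_def using trace_adj_self[OF AB[OF AD(6)[OF T yA]]] by simp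
  qed
  have y\<delta>: "y \<delta> = (\<lambda>x. \<delta> x + ell2_basis z x)"
    using z by (simp add: y_def op_add_def L_basis)
  have "(ell2_norm S (y \<delta>))\<^sup>2 = (ell2_norm S \<delta>)\<^sup>2 + (ell2_norm S (ell2_basis z))\<^sup>2"
    unfolding y\<delta> by (rule ell2_norm_disjoint_add[OF delta_ell2(1) ell2_basis(1)[OF z]])
      (use z_not_one in \<open>auto simp: ell2_basis_def\<close>)
  then have ny: "(ell2_norm S (y \<delta>))\<^sup>2 = 2" using z by (simp add: ell2_basis)
  have "op_adj S (op_id S) \<circ> op_id S = op_id S"
    by (simp only: op_adj_id op_comp_id(1)[OF op_id_bounded])
  with \<phi>_pos[OF id_in_A] have \<phi>_one: "\<phi> (op_id S) = 1"
    using op_id_apply[OF bounded_ops_ell2[OF yB]] ny by simp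
  have \<phi>_add: "\<phi> (op_add T U) = \<phi> T + \<phi> U" if "T \<in> A" "U \<in> A" for T U
    unfolding \<phi>_def op_comp_add(2)[OF yB AB[OF that(1)] AB[OF that(2)]]
      op_comp_add(1)[OF ysB AB[OF AD(6)[OF that(1) yA]] AB[OF AD(6)[OF that(2) yA]]]
    by (simp add: trace_linear distrib_left)
  have \<phi>_scale: "\<phi> (op_scale c T) = c * \<phi> T" if "T \<in> A" for c T
    unfolding \<phi>_def op_comp_scale(2)[OF yB AB[OF that]] op_comp_scale(1)[OF ysB AB[OF AD(6)[OF that yA]]]
    by (simp add: trace_linear)
  have \<phi>_trace: "\<phi> (T \<circ> U) = \<phi> (U \<circ> T)" if T: "T \<in> A" and U: "U \<in> A" for T U
  proof -
    have "op_adj S y \<circ> (T \<circ> U \<circ> y) = T \<circ> (op_adj S y \<circ> (U \<circ> y))"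
      by (simp only: o_assoc ysc[OF T])
    moreover have "op_adj S y \<circ> (U \<circ> T \<circ> y) = (op_adj S y \<circ> (U \<circ> y)) \<circ> T"
      by (simp only: comp_assoc yc[OF T, symmetric])
    moreover have "\<tau> (T \<circ> (op_adj S y \<circ> (U \<circ> y))) = \<tau> ((op_adj S y \<circ> (U \<circ> y)) \<circ> T)"
      by (intro trace_commute T AD(6) yadj U yA)
    ultimately show ?thesis by (simp only: \<phi>_def)
  qed
  have r: "restrict \<phi> A T = \<phi> T" if "T \<in> A" for T using that by simp
  have pos: "\<phi> (op_adj S T \<circ> T) \<in> \<real> \<and> 0 \<le> Re (\<phi> (op_adj S T \<circ> T))" if "T \<in> A" for T
    unfolding \<phi>_pos[OF that] by simp
  have "tracial_state S A (restrict \<phi> A)"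
    unfolding tracial_state_def
    by (intro conjI ballI allI restrict_extensional)
      (simp_all only: r AD(2-7) id_in_A \<phi>_add \<phi>_scale \<phi>_one pos, rule \<phi>_trace)
  then have "restrict \<phi> A = restrict \<tau> A"
    using uniq tracial_state_canonical unfolding unique_trace_property_def by blast
  then have eq: "\<phi> (L z) = \<tau> (L z)" using L_in_A[OF z] by (metis restrict_apply')
  have zz: "z \<otimes> z \<in> S" "z \<otimes> z \<noteq> \<one>" "z \<otimes> z \<noteq> z"
    using z z_order[of 2] z_not_one by (auto simp: numeral_2_eq_2 nat_pow_Suc)
  have "\<phi> (L z) = 1/2 * ell2_inner S (L z (y \<delta>)) (y \<delta>)"
    unfolding \<phi>_def trace_inner o_apply
    using op_adj_inner'[OF yB bounded_ops_ell2[OF L_bounded[OF z]] delta_ell2(1)] by simp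
  also have "L z (y \<delta>) = (\<lambda>x. ell2_basis z x + \<sigma> z z * ell2_basis (z \<otimes> z) x)"
    unfolding y\<delta> bounded_opsD(3)[OF L_bounded[OF z] delta_ell2(1) ell2_basis(1)[OF z]]
      L_basis[OF z one_closed] L_basis[OF z z] using z by simp
  also have "ell2_inner S (\<lambda>x. ell2_basis z x + \<sigma> z z * ell2_basis (z \<otimes> z) x) (y \<delta>) = 1"
    unfolding y\<delta> using z zz z_not_one
    by (simp add: ell2_inner_add ell2_inner_scale ell2_scale ell2_add ell2_basis ell2_inner_basis) (auto simp: ell2_basis_def)
  finally show False using eq trace_L[OF z] z_not_one by simp
qed

end

theorem (in relative_powers_group) kleppner_iff_simple_and_unique_trace:
  shows "kleppner_condition G \<sigma> \<longleftrightarrow> twisted_cstar_simple G \<sigma>"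
    and "kleppner_condition G \<sigma> \<longleftrightarrow> unique_trace_property G \<sigma>"
proof -
  have "\<not> twisted_cstar_simple G \<sigma> \<and> \<not> unique_trace_property G \<sigma>" if nk: "\<not> kleppner_condition G \<sigma>"
  proof -
    obtain z where z: "z \<in> Z" "z \<noteq> \<one>" "sigma_regular G \<sigma> z" using nk kleppner_iff by blast
    interpret regular_central G \<sigma> z
      by unfold_locales (use z Z_subset Z_central Z_torsion_free in auto)
    show ?thesis using not_simple not_unique_trace by blast
  qed
  then show "kleppner_condition G \<sigma> \<longleftrightarrow> twisted_cstar_simple G \<sigma>"
    and "kleppner_condition G \<sigma> \<longleftrightarrow> unique_trace_property G \<sigma>"
    using kleppner_imp_simple kleppner_imp_unique_trace by blast+
qed


section \<open>Presented groups\<close>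

lemma pres_eq_append:
  assumes "pres_eq R u u'" "pres_eq R v v'"
  shows "pres_eq R (u @ v) (u' @ v')"
  using pres_ctxt[OF assms(1), of "[]" v] pres_ctxt[OF assms(2), of u' "[]"] by (auto intro: pres_trans)

lemma pres_class_eq_iff: "pres_class R u = pres_class R v \<longleftrightarrow> pres_eq R u v"
proof
  assume "pres_class R u = pres_class R v"
  moreover have "v \<in> pres_class R v" by (simp add: pres_class_def pres_refl)
  ultimately show "pres_eq R u v" by (auto simp: pres_class_def)
next
  assume uv: "pres_eq R u v"
  have "pres_eq R u w \<longleftrightarrow> pres_eq R v w" for w
    using uv pres_trans pres_sym by blast
  then show "pres_class R u = pres_class R v" by (simp add: pres_class_def)
qed

lemma presented_group_carrier: "carrier (presented_group R) = range (pres_class R)"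
  and presented_group_one: "\<one>\<^bsub>presented_group R\<^esub> = pres_class R []"
  by (simp_all add: presented_group_def)

lemma presented_group_mult:
  "pres_class R u \<otimes>\<^bsub>presented_group R\<^esub> pres_class R v = pres_class R (u @ v)"
proof -
  have eq: "pres_class R (u' @ v') = pres_class R (u @ v)" if "u' \<in> pres_class R u" "v' \<in> pres_class R v" for u' v'
    unfolding pres_class_eq_iff by (rule pres_sym, rule pres_eq_append) (use that in \<open>simp_all add: pres_class_def\<close>)
  have "u \<in> pres_class R u" "v \<in> pres_class R v" by (simp_all add: pres_class_def pres_refl)
  then have "(\<Union>u'\<in>pres_class R u. \<Union>v'\<in>pres_class R v. pres_class R (u @ v)) = pres_class R (u @ v)" by auto
  moreover have "(\<Union>u'\<in>pres_class R u. \<Union>v'\<in>pres_class R v. pres_class R (u' @ v')) =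
      (\<Union>u'\<in>pres_class R u. \<Union>v'\<in>pres_class R v. pres_class R (u @ v))"
    by (intro SUP_cong refl eq)
  ultimately show ?thesis by (simp add: presented_group_def)
qed

definition word_inv :: "'s word \<Rightarrow> 's word" where
  "word_inv w = rev (map (\<lambda>(s, e). (s, \<not> e)) w)"

lemma pres_eq_word_inv: "pres_eq R (word_inv w @ w) []"
proof (induction w)
  case Nil
  show ?case by (simp add: word_inv_def pres_refl)
next
  case (Cons l w)
  obtain s e where l: "l = (s, e)" by (cases l)
  have "pres_eq R [(s, \<not> e), (s, \<not> \<not> e)] []" by (rule pres_cancel)
  then have "pres_eq R (word_inv w @ [(s, \<not> e), (s, e)] @ w) (word_inv w @ [] @ w)"
    using pres_ctxt by fastforce
  then show ?case using pres_trans[OF _ Cons] by (simp add: l word_inv_def)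
qed

lemma presented_group: "group (presented_group R)"
proof (rule groupI)
  fix X Y assume "X \<in> carrier (presented_group R)" "Y \<in> carrier (presented_group R)"
  then show "X \<otimes>\<^bsub>presented_group R\<^esub> Y \<in> carrier (presented_group R)"
    by (auto simp: presented_group_carrier presented_group_mult)
next
  fix X Y W assume "X \<in> carrier (presented_group R)" "Y \<in> carrier (presented_group R)" "W \<in> carrier (presented_group R)"
  then show "X \<otimes>\<^bsub>presented_group R\<^esub> Y \<otimes>\<^bsub>presented_group R\<^esub> W = X \<otimes>\<^bsub>presented_group R\<^esub> (Y \<otimes>\<^bsub>presented_group R\<^esub> W)"
    by (auto simp: presented_group_carrier presented_group_mult)
next
  fix X assume "X \<in> carrier (presented_group R)"
  then obtain w where w: "X = pres_class R w" by (auto simp: presented_group_carrier)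
  show "\<exists>Y\<in>carrier (presented_group R). Y \<otimes>\<^bsub>presented_group R\<^esub> X = \<one>\<^bsub>presented_group R\<^esub>"
    by (rule bexI[of _ "pres_class R (word_inv w)"])
      (simp_all add: w presented_group_carrier presented_group_mult presented_group_one pres_class_eq_iff pres_eq_word_inv rangeI)
qed (auto simp: presented_group_carrier presented_group_mult presented_group_one)

definition word_action :: "('s \<times> bool \<Rightarrow> 'x \<Rightarrow> 'x) \<Rightarrow> 's word \<Rightarrow> 'x \<Rightarrow> 'x" where
  "word_action f w = foldr (\<lambda>l h. f l \<circ> h) w id"

lemma word_action_simps [simp]:
  "word_action f [] = id" "word_action f (l # w) = f l \<circ> word_action f w"
  by (simp_all add: word_action_def)

lemma word_action_append: "word_action f (u @ v) = word_action f u \<circ> word_action f v"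
  by (induction u) (simp_all add: comp_assoc)

lemma word_action_cong:
  assumes inv: "\<And>s e. f (s, e) \<circ> f (s, \<not> e) = id"
    and rel: "\<And>u v. (u, v) \<in> R \<Longrightarrow> word_action f u = word_action f v"
    and eq: "pres_eq R u v"
  shows "word_action f u = word_action f v"
  using eq
proof (induction rule: pres_eq.induct)
  case (pres_cancel s e)
  show ?case using inv[of s e] by simp
qed (simp_all add: word_action_append rel)

definition group_action :: "('s \<times> bool \<Rightarrow> 'x \<Rightarrow> 'x) \<Rightarrow> 's word set \<Rightarrow> 'x \<Rightarrow> 'x" where
  "group_action f X = word_action f (SOME w. w \<in> X)"

lemma group_action_class:
  assumes "\<And>s e. f (s, e) \<circ> f (s, \<not> e) = id"
    and "\<And>u v. (u, v) \<in> R \<Longrightarrow> word_action f u = word_action f v"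
  shows "group_action f (pres_class R w) = word_action f w"
proof -
  have "(SOME u. u \<in> pres_class R w) \<in> pres_class R w"
    by (rule someI[of _ w]) (simp add: pres_class_def pres_refl)
  then have "pres_eq R w (SOME u. u \<in> pres_class R w)" by (simp add: pres_class_def)
  from word_action_cong[OF assms this] show ?thesis by (simp add: group_action_def)
qed


section \<open>Ping-pong\<close>

text \<open>Identify the natural numbers with \<open>I \<times> D\<close> in such a way that \<open>D\<close> becomes \<open>{0} \<times> D\<close>, and let \<open>\<pi>\<close> act on
  the first coordinate.  The identification exists because \<open>D\<close> and its complement are countably
  infinite, whatever they are; so the same \<open>D\<close>, or its complement, can serve two different actions.\<close>

lemma induced_action:
  fixes I :: "int set" and \<pi> :: "int \<Rightarrow> int \<Rightarrow> int" and D :: "nat set"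
  assumes I: "0 \<in> I" "I \<noteq> {0}" and D: "infinite D" "infinite (- D)"
    and \<pi>: "\<And>k i. i \<in> I \<Longrightarrow> \<pi> k i \<in> I" "\<And>i. i \<in> I \<Longrightarrow> \<pi> 0 i = i"
      "\<And>k l i. i \<in> I \<Longrightarrow> \<pi> (k + l) i = \<pi> k (\<pi> l i)"
  obtains A :: "int \<Rightarrow> nat \<Rightarrow> nat" where "\<And>k l x. A (k + l) x = A k (A l x)"
    and "\<And>k x. (\<And>i. i \<in> I \<Longrightarrow> \<pi> k i = i) \<Longrightarrow> A k x = x"
    and "\<And>k x. \<pi> k 0 \<noteq> 0 \<Longrightarrow> x \<in> D \<Longrightarrow> A k x \<notin> D"
proof -
  let ?P = "(I - {0}) \<times> D"
  have "infinite ?P" using I D by (auto simp: finite_cartesian_product_iff)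
  then have 1: "bij_betw (to_nat_on ?P) ?P UNIV" by (intro to_nat_on_infinite) auto
  have 2: "bij_betw (to_nat_on (- D)) (- D) UNIV" by (intro to_nat_on_infinite D) auto
  obtain h where h: "bij_betw h (- D) ?P"
    using bij_betw_trans[OF 2 bij_betw_inv_into[OF 1]] by blast
  define f where "f x = (if x \<in> D then (0, x) else h x)" for x
  have "bij_betw f D ({0} \<times> D)" by (rule bij_betw_byWitness[where f'=snd]) (auto simp: f_def)
  moreover have "bij_betw f (- D) ?P" using h by (subst bij_betw_cong[of _ _ h]) (auto simp: f_def)
  ultimately have "bij_betw f (D \<union> - D) ({0} \<times> D \<union> ?P)" by (rule bij_betw_combine) auto
  moreover have "{0} \<times> D \<union> ?P = I \<times> D" using I by auto
  ultimately have f: "bij_betw f UNIV (I \<times> D)" by (simp only: Compl_partition)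
  define g where "g = inv_into UNIV f"
  have fg: "f (g p) = p" if "p \<in> I \<times> D" for p
    using bij_betw_inv_into_right[OF f that] by (simp add: g_def)
  have gf: "g (f x) = x" for x using bij_betw_inv_into_left[OF f] by (simp add: g_def)
  have fI: "fst (f x) \<in> I" "snd (f x) \<in> D" for x
    using bij_betw_apply[OF f, of x] by (auto simp: mem_Times_iff)
  define A where "A k x = g (\<pi> k (fst (f x)), snd (f x))" for k x
  have fA: "f (A k x) = (\<pi> k (fst (f x)), snd (f x))" for k x
    unfolding A_def by (rule fg) (simp add: fI \<pi>(1))
  show thesis
  proof (rule that)
    fix k l x show "A (k + l) x = A k (A l x)"
      using \<pi>(3)[OF fI(1)] fA[of l x] by (simp add: A_def[of "k + l"] A_def[of k])
  next
    fix k x assume "\<And>i. i \<in> I \<Longrightarrow> \<pi> k i = i"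
    then show "A k x = x" using gf[of x] fI(1)[of x] by (simp add: A_def)
  next
    fix k x assume k: "\<pi> k 0 \<noteq> 0" and x: "x \<in> D"
    show "A k x \<notin> D"
    proof
      assume "A k x \<in> D"
      then have "fst (f (A k x)) = 0" by (simp add: f_def)
      then show False using fA[of k x] k x by (simp add: f_def)
    qed
  qed
qed

lemma infinite_evens: "infinite {x::nat. even x}" "infinite (- {x::nat. even x})"
proof -
  have "range (\<lambda>k::nat. 2 * k) \<subseteq> {x. even x}" "range (\<lambda>k::nat. 2 * k + 1) \<subseteq> - {x. even x}" by auto
  moreover have "infinite (range (\<lambda>k::nat. 2 * k))" "infinite (range (\<lambda>k::nat. 2 * k + 1))"
    by (intro range_inj_infinite injI; simp)+
  ultimately show "infinite {x::nat. even x}" "infinite (- {x::nat. even x})"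
    using finite_subset by blast+
qed

text \<open>The parameters \<open>A\<close> and \<open>B\<close> are the actions of the integers by powers of \<open>a\<close> and \<open>b\<close>.  The nonzero powers
  of \<open>a\<close> send \<open>C\<close> into its complement, and \<open>b\<close>, \<open>b\<^sup>2\<close>, up to \<open>b\<^sup>n\<^sup>-\<^sup>1\<close> send the complement into \<open>C\<close>.  The homomorphism \<open>ht\<close> counts
  the exponent of \<open>b\<close> and shows that \<open>b\<^sup>n\<close> has infinite order, which \<open>act\<close> cannot detect.\<close>

locale ping_pong = group G for G (structure) +
  fixes a b :: 'a and n :: nat and act :: "'a \<Rightarrow> nat \<Rightarrow> nat" and ht :: "'a \<Rightarrow> int"
    and A B :: "int \<Rightarrow> nat \<Rightarrow> nat" and C :: "nat set"
  assumes n: "n \<ge> 2" and a: "a \<in> carrier G" and b: "b \<in> carrier G"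
    and relation: "a \<otimes> b [^] n = b [^] n \<otimes> a"
    and generated: "\<And>P x. P \<one> \<Longrightarrow> (\<And>x. x \<in> carrier G \<Longrightarrow> P x \<Longrightarrow> P (x \<otimes> a) \<and> P (x \<otimes> inv a) \<and> P (x \<otimes> b) \<and> P (x \<otimes> inv b))
        \<Longrightarrow> x \<in> carrier G \<Longrightarrow> P x"
    and act_mult: "\<And>x y u. x \<in> carrier G \<Longrightarrow> y \<in> carrier G \<Longrightarrow> act (x \<otimes> y) u = act x (act y u)"
    and act_one: "\<And>u. act \<one> u = u"
    and act_a: "\<And>u. act a u = A 1 u" and act_b: "\<And>u. act b u = B 1 u"
    and A_add: "\<And>k l u. A (k + l) u = A k (A l u)" and A_zero: "\<And>u. A 0 u = u"
    and B_add: "\<And>k l u. B (k + l) u = B k (B l u)" and B_zero: "\<And>u. B 0 u = u"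
    and B_n: "\<And>u. B (int n) u = u"
    and A_pong: "\<And>k u. k \<noteq> 0 \<Longrightarrow> u \<in> C \<Longrightarrow> A k u \<notin> C"
    and B_pong: "\<And>k u. 0 < k \<Longrightarrow> k < int n \<Longrightarrow> u \<notin> C \<Longrightarrow> B k u \<in> C"
    and ht_mult: "\<And>x y. x \<in> carrier G \<Longrightarrow> y \<in> carrier G \<Longrightarrow> ht (x \<otimes> y) = ht x + ht y"
    and ht_b: "ht b = 1"
begin

definition z where "z = b [^] n"
definition Z where "Z = range (\<lambda>k::int. z [^] k)"

lemma z_closed [simp]: "z \<in> carrier G"
  by (simp add: z_def b)

lemma Z_subset: "Z \<subseteq> carrier G"
  by (auto simp: Z_def)

lemma commute_inv:
  assumes "x \<in> carrier G" "y \<in> carrier G" "x \<otimes> y = y \<otimes> x"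
  shows "x \<otimes> inv y = inv y \<otimes> x"
proof -
  have "inv y \<otimes> x = inv y \<otimes> ((x \<otimes> y) \<otimes> inv y)" using assms(1,2) by (simp add: m_assoc)
  also have "\<dots> = inv y \<otimes> (y \<otimes> (x \<otimes> inv y))" using assms by (simp add: m_assoc)
  also have "\<dots> = x \<otimes> inv y" using assms(1,2) by (simp add: m_assoc[symmetric])
  finally show ?thesis by simp
qed

lemma z_central: "x \<in> carrier G \<Longrightarrow> z \<otimes> x = x \<otimes> z"
proof (rule generated[of "\<lambda>x. z \<otimes> x = x \<otimes> z"])
  have step: "z \<otimes> (x \<otimes> y) = x \<otimes> y \<otimes> z"
    if "x \<in> carrier G" "z \<otimes> x = x \<otimes> z" "y \<in> carrier G" "z \<otimes> y = y \<otimes> z" for x y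
    using that by (metis m_assoc z_closed)
  have za: "z \<otimes> a = a \<otimes> z" using relation by (simp add: z_def)
  have zb: "z \<otimes> b = b \<otimes> z" using b by (metis z_def nat_pow_Suc nat_pow_Suc2)
  fix x assume "x \<in> carrier G" "z \<otimes> x = x \<otimes> z"
  then show "z \<otimes> (x \<otimes> a) = x \<otimes> a \<otimes> z \<and> z \<otimes> (x \<otimes> inv a) = x \<otimes> inv a \<otimes> z \<and>
      z \<otimes> (x \<otimes> b) = x \<otimes> b \<otimes> z \<and> z \<otimes> (x \<otimes> inv b) = x \<otimes> inv b \<otimes> z"
    using step a b za zb commute_inv[OF z_closed a za] commute_inv[OF z_closed b zb] by auto
qed auto

lemma Z_central:
  assumes "w \<in> Z" "x \<in> carrier G"
  shows "x \<otimes> w = w \<otimes> x"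
proof -
  have nat: "x \<otimes> z [^] (k::nat) = z [^] k \<otimes> x" for k
  proof (induction k)
    case (Suc k)
    have "x \<otimes> z [^] Suc k = (x \<otimes> z [^] k) \<otimes> z" using assms(2) by (simp add: m_assoc)
    also have "\<dots> = z [^] k \<otimes> (x \<otimes> z)" using Suc assms(2) by (simp add: m_assoc)
    also have "\<dots> = z [^] Suc k \<otimes> x" using z_central[OF assms(2)] assms(2) by (simp add: m_assoc)
    finally show ?case .
  qed (use assms in simp)
  obtain k :: int where k: "w = z [^] k" using assms(1) by (auto simp: Z_def)
  show ?thesis
  proof (cases k rule: int_cases2)
    case (nonneg j)
    then show ?thesis using nat[of j] by (simp add: k int_pow_int)
  next
    case (nonpos j)
    have "x \<otimes> inv (z [^] j) = inv (z [^] j) \<otimes> x"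
      by (rule commute_inv[OF assms(2) _ nat]) simp
    then show ?thesis by (simp add: k nonpos int_pow_neg_int)
  qed
qed

lemma Z_mult: "u \<in> Z \<Longrightarrow> w \<in> Z \<Longrightarrow> u \<otimes> w \<in> Z"
  unfolding Z_def by (elim rangeE) (simp add: int_pow_mult[OF z_closed, symmetric])

lemma one_in_Z: "\<one> \<in> Z" and z_in_Z: "z \<in> Z" and inv_z_in_Z: "inv z \<in> Z"
proof -
  have "z [^] (0::int) \<in> Z" "z [^] (1::int) \<in> Z" "z [^] (-1::int) \<in> Z" unfolding Z_def by (rule rangeI)+
  then show "\<one> \<in> Z" "z \<in> Z" "inv z \<in> Z" by (simp_all add: int_pow_neg)
qed

lemma act_inv: "x \<in> carrier G \<Longrightarrow> act (inv x) (act x u) = u" "x \<in> carrier G \<Longrightarrow> act x (act (inv x) u) = u"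
  using act_mult[of "inv x" x u] act_mult[of x "inv x" u] by (auto simp: act_one)

lemma act_nat_pow: "act (a [^] (k::nat)) u = A (int k) u" "act (b [^] (k::nat)) u = B (int k) u"
proof -
  show "act (a [^] (k::nat)) u = A (int k) u"
    by (induction k arbitrary: u) (auto simp: act_one A_zero act_mult a act_a A_add[symmetric] add.commute)
  show "act (b [^] (k::nat)) u = B (int k) u"
    by (induction k arbitrary: u) (auto simp: act_one B_zero act_mult b act_b B_add[symmetric] add.commute)
qed

lemma act_int_pow: "act (a [^] (k::int)) u = A k u"
proof (cases k rule: int_cases2)
  case (nonneg j)
  then show ?thesis using act_nat_pow(1)[of j u] by (simp add: int_pow_int)
next
  case (nonpos j)
  have "u = A (int j) (A k u)" by (simp add: nonpos A_add[symmetric] A_zero)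
  then have "act (inv (a [^] j)) u = A k u"
    using act_inv(1)[of "a [^] j" "A k u"] a by (simp add: act_nat_pow)
  then show ?thesis by (simp add: nonpos int_pow_neg_int[OF a])
qed

lemma act_Z: "w \<in> Z \<Longrightarrow> act w u = u"
proof -
  assume "w \<in> Z"
  then obtain k :: int where k: "w = z [^] k" by (auto simp: Z_def)
  have z: "act z u = u" for u unfolding z_def act_nat_pow by (rule B_n)
  have nat: "act (z [^] (m::nat)) u = u" for m u
    by (induction m arbitrary: u) (auto simp: act_one act_mult z)
  show ?thesis
  proof (cases k rule: int_cases2)
    case (nonneg j)
    then show ?thesis using nat[of j u] by (simp add: k int_pow_int)
  next
    case (nonpos j)
    then show ?thesis using nat[of j u] act_inv(1)[of "z [^] j" u] by (simp add: k int_pow_neg_int)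
  qed
qed

lemma Z_torsion_free:
  assumes w: "w \<in> Z" "w \<noteq> \<one>" and m: "0 < m"
  shows "w [^] (m::nat) \<noteq> \<one>"
proof
  assume e: "w [^] m = \<one>"
  obtain k :: int where k: "w = z [^] k" using w by (auto simp: Z_def)
  have ht_one: "ht \<one> = 0" using ht_mult[of \<one> \<one>] by simp
  have ht_inv: "ht (inv x) = - ht x" if "x \<in> carrier G" for x
    using ht_mult[of x "inv x"] that ht_one by simp
  have ht_pow: "ht (x [^] (j::nat)) = int j * ht x" if "x \<in> carrier G" for x j
    by (induction j) (auto simp: ht_one ht_mult that algebra_simps)
  have htz: "ht z = int n" unfolding z_def using ht_pow[OF b] by (simp add: ht_b)
  have "ht w = k * int n"
  proof (cases k rule: int_cases2)
    case (nonneg j)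
    then show ?thesis using ht_pow[OF z_closed, of j] by (simp add: k int_pow_int htz)
  next
    case (nonpos j)
    then show ?thesis using ht_pow[OF z_closed, of j] ht_inv[of "z [^] j"] by (simp add: k int_pow_neg_int htz)
  qed
  moreover have "int m * ht w = 0" using ht_pow[of w m] e ht_one w Z_subset by auto
  ultimately have "k = 0" using m n by auto
  then show False using w k by simp
qed

text \<open>Alternating products that begin and end with a power of \<open>b\<close>: these send the complement of \<open>C\<close> into \<open>C\<close>.\<close>

inductive_set syllables :: "'a set" where
  single: "0 < j \<Longrightarrow> j < n \<Longrightarrow> b [^] (j::nat) \<in> syllables"
| snoc: "h \<in> syllables \<Longrightarrow> p \<noteq> 0 \<Longrightarrow> 0 < j \<Longrightarrow> j < n \<Longrightarrow> h \<otimes> a [^] (p::int) \<otimes> b [^] (j::nat) \<in> syllables"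

lemma syllables_closed [simp]: "h \<in> syllables \<Longrightarrow> h \<in> carrier G"
  by (induction rule: syllables.induct) (auto simp: a b)

lemma syllables_pong: "h \<in> syllables \<Longrightarrow> u \<notin> C \<Longrightarrow> act h u \<in> C"
proof (induction arbitrary: u rule: syllables.induct)
  case (single j)
  then show ?case by (simp add: act_nat_pow B_pong)
next
  case (snoc h p j)
  then have "A p (B (int j) u) \<notin> C" by (intro A_pong B_pong) auto
  then show ?case using snoc by (simp add: act_mult act_nat_pow act_int_pow a b)
qed

text \<open>The last exponent of \<open>b\<close> grows by one; if it reaches \<open>n\<close>, the central element \<open>z\<close> splits off.\<close>

lemma syllables_mult_b:
  assumes "h \<in> syllables"
  shows "h \<otimes> b \<in> syllables \<or> h \<otimes> b = z \<or> (\<exists>h'\<in>syllables. \<exists>p::int. h \<otimes> b = z \<otimes> (h' \<otimes> a [^] p))"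
  using assms
proof (cases rule: syllables.cases)
  case (single j)
  show ?thesis
  proof (cases "Suc j < n")
    case True
    then show ?thesis using syllables.single[of "Suc j"] by (simp add: single)
  next
    case False
    then have "Suc j = n" using single by simp
    then show ?thesis by (auto simp: single z_def)
  qed
next
  case (snoc h' p j)
  have eq: "h \<otimes> b = h' \<otimes> a [^] p \<otimes> b [^] Suc j" using snoc a b by (simp add: m_assoc)
  show ?thesis
  proof (cases "Suc j < n")
    case True
    then show ?thesis unfolding eq using syllables.snoc[of h' p "Suc j"] snoc by blast
  next
    case False
    then have "Suc j = n" using snoc by simp
    then have "h \<otimes> b = z \<otimes> (h' \<otimes> a [^] p)"
      unfolding eq using z_central[of "h' \<otimes> a [^] p"] snoc a by (simp add: z_def)
    then show ?thesis using snoc by blast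
  qed
qed

definition normal_form :: "'a \<Rightarrow> bool" where
  "normal_form x \<longleftrightarrow> (\<exists>w\<in>Z. \<exists>p::int. x = w \<otimes> a [^] p) \<or>
     (\<exists>w\<in>Z. \<exists>h\<in>syllables. \<exists>(p::int) (q::int). x = w \<otimes> (a [^] p \<otimes> h \<otimes> a [^] q))"

lemma normal_formI:
  "w \<in> Z \<Longrightarrow> normal_form (w \<otimes> a [^] (p::int))"
  "w \<in> Z \<Longrightarrow> h \<in> syllables \<Longrightarrow> normal_form (w \<otimes> (a [^] (p::int) \<otimes> h \<otimes> a [^] (q::int)))"
  unfolding normal_form_def by blast+

lemma normal_form_mult_a:
  assumes "normal_form x"
  shows "normal_form (x \<otimes> a [^] (r::int))"
  using assms unfolding normal_form_def[of x]
proof (elim disjE bexE exE)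
  fix w p assume w: "w \<in> Z" "x = w \<otimes> a [^] (p::int)"
  have "x \<otimes> a [^] r = w \<otimes> a [^] (p + r)"
    using w Z_subset a by (auto simp: m_assoc int_pow_mult)
  then show ?thesis using normal_formI(1)[OF w(1)] by simp
next
  fix w h p q assume w: "w \<in> Z" "h \<in> syllables" "x = w \<otimes> (a [^] (p::int) \<otimes> h \<otimes> a [^] (q::int))"
  have "x \<otimes> a [^] r = w \<otimes> (a [^] p \<otimes> h \<otimes> a [^] (q + r))"
    using w Z_subset a by (auto simp: m_assoc int_pow_mult)
  then show ?thesis using normal_formI(2)[OF w(1,2)] by simp
qed

lemma normal_form_mult_Z:
  assumes "normal_form x" "v \<in> Z"
  shows "normal_form (v \<otimes> x)"
  using assms(1) unfolding normal_form_def[of x]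
proof (elim disjE bexE exE)
  fix w p assume w: "w \<in> Z" "x = w \<otimes> a [^] (p::int)"
  have "v \<otimes> x = (v \<otimes> w) \<otimes> a [^] p"
    using w(2-) subsetD[OF Z_subset w(1)] subsetD[OF Z_subset assms(2)] a by (simp add: m_assoc)
  then show ?thesis using normal_formI(1)[OF Z_mult[OF assms(2) w(1)]] by simp
next
  fix w h p q assume w: "w \<in> Z" "h \<in> syllables" "x = w \<otimes> (a [^] (p::int) \<otimes> h \<otimes> a [^] (q::int))"
  have "v \<otimes> x = (v \<otimes> w) \<otimes> (a [^] p \<otimes> h \<otimes> a [^] q)"
    using w(2-) subsetD[OF Z_subset w(1)] subsetD[OF Z_subset assms(2)] a by (simp add: m_assoc)
  then show ?thesis using normal_formI(2)[OF Z_mult[OF assms(2) w(1)] w(2)] by simp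
qed

lemma normal_form_mult_b:
  assumes "normal_form x"
  shows "normal_form (x \<otimes> b)"
  using assms unfolding normal_form_def[of x]
proof (elim disjE bexE exE)
  fix w p assume w: "w \<in> Z" "x = w \<otimes> a [^] (p::int)"
  have wS: "w \<in> carrier G" using w Z_subset by auto
  have "b [^] (1::nat) \<in> syllables" by (rule syllables.single) (use n in auto)
  then have "b \<in> syllables" using b by simp
  moreover have "x \<otimes> b = w \<otimes> (a [^] p \<otimes> b \<otimes> a [^] (0::int))"
    using w wS a b by (simp add: m_assoc)
  ultimately show ?thesis by (simp only: normal_formI(2)[OF w(1)])
next
  fix w h p q assume w: "w \<in> Z" "h \<in> syllables" "x = w \<otimes> (a [^] (p::int) \<otimes> h \<otimes> a [^] (q::int))"
  have wS: "w \<in> carrier G" using w Z_subset by auto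
  note hS = syllables_closed[OF w(2)]
  show ?thesis
  proof (cases "q = 0")
    case False
    have "h \<otimes> a [^] q \<otimes> b [^] (1::nat) \<in> syllables"
      by (rule syllables.snoc) (use w n False in auto)
    then have "h \<otimes> a [^] q \<otimes> b \<in> syllables" using b by simp
    moreover have "x \<otimes> b = w \<otimes> (a [^] p \<otimes> (h \<otimes> a [^] q \<otimes> b) \<otimes> a [^] (0::int))"
      using w(3) wS hS a b by (simp add: m_assoc)
    ultimately show ?thesis by (simp only: normal_formI(2)[OF w(1)])
  next
    case True
    have xb: "x \<otimes> b = w \<otimes> (a [^] p \<otimes> (h \<otimes> b))"
      using w(3) wS hS a b True by (simp add: m_assoc)
    from syllables_mult_b[OF w(2)] show ?thesis
    proof (elim disjE bexE exE)
      assume hb: "h \<otimes> b \<in> syllables"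
      have "x \<otimes> b = w \<otimes> (a [^] p \<otimes> (h \<otimes> b) \<otimes> a [^] (0::int))"
        unfolding xb using a b hS by simp
      then show ?thesis by (simp only: normal_formI(2)[OF w(1) hb])
    next
      assume hb: "h \<otimes> b = z"
      have "x \<otimes> b = z \<otimes> (w \<otimes> a [^] p)"
        unfolding xb hb using z_central[of "w \<otimes> a [^] p"] wS a by (simp add: m_assoc)
      then show ?thesis using normal_form_mult_Z[OF normal_formI(1)[OF w(1)] z_in_Z] by simp
    next
      fix h' r assume h': "h' \<in> syllables" and hb: "h \<otimes> b = z \<otimes> (h' \<otimes> a [^] (r::int))"
      have c: "h' \<otimes> a [^] r \<in> carrier G" using h' a by simp
      have "x \<otimes> b = w \<otimes> (a [^] p \<otimes> z) \<otimes> (h' \<otimes> a [^] r)"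
        unfolding xb hb using wS a c by (simp add: m_assoc)
      also have "a [^] p \<otimes> z = z \<otimes> a [^] p" using z_central[of "a [^] p"] a by simp
      also have "w \<otimes> (z \<otimes> a [^] p) = z \<otimes> (w \<otimes> a [^] p)"
        using z_central[OF wS] wS a by (simp add: m_assoc[symmetric])
      also have "z \<otimes> (w \<otimes> a [^] p) \<otimes> (h' \<otimes> a [^] r) = z \<otimes> (w \<otimes> (a [^] p \<otimes> h' \<otimes> a [^] r))"
        using wS a h' by (simp add: m_assoc)
      finally show ?thesis using normal_form_mult_Z[OF normal_formI(2)[OF w(1) h'] z_in_Z] by simp
    qed
  qed
qed

text \<open>Closure under \<open>inv b\<close> comes for free, as it is \<open>b\<close> to the power \<open>n - 1\<close> up to an element of \<open>Z\<close>.\<close>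

lemma normal_form_exists: "x \<in> carrier G \<Longrightarrow> normal_form x"
proof (rule generated[of normal_form])
  show "normal_form \<one>" using normal_formI(1)[OF one_in_Z, of 0] by simp
  fix x assume x: "x \<in> carrier G" and nf: "normal_form x"
  have 1: "normal_form (x \<otimes> a)" using normal_form_mult_a[OF nf, of 1] a by simp
  have 2: "normal_form (x \<otimes> inv a)" using normal_form_mult_a[OF nf, of "-1"] a by (simp add: int_pow_neg)
  have pow: "normal_form (x \<otimes> b [^] (k::nat))" for k
  proof (induction k)
    case (Suc k)
    then show ?case using normal_form_mult_b[OF Suc] x b by (simp add: m_assoc)
  qed (use nf x in simp)
  have "b [^] (n - 1) \<otimes> b = z" using n b by (simp add: z_def flip: nat_pow_Suc)
  then have "b [^] (n - 1) = z \<otimes> inv b" using b by (metis inv_solve_right nat_pow_closed z_closed)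
  then have "inv z \<otimes> (x \<otimes> b [^] (n - 1)) = inv z \<otimes> (z \<otimes> x) \<otimes> inv b"
    using x b z_central[OF x] by (simp add: m_assoc)
  also have "\<dots> = x \<otimes> inv b" using x b by (simp add: m_assoc[symmetric])
  finally have 3: "normal_form (x \<otimes> inv b)"
    using normal_form_mult_Z[OF pow[of "n - 1"] inv_z_in_Z] by simp
  show "normal_form (x \<otimes> a) \<and> normal_form (x \<otimes> inv a) \<and> normal_form (x \<otimes> b) \<and> normal_form (x \<otimes> inv b)"
    using 1 2 3 normal_form_mult_b[OF nf] by blast
qed

text \<open>A power of \<open>a\<close> always moves \<open>C\<close> off itself.  Otherwise \<open>g\<close> acts as \<open>a\<^sup>p h a\<^sup>q\<close> with \<open>h\<close> in \<open>syllables\<close>, and conjugation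
  by \<open>a\<^sup>m\<close> turns the outer exponents into \<open>m + p\<close> and \<open>q - m\<close>.  When both are nonzero, the three
  factors move \<open>C\<close> out, in and out again.\<close>

lemma eventually_pong:
  assumes g: "g \<in> carrier G" "g \<notin> Z"
  shows "finite {m::nat. \<exists>u\<in>C. A (int m) (act g (A (- int m) u)) \<in> C}"
proof -
  have Am: "A k (A l u) = A (k + l) u" for k l u by (simp add: A_add)
  from normal_form_exists[OF g(1)] show ?thesis
    unfolding normal_form_def
  proof (elim disjE bexE exE)
    fix w p assume w: "w \<in> Z" "g = w \<otimes> a [^] (p::int)"
    have wS: "w \<in> carrier G" using w Z_subset by auto
    have p: "p \<noteq> 0" using g w wS by auto
    have "act g u = A p u" for u using w wS a by (simp add: act_mult act_Z act_int_pow)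
    then have "A (int m) (act g (A (- int m) u)) = A p u" for m u by (simp add: Am)
    then have "{m::nat. \<exists>u\<in>C. A (int m) (act g (A (- int m) u)) \<in> C} = {}" using A_pong[OF p] by auto
    then show ?thesis by simp
  next
    fix w h p q assume w: "w \<in> Z" "h \<in> syllables" "g = w \<otimes> (a [^] (p::int) \<otimes> h \<otimes> a [^] (q::int))"
    have wS: "w \<in> carrier G" using w Z_subset by auto
    note hS = syllables_closed[OF w(2)]
    have "act g u = A p (act h (A q u))" for u using w wS hS a by (simp add: act_mult act_Z act_int_pow)
    then have eq: "A (int m) (act g (A (- int m) u)) = A (int m + p) (act h (A (q - int m) u))" for m u
      by (simp add: Am)
    \<comment> \<open>Only \<open>m = q\<close> and \<open>m = - p\<close> cancel one of the outer powers of \<open>a\<close>.\<close>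
    have "{m::nat. \<exists>u\<in>C. A (int m) (act g (A (- int m) u)) \<in> C} \<subseteq> {nat q, nat (- p)}"
    proof
      fix m assume "m \<in> {m::nat. \<exists>u\<in>C. A (int m) (act g (A (- int m) u)) \<in> C}"
      then obtain u where u: "u \<in> C" "A (int m + p) (act h (A (q - int m) u)) \<in> C" by (auto simp: eq)
      have "q - int m = 0 \<or> int m + p = 0"
        using A_pong[of "int m + p"] A_pong[of "q - int m" u] syllables_pong[OF w(2)] u by blast
      then show "m \<in> {nat q, nat (- p)}" by auto
    qed
    then show ?thesis using finite_subset by blast
  qed
qed

text \<open>Choose \<open>m\<close> such that conjugation by \<open>a\<^sup>m\<close> makes all of \<open>F\<close> move the ping-pong set \<open>C\<close> off itself, and pull \<open>C\<close> back
  along the orbit map \<open>x \<mapsto> a\<^sup>m x \<cdot> 0\<close>.  The translations \<open>b a\<^sup>i\<^sup>+\<^sup>1 b a\<^sup>m\<close> then take the complement into the sets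
  \<open>b a\<^sup>i\<^sup>+\<^sup>1 C\<close>, which are disjoint because nonzero powers of \<open>a\<close> move \<open>C\<close> off itself.\<close>

lemma relative_powers_Z: "relative_powers G Z"
  unfolding relative_powers_def
proof (intro allI impI, elim conjE)
  fix F and N :: nat assume F: "finite F" "F \<subseteq> carrier G - Z"
  have "finite (\<Union>f\<in>F. {m::nat. \<exists>u\<in>C. A (int m) (act f (A (- int m) u)) \<in> C})"
    using F by (intro finite_UN_I eventually_pong) auto
  then obtain m :: nat where "m \<notin> (\<Union>f\<in>F. {m::nat. \<exists>u\<in>C. A (int m) (act f (A (- int m) u)) \<in> C})"
    using ex_new_if_finite infinite_UNIV_nat by blast
  then have m: "A (int m) (act f (A (- int m) u)) \<notin> C" if "f \<in> F" "u \<in> C" for f u using that by blast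
  define \<nu> where "\<nu> x = A (int m) (act x 0)" for x
  define D where "D = {x \<in> carrier G. \<nu> x \<in> C}"
  define g where "g i = b \<otimes> a [^] Suc i \<otimes> b \<otimes> a [^] m" for i
  have gS: "g i \<in> carrier G" for i using a b by (simp add: g_def)
  have g_act: "act (b \<otimes> a [^] k \<otimes> b \<otimes> a [^] m \<otimes> x) 0 = B 1 (A (int k) (B 1 (\<nu> x)))"
    if "x \<in> carrier G" for k :: nat and x
    unfolding \<nu>_def using that a b by (simp add: act_mult act_nat_pow act_b)
  have move: "f \<otimes> x \<notin> D" if f: "f \<in> F" and x: "x \<in> D" for f x
  proof -
    have S: "f \<in> carrier G" "x \<in> carrier G" using f x F by (auto simp: D_def)
    have "act x 0 = A (- int m) (\<nu> x)" by (simp add: \<nu>_def A_add[symmetric] A_zero)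
    then have "\<nu> (f \<otimes> x) = A (int m) (act f (A (- int m) (\<nu> x)))"
      using S by (simp add: \<nu>_def[of "f \<otimes> x"] act_mult)
    then show ?thesis using m[OF f, of "\<nu> x"] x by (simp add: D_def)
  qed
  have disj: "g i \<otimes> x \<noteq> g j \<otimes> y"
    if ij: "i \<noteq> j" and x: "x \<in> carrier G - D" and y: "y \<in> carrier G - D" for i j x y
  proof
    assume e: "g i \<otimes> x = g j \<otimes> y"
    have C: "B 1 (\<nu> x) \<in> C" "B 1 (\<nu> y) \<in> C" using x y n by (auto simp: D_def intro!: B_pong)
    have "B 1 (A (int (Suc i)) (B 1 (\<nu> x))) = B 1 (A (int (Suc j)) (B 1 (\<nu> y)))"
      using e x y g_act[of x "Suc i"] g_act[of y "Suc j"] unfolding g_def by simp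
    then have "B (-1) (B 1 (A (int (Suc i)) (B 1 (\<nu> x)))) = B (-1) (B 1 (A (int (Suc j)) (B 1 (\<nu> y))))" by simp
    then have "A (int (Suc i)) (B 1 (\<nu> x)) = A (int (Suc j)) (B 1 (\<nu> y))"
      unfolding B_add[symmetric] by (simp add: B_zero)
    then have "A (- int (Suc j)) (A (int (Suc i)) (B 1 (\<nu> x))) = A (- int (Suc j)) (A (int (Suc j)) (B 1 (\<nu> y)))" by simp
    then have "A (int i - int j) (B 1 (\<nu> x)) = B 1 (\<nu> y)"
      unfolding A_add[symmetric] by (simp add: A_zero)
    then show False using A_pong[of "int i - int j" "B 1 (\<nu> x)"] C ij by simp
  qed
  show "\<exists>C g. C \<subseteq> carrier G \<and> (\<forall>i<N. g i \<in> carrier G) \<and> (\<forall>f\<in>F. \<forall>x\<in>C. f \<otimes> x \<notin> C) \<and>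
      (\<forall>i<N. \<forall>j<N. i \<noteq> j \<longrightarrow> (\<forall>x\<in>carrier G - C. \<forall>y\<in>carrier G - C. g i \<otimes> x \<noteq> g j \<otimes> y))"
    by (rule exI[of _ D], rule exI[of _ g]) (use gS move disj in \<open>auto simp: D_def\<close>)
qed

end


section \<open>The Baumslag-Solitar group\<close>

lemma group_BS: "group (BS m n)"
  unfolding BS_def by (rule presented_group)

text \<open>The integers act by translation on themselves, and modulo \<open>n\<close> on \<open>{0..<n}\<close>.  The first action is
  induced from the even numbers \<open>C\<close> and the second from the odd ones, which makes them a ping-pong
  pair; \<open>b\<^sup>n\<close> acts trivially, so the defining relation is respected.\<close>

lemma BS_ping_pong:
  assumes n: "n \<ge> 2"
  shows "\<exists>a b act ht A B C. ping_pong (BS n n) a b n act ht A B C"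
proof -
  define R :: "(bs_gen word \<times> bs_gen word) set" where
    "R = {([(BS_a, True)] @ replicate n (BS_b, True), replicate n (BS_b, True) @ [(BS_a, True)])}"
  have G: "BS n n = presented_group R" by (simp add: BS_def R_def)
  interpret group "presented_group R" by (rule presented_group)
  let ?G = "presented_group R"
  let ?cl = "pres_class R"
  define C where "C = {x::nat. even x}"
  obtain A :: "int \<Rightarrow> nat \<Rightarrow> nat" where A_add: "\<And>k l x. A (k + l) x = A k (A l x)"
    and A_id: "\<And>k x. (\<And>i. i \<in> UNIV \<Longrightarrow> i + k = i) \<Longrightarrow> A k x = x"
    and A_pong: "\<And>k x. 0 + k \<noteq> 0 \<Longrightarrow> x \<in> C \<Longrightarrow> A k x \<notin> C"
  proof (rule induced_action[of UNIV C "\<lambda>k i. i + k"])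
    show "(UNIV :: int set) \<noteq> {0}" by (metis UNIV_I singletonD zero_neq_one)
  qed (use infinite_evens in \<open>auto simp: C_def\<close>)
  obtain B :: "int \<Rightarrow> nat \<Rightarrow> nat" where B_add: "\<And>k l x. B (k + l) x = B k (B l x)"
    and B_id: "\<And>k x. (\<And>i. i \<in> {0..<int n} \<Longrightarrow> (i + k) mod int n = i) \<Longrightarrow> B k x = x"
    and B_pong: "\<And>k x. (0 + k) mod int n \<noteq> 0 \<Longrightarrow> x \<in> - C \<Longrightarrow> B k x \<notin> - C"
  proof (rule induced_action[of "{0..<int n}" "- C" "\<lambda>k i. (i + k) mod int n"])
    show "0 \<in> {0..<int n}" using n by simp
    have "1 \<in> {0..<int n}" using n by simp
    then show "{0..<int n} \<noteq> {0}" by force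
  qed (use infinite_evens n in \<open>auto simp: C_def mod_simps algebra_simps\<close>)
  have A0: "A 0 x = x" and B0: "B 0 x = x" and Bn: "B (int n) x = x" for x
    by (rule A_id; simp) (rule B_id; simp)+
  \<comment> \<open>The letters act by \<open>f\<close> on the ping-pong set, and by \<open>h\<close> on the integers as shifts that count \<open>b\<close>.\<close>
  define f :: "bs_gen \<times> bool \<Rightarrow> nat \<Rightarrow> nat" where
    "f l = (case l of (BS_a, e) \<Rightarrow> A (if e then 1 else -1) | (BS_b, e) \<Rightarrow> B (if e then 1 else -1))" for l
  define h :: "bs_gen \<times> bool \<Rightarrow> int \<Rightarrow> int" where
    "h l = (case l of (BS_a, e) \<Rightarrow> id | (BS_b, e) \<Rightarrow> (\<lambda>i. i + (if e then 1 else -1)))" for l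
  have f_inv: "f (s, e) \<circ> f (s, \<not> e) = id" for s e
    by (cases s; cases e) (auto simp: f_def fun_eq_iff A_add[symmetric] B_add[symmetric] A0 B0)
  have h_inv: "h (s, e) \<circ> h (s, \<not> e) = id" for s e
    by (cases s; cases e) (auto simp: h_def fun_eq_iff)
  have f_rep: "word_action f (replicate k (BS_b, True)) = B (int k)" for k
    by (induction k) (auto simp: fun_eq_iff B0 f_def B_add[symmetric])
  have h_shift: "word_action h w i = i + word_action h w 0" for w i
  proof (induction w arbitrary: i)
    case (Cons l w)
    have "h l j = j + h l 0" for j by (cases l; cases "fst l") (auto simp: h_def)
    then show ?case using Cons.IH by (metis (no_types, opaque_lifting) add.assoc comp_apply word_action_simps(2))
  qed simp
  have f_rel: "word_action f u = word_action f v" if "(u, v) \<in> R" for u v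
    using that Bn by (auto simp: R_def word_action_append f_rep fun_eq_iff)
  have h_rel: "word_action h u = word_action h v" if "(u, v) \<in> R" for u v
    using that by (auto simp: R_def word_action_append h_def fun_eq_iff)
  note fc = group_action_class[OF f_inv f_rel] and hc = group_action_class[OF h_inv h_rel]
  define a where "a = ?cl [(BS_a, True)]"
  define b where "b = ?cl [(BS_b, True)]"
  have inv: "inv\<^bsub>?G\<^esub> (?cl [(s, True)]) = ?cl [(s, False)]" for s
  proof (rule inv_equality)
    have "pres_eq R [(s, False), (s, \<not> False)] []" by (rule pres_cancel)
    then show "?cl [(s, False)] \<otimes>\<^bsub>?G\<^esub> ?cl [(s, True)] = \<one>\<^bsub>?G\<^esub>"
      by (simp add: presented_group_mult presented_group_one pres_class_eq_iff)
  qed (auto simp: presented_group_carrier)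
  have b_pow: "b [^]\<^bsub>?G\<^esub> k = ?cl (replicate k (BS_b, True))" for k :: nat
    by (induction k) (simp_all add: b_def presented_group_one presented_group_mult replicate_append_same)
  have "ping_pong ?G a b n (group_action f) (\<lambda>X. group_action h X 0) A B C"
  proof (unfold_locales)
    show "2 \<le> n" by (rule n)
    show "a \<in> carrier ?G" "b \<in> carrier ?G" by (simp_all add: a_def b_def presented_group_carrier)
    have "pres_eq R ([(BS_a, True)] @ replicate n (BS_b, True)) (replicate n (BS_b, True) @ [(BS_a, True)])"
      by (rule pres_rel) (simp add: R_def)
    then show "a \<otimes>\<^bsub>?G\<^esub> b [^]\<^bsub>?G\<^esub> n = b [^]\<^bsub>?G\<^esub> n \<otimes>\<^bsub>?G\<^esub> a"
      unfolding b_pow a_def presented_group_mult pres_class_eq_iff .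
  next
    fix P x
    assume one: "P \<one>\<^bsub>?G\<^esub>" and x: "x \<in> carrier ?G"
      and step: "\<And>x. x \<in> carrier ?G \<Longrightarrow> P x \<Longrightarrow> P (x \<otimes>\<^bsub>?G\<^esub> a) \<and> P (x \<otimes>\<^bsub>?G\<^esub> inv\<^bsub>?G\<^esub> a) \<and>
        P (x \<otimes>\<^bsub>?G\<^esub> b) \<and> P (x \<otimes>\<^bsub>?G\<^esub> inv\<^bsub>?G\<^esub> b)"
    have "P (?cl w)" for w
    proof (induction w rule: rev_induct)
      case Nil
      show ?case using one by (simp add: presented_group_one)
    next
      case (snoc l w)
      have c: "?cl w \<in> carrier ?G" by (simp add: presented_group_carrier)
      obtain s e where l: "l = (s, e)" by (cases l)
      have "?cl (w @ [l]) = ?cl w \<otimes>\<^bsub>?G\<^esub> ?cl [(s, e)]" by (simp add: l presented_group_mult)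
      then show ?case using step[OF c snoc] by (cases s; cases e) (simp_all add: a_def b_def inv)
    qed
    then show "P x" using x by (auto simp: presented_group_carrier)
  next
    fix x y u assume "x \<in> carrier ?G" "y \<in> carrier ?G"
    then show "group_action f (x \<otimes>\<^bsub>?G\<^esub> y) u = group_action f x (group_action f y u)"
      by (auto simp: presented_group_carrier presented_group_mult fc word_action_append)
  next
    fix u show "group_action f \<one>\<^bsub>?G\<^esub> u = u" by (simp add: presented_group_one fc)
    show "group_action f a u = A 1 u" "group_action f b u = B 1 u" by (simp_all add: a_def b_def fc f_def)
  next
    fix k :: int and u assume "k \<noteq> 0" "u \<in> C" then show "A k u \<notin> C" using A_pong by simp
  next
    fix k u assume "0 < k" "k < int n" "u \<notin> C" then show "B k u \<in> C" using B_pong[of k u] by simp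
  next
    fix x y assume "x \<in> carrier ?G" "y \<in> carrier ?G"
    then obtain u v where uv: "x = ?cl u" "y = ?cl v" by (auto simp: presented_group_carrier)
    show "group_action h (x \<otimes>\<^bsub>?G\<^esub> y) 0 = group_action h x 0 + group_action h y 0"
      using h_shift[of u "word_action h v 0"]
      by (simp add: uv presented_group_mult hc word_action_append)
  next
    show "group_action h b 0 = 1" by (simp add: b_def hc h_def)
  qed (rule A_add A0 B_add B0 Bn)+
  then show ?thesis unfolding G by blast
qed

lemma BS_kleppner_iff:
  assumes n: "n \<ge> 2" and \<sigma>: "\<sigma> \<in> two_cocycles (BS n n)"
  shows "kleppner_condition (BS n n) \<sigma> \<longleftrightarrow> twisted_cstar_simple (BS n n) \<sigma>"
    and "kleppner_condition (BS n n) \<sigma> \<longleftrightarrow> unique_trace_property (BS n n) \<sigma>"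
proof -
  obtain a b act ht A B C where "ping_pong (BS n n) a b n act ht A B C"
    using BS_ping_pong[OF n] by blast
  then interpret pp: ping_pong "BS n n" a b n act ht A B C .
  interpret relative_powers_group "BS n n" \<sigma> pp.Z
  proof unfold_locales
    show "\<sigma> \<in> two_cocycles (BS n n)" by (rule \<sigma>)
    show "pp.Z \<subseteq> carrier (BS n n)" by (rule pp.Z_subset)
    show "relative_powers (BS n n) pp.Z" by (rule pp.relative_powers_Z)
  qed (use pp.Z_central pp.Z_torsion_free in auto)
  show "kleppner_condition (BS n n) \<sigma> \<longleftrightarrow> twisted_cstar_simple (BS n n) \<sigma>"
    and "kleppner_condition (BS n n) \<sigma> \<longleftrightarrow> unique_trace_property (BS n n) \<sigma>"
    by (rule kleppner_iff_simple_and_unique_trace)+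
qed

theorem proposition5p17:
  fixes n :: nat
  assumes "n \<ge> 2"
  shows "(\<forall>\<sigma>\<in>two_cocycles (BS n n).
            (kleppner_condition (BS n n) \<sigma> \<longleftrightarrow> twisted_cstar_simple (BS n n) \<sigma>) \<and>
            (twisted_cstar_simple (BS n n) \<sigma> \<longleftrightarrow> unique_trace_property (BS n n) \<sigma>))
         \<and> class_K (BS n n)"
  unfolding class_K_def using group_BS BS_kleppner_iff[OF assms] by blast

end
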